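(* The inner and outer morphisms form a factorization system in $\mathbf{pOpeCard}_\omega$. So any $\omega$-functor $f:S^*\to T^*$ between $\omega$-categories generated by positive opetopic cardinals $S,T$ can be factored, essentially uniquely, as an inner map $S^*\to f(S)^*$ followed by an outer map $f(S)^*\to T^*$.
   Context: **Positive hypergraphs.** A positive hypergraph $S$ is a family $(S_k)_{k\in\omega}$ of finite sets of faces (pairwise disjoint, only finitely many non-empty), functions $\gamma:S_{k+1}\to S_k$ and, for each $a\in S_{k+1}$, a non-empty set $\delta(a)\subseteq S_k$, where $\delta(a)$ is a singleton for $a\in S_1$. A morphism $f:S\to T$ is a family of functions $f_k:S_k\to T_k$ commuting with $\gamma$ and such that for every $a$ of dimension $\ge1$, $f$ restricts to a bijection $\delta(a)\to\delta(f(a))$. For a set $A$ of faces, $\delta(A)=\bigcup_{a\in A}\delta(a)$, $\gamma(A)=\{\gamma(a):a\in A\}$; singletons are identified with elements. For $a$ of dimension $\ge 2$, $\iota(a)=\delta\delta(a)\cap\gamma\delta(a)$, and $\iota(A)=\bigcup_{a\in A}\iota(a)$. On $S_k$: $<^-$ is the transitive closure of the relation "$\gamma(a)\in\delta(b)$" (empty for $k=0$); $<^+$ is the transitive closure of the relation "there is $\alpha\in S_{k+1}$ with $a\in\delta(\alpha)$, $\gamma(\alpha)=b$"; $a\perp^{\pm}b$ means $a<^{\pm}b$ or $b<^{\pm}a$. **Positive opetopic cardinals.** A positive hypergraph $S$ with $S_0\ne\emptyset$ is a positive opetopic cardinal if: (globularity) for all $a$ of dimension $\ge2$, $\gamma\gamma(a)=\gamma\delta(a)-\delta\delta(a)$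 and $\delta\gamma(a)=\delta\delta(a)-\gamma\delta(a)$; (strictness) $<^+$ is a strict order on each $S_k$, and linear on $S_0$; (disjointness) for $k>0$ no two faces $a,b\in S_k$ satisfy both $a\perp^+b$ and $a\perp^-b$; (pencil linearity) for $k>0$ and $x\in S_{k-1}$ the sets $\{a\in S_k: x=\gamma(a)\}$ and $\{a\in S_k:x\in\delta(a)\}$ are linearly ordered by $<^+$. $\dim(S)$ is the largest $k$ with $S_k\neq\emptyset$. $\mathbf{pOpeCard}$ is the full subcategory of positive hypergraphs on these. **The $\omega$-category $S^*$.** For $S$ in $\mathbf{pOpeCard}$ and $k\in\omega$, $\mathbf d^{(k)}S\subseteq S$ has faces $S_l$ for $l<k$, $S_k-\gamma(S_{k+1})$ in dimension $k$, none above; $\mathbf c^{(k)}S\subseteq S$ has faces $S_l$ for $l<k-1$, $S_{k-1}-\iota(S_{k+1})$ in dimension $k-1$ (if $k>0$), $S_k-\delta(S_{k+1})$ in dimension $k$, none above. $S^*$ is the $\omega$-category whose $n$-cells are the positive opetopic cardinals of dimension $\le n$ contained in $S$ (as subhypergraphs, i.e. subsets of faces closed under $\gamma,\delta$), with $k$-th domain and codomain $\mathbf d^{(k)},\mathbf c^{(k)}$, identities given by inclusion, and $k$-composition of $X,Y$ with $\mathbf c^{(k)}X=\mathbf d^{(k)}Y$ given by $X\cup Y$. A morphism $g:S\to T$ induces $g^*:S^*\to T^*$, $X\mapsto g(X)$. $\mathbf{pOpeCard}_\omega$ is the full subcategory of the category of $\omega$-categories on the objects $S^*$; its morphisms are all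 $\omega$-functors. **Inner and outer maps.** An $\omega$-functor $f:S^*\to T^*$ is outer if $f=g^*$ for some morphism $g:S\to T$ of positive opetopic cardinals; it is inner if $f_{\dim(S)}(S)=T$, i.e. it sends the cell $S$ to the cell $T$. For arbitrary $f:S^*\to T^*$, $f(S)$ denotes the cell $f_{\dim(S)}(S)$ of $T^*$, which is a positive opetopic cardinal contained in $T$. *)

theory Defs
  imports Main "HOL-Library.FuncSet"
begin

section \<open>Positive hypergraphs\<close>

text \<open>
  The sets of faces of different dimensions are disjoint, so one function \<open>\<gamma>\<close> and one function
  \<open>\<delta>\<close> serve all dimensions. Their values off the faces of positive dimension carry no meaning.
\<close>

record 'a hypergraph =
  faces :: "nat \<Rightarrow> 'a set"
  gam :: "'a \<Rightarrow> 'a"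
  del :: "'a \<Rightarrow> 'a set"

locale positive_hypergraph =
  fixes S :: "'a hypergraph"
  assumes finite_faces: "finite (faces S k)"
    and faces_disjoint: "i \<noteq> j \<Longrightarrow> faces S i \<inter> faces S j = {}"
    and finitely_many_dims: "finite {k. faces S k \<noteq> {}}"
    and gam_face: "a \<in> faces S (Suc k) \<Longrightarrow> gam S a \<in> faces S k"
    and del_faces: "a \<in> faces S (Suc k) \<Longrightarrow> del S a \<subseteq> faces S k"
    and del_nonempty: "a \<in> faces S (Suc k) \<Longrightarrow> del S a \<noteq> {}"
    and del_singleton: "a \<in> faces S 1 \<Longrightarrow> is_singleton (del S a)"

definition hmorphism :: "'a hypergraph \<Rightarrow> 'b hypergraph \<Rightarrow> (nat \<Rightarrow> 'a \<Rightarrow> 'b) \<Rightarrow> bool" where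
  "hmorphism S T g \<longleftrightarrow>
     (\<forall>k. g k \<in> faces S k \<rightarrow> faces T k) \<and>
     (\<forall>k. \<forall>a \<in> faces S (Suc k).
        g k (gam S a) = gam T (g (Suc k) a) \<and>
        bij_betw (g k) (del S a) (del T (g (Suc k) a)))"

definition delU :: "'a hypergraph \<Rightarrow> 'a set \<Rightarrow> 'a set" where
  "delU S A = (\<Union>a\<in>A. del S a)"

definition iot :: "'a hypergraph \<Rightarrow> 'a \<Rightarrow> 'a set" where
  "iot S a = delU S (del S a) \<inter> gam S ` del S a"

definition iotU :: "'a hypergraph \<Rightarrow> 'a set \<Rightarrow> 'a set" where
  "iotU S A = (\<Union>a\<in>A. iot S a)"

definition lower :: "'a hypergraph \<Rightarrow> nat \<Rightarrow> 'a rel" where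
  "lower S k = (if k = 0 then {}
     else {(a, b). a \<in> faces S k \<and> b \<in> faces S k \<and> gam S a \<in> del S b}\<^sup>+)"

definition upper :: "'a hypergraph \<Rightarrow> nat \<Rightarrow> 'a rel" where
  "upper S k = {(a, b). \<exists>\<alpha> \<in> faces S (Suc k). a \<in> del S \<alpha> \<and> gam S \<alpha> = b}\<^sup>+"

definition perp :: "'a rel \<Rightarrow> 'a \<Rightarrow> 'a \<Rightarrow> bool" where
  "perp r a b \<longleftrightarrow> (a, b) \<in> r \<or> (b, a) \<in> r"

text \<open>The largest dimension of a face; meant for hypergraphs that have a face.\<close>

definition hdim :: "'a hypergraph \<Rightarrow> nat" where
  "hdim S = Max {k. faces S k \<noteq> {}}"


section \<open>Positive opetopic cardinals\<close>

text \<open>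
  Since \<^term>\<open>upper S k\<close> is a transitive closure, it is a strict order as soon as it is
  irreflexive, and then it orders a set linearly iff it is total on it.
\<close>

locale positive_opetopic_cardinal = positive_hypergraph S for S :: "'a hypergraph" +
  assumes nonempty: "faces S 0 \<noteq> {}"
    and globularity_gam: "a \<in> faces S (Suc (Suc k)) \<Longrightarrow>
          {gam S (gam S a)} = gam S ` del S a - delU S (del S a)"
    and globularity_del: "a \<in> faces S (Suc (Suc k)) \<Longrightarrow>
          del S (gam S a) = delU S (del S a) - gam S ` del S a"
    and strictness: "irrefl (upper S k)"
    and linearity_0: "total_on (faces S 0) (upper S 0)"
    and disjointness: "0 < k \<Longrightarrow> a \<in> faces S k \<Longrightarrow> b \<in> faces S k \<Longrightarrow>
          \<not> (perp (upper S k) a b \<and> perp (lower S k) a b)"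
    and pencil_gam: "x \<in> faces S k \<Longrightarrow>
          total_on {a \<in> faces S (Suc k). x = gam S a} (upper S (Suc k))"
    and pencil_del: "x \<in> faces S k \<Longrightarrow>
          total_on {a \<in> faces S (Suc k). x \<in> del S a} (upper S (Suc k))"


section \<open>Strict \<omega>-categories\<close>

text \<open>
  The \<open>n\<close>-cells are \<open>cells C n\<close>. For \<open>k < n\<close>, the maps \<open>cdom C n k\<close> and \<open>ccod C n k\<close> are the
  \<open>k\<close>-th domain and codomain of \<open>n\<close>-cells, \<open>cid C k n\<close> sends a \<open>k\<close>-cell to its (iterated) identity
  \<open>n\<close>-cell, and \<open>ccomp C n k x y\<close> is the \<open>k\<close>-composite, first \<open>x\<close> then \<open>y\<close>, of \<open>n\<close>-cells with
  \<open>ccod C n k x = cdom C n k y\<close>.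
\<close>

record 'c omega_data =
  cells :: "nat \<Rightarrow> 'c set"
  cdom :: "nat \<Rightarrow> nat \<Rightarrow> 'c \<Rightarrow> 'c"
  ccod :: "nat \<Rightarrow> nat \<Rightarrow> 'c \<Rightarrow> 'c"
  cid :: "nat \<Rightarrow> nat \<Rightarrow> 'c \<Rightarrow> 'c"
  ccomp :: "nat \<Rightarrow> nat \<Rightarrow> 'c \<Rightarrow> 'c \<Rightarrow> 'c"

locale omega_category =
  fixes C :: "'c omega_data"
  assumes dom_cell: "k < n \<Longrightarrow> x \<in> cells C n \<Longrightarrow> cdom C n k x \<in> cells C k"
    and cod_cell: "k < n \<Longrightarrow> x \<in> cells C n \<Longrightarrow> ccod C n k x \<in> cells C k"
    and id_cell: "k < n \<Longrightarrow> x \<in> cells C k \<Longrightarrow> cid C k n x \<in> cells C n"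
    and comp_cell: "k < n \<Longrightarrow> x \<in> cells C n \<Longrightarrow> y \<in> cells C n \<Longrightarrow>
          ccod C n k x = cdom C n k y \<Longrightarrow> ccomp C n k x y \<in> cells C n"
    and dom_dom: "j < k \<Longrightarrow> k < n \<Longrightarrow> x \<in> cells C n \<Longrightarrow> cdom C k j (cdom C n k x) = cdom C n j x"
    and dom_cod: "j < k \<Longrightarrow> k < n \<Longrightarrow> x \<in> cells C n \<Longrightarrow> cdom C k j (ccod C n k x) = cdom C n j x"
    and cod_dom: "j < k \<Longrightarrow> k < n \<Longrightarrow> x \<in> cells C n \<Longrightarrow> ccod C k j (cdom C n k x) = ccod C n j x"
    and cod_cod: "j < k \<Longrightarrow> k < n \<Longrightarrow> x \<in> cells C n \<Longrightarrow> ccod C k j (ccod C n k x) = ccod C n j x"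
    and dom_id: "k < n \<Longrightarrow> x \<in> cells C k \<Longrightarrow> cdom C n k (cid C k n x) = x"
    and cod_id: "k < n \<Longrightarrow> x \<in> cells C k \<Longrightarrow> ccod C n k (cid C k n x) = x"
    and id_id: "j < k \<Longrightarrow> k < n \<Longrightarrow> x \<in> cells C j \<Longrightarrow> cid C k n (cid C j k x) = cid C j n x"
    and dom_comp: "k < n \<Longrightarrow> x \<in> cells C n \<Longrightarrow> y \<in> cells C n \<Longrightarrow>
          ccod C n k x = cdom C n k y \<Longrightarrow> cdom C n k (ccomp C n k x y) = cdom C n k x"
    and cod_comp: "k < n \<Longrightarrow> x \<in> cells C n \<Longrightarrow> y \<in> cells C n \<Longrightarrow>
          ccod C n k x = cdom C n k y \<Longrightarrow> ccod C n k (ccomp C n k x y) = ccod C n k y"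
    and dom_comp_higher: "k < j \<Longrightarrow> j < n \<Longrightarrow> x \<in> cells C n \<Longrightarrow> y \<in> cells C n \<Longrightarrow>
          ccod C n k x = cdom C n k y \<Longrightarrow>
          cdom C n j (ccomp C n k x y) = ccomp C j k (cdom C n j x) (cdom C n j y)"
    and cod_comp_higher: "k < j \<Longrightarrow> j < n \<Longrightarrow> x \<in> cells C n \<Longrightarrow> y \<in> cells C n \<Longrightarrow>
          ccod C n k x = cdom C n k y \<Longrightarrow>
          ccod C n j (ccomp C n k x y) = ccomp C j k (ccod C n j x) (ccod C n j y)"
    and comp_assoc: "k < n \<Longrightarrow> x \<in> cells C n \<Longrightarrow> y \<in> cells C n \<Longrightarrow> z \<in> cells C n \<Longrightarrow>
          ccod C n k x = cdom C n k y \<Longrightarrow> ccod C n k y = cdom C n k z \<Longrightarrow>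
          ccomp C n k (ccomp C n k x y) z = ccomp C n k x (ccomp C n k y z)"
    and unit_left: "k < n \<Longrightarrow> x \<in> cells C n \<Longrightarrow> ccomp C n k (cid C k n (cdom C n k x)) x = x"
    and unit_right: "k < n \<Longrightarrow> x \<in> cells C n \<Longrightarrow> ccomp C n k x (cid C k n (ccod C n k x)) = x"
    and id_comp: "k < m \<Longrightarrow> m < n \<Longrightarrow> x \<in> cells C m \<Longrightarrow> y \<in> cells C m \<Longrightarrow>
          ccod C m k x = cdom C m k y \<Longrightarrow>
          cid C m n (ccomp C m k x y) = ccomp C n k (cid C m n x) (cid C m n y)"
    and interchange: "j < k \<Longrightarrow> k < n \<Longrightarrow>
          x \<in> cells C n \<Longrightarrow> y \<in> cells C n \<Longrightarrow> z \<in> cells C n \<Longrightarrow> w \<in> cells C n \<Longrightarrow>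
          ccod C n k x = cdom C n k y \<Longrightarrow> ccod C n k z = cdom C n k w \<Longrightarrow>
          ccod C n j x = cdom C n j z \<Longrightarrow>
          ccomp C n j (ccomp C n k x y) (ccomp C n k z w) =
          ccomp C n k (ccomp C n j x z) (ccomp C n j y w)"

text \<open>
  The components of a functor are taken extensional on the cells, so that equality of functors is
  equality of families of functions.
\<close>

locale omega_functor = dom: omega_category C + cod: omega_category D
  for C :: "'c omega_data" and D :: "'d omega_data" +
  fixes f :: "nat \<Rightarrow> 'c \<Rightarrow> 'd"
  assumes map_cells: "f n \<in> cells C n \<rightarrow>\<^sub>E cells D n"
    and map_dom: "k < n \<Longrightarrow> x \<in> cells C n \<Longrightarrow> f k (cdom C n k x) = cdom D n k (f n x)"
    and map_cod: "k < n \<Longrightarrow> x \<in> cells C n \<Longrightarrow> f k (ccod C n k x) = ccod D n k (f n x)"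
    and map_id: "k < n \<Longrightarrow> x \<in> cells C k \<Longrightarrow> f n (cid C k n x) = cid D k n (f k x)"
    and map_comp: "k < n \<Longrightarrow> x \<in> cells C n \<Longrightarrow> y \<in> cells C n \<Longrightarrow>
          ccod C n k x = cdom C n k y \<Longrightarrow> f n (ccomp C n k x y) = ccomp D n k (f n x) (f n y)"


section \<open>The \<omega>-category of a positive opetopic cardinal\<close>

definition subhypergraph :: "'a hypergraph \<Rightarrow> 'a hypergraph \<Rightarrow> bool" where
  "subhypergraph X S \<longleftrightarrow> positive_hypergraph X \<and> (\<forall>k. faces X k \<subseteq> faces S k) \<and>
     gam X = gam S \<and> del X = del S"

definition hdom :: "nat \<Rightarrow> 'a hypergraph \<Rightarrow> 'a hypergraph" where
  "hdom k X = X\<lparr>faces := (\<lambda>l.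
     if l < k then faces X l
     else if l = k then faces X k - gam X ` faces X (Suc k)
     else {})\<rparr>"

definition hcod :: "nat \<Rightarrow> 'a hypergraph \<Rightarrow> 'a hypergraph" where
  "hcod k X = X\<lparr>faces := (\<lambda>l.
     if Suc l < k then faces X l
     else if Suc l = k then faces X l - iotU X (faces X (Suc k))
     else if l = k then faces X k - delU X (faces X (Suc k))
     else {})\<rparr>"

definition hunion :: "'a hypergraph \<Rightarrow> 'a hypergraph \<Rightarrow> 'a hypergraph" where
  "hunion X Y = X\<lparr>faces := (\<lambda>l. faces X l \<union> faces Y l)\<rparr>"

definition star :: "'a hypergraph \<Rightarrow> 'a hypergraph omega_data" where
  "star S = \<lparr>
     cells = (\<lambda>n. {X. subhypergraph X S \<and> positive_opetopic_cardinal X \<and> hdim X \<le> n}),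
     cdom = (\<lambda>n k. hdom k),
     ccod = (\<lambda>n k. hcod k),
     cid = (\<lambda>k n X. X),
     ccomp = (\<lambda>n k. hunion)\<rparr>"

definition star_map ::
  "'a hypergraph \<Rightarrow> 'b hypergraph \<Rightarrow> (nat \<Rightarrow> 'a \<Rightarrow> 'b) \<Rightarrow> nat \<Rightarrow> 'a hypergraph \<Rightarrow> 'b hypergraph"
  where
  "star_map S T g = (\<lambda>n. restrict (\<lambda>X. T\<lparr>faces := (\<lambda>k. g k ` faces X k)\<rparr>) (cells (star S) n))"


section \<open>Categories and factorization systems\<close>

text \<open>\<open>Comp C X Y Z g f\<close> is the composite of \<open>f : X \<rightarrow> Y\<close> followed by \<open>g : Y \<rightarrow> Z\<close>.\<close>

record ('o, 'm) cat =
  Ob :: "'o set"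
  Hom :: "'o \<Rightarrow> 'o \<Rightarrow> 'm set"
  Id :: "'o \<Rightarrow> 'm"
  Comp :: "'o \<Rightarrow> 'o \<Rightarrow> 'o \<Rightarrow> 'm \<Rightarrow> 'm \<Rightarrow> 'm"

locale category =
  fixes C :: "('o, 'm) cat"
  assumes Id_Hom: "X \<in> Ob C \<Longrightarrow> Id C X \<in> Hom C X X"
    and Comp_Hom: "X \<in> Ob C \<Longrightarrow> Y \<in> Ob C \<Longrightarrow> Z \<in> Ob C \<Longrightarrow>
          f \<in> Hom C X Y \<Longrightarrow> g \<in> Hom C Y Z \<Longrightarrow> Comp C X Y Z g f \<in> Hom C X Z"
    and Id_left: "X \<in> Ob C \<Longrightarrow> Y \<in> Ob C \<Longrightarrow> f \<in> Hom C X Y \<Longrightarrow> Comp C X Y Y (Id C Y) f = f"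
    and Id_right: "X \<in> Ob C \<Longrightarrow> Y \<in> Ob C \<Longrightarrow> f \<in> Hom C X Y \<Longrightarrow> Comp C X X Y f (Id C X) = f"
    and Comp_assoc: "W \<in> Ob C \<Longrightarrow> X \<in> Ob C \<Longrightarrow> Y \<in> Ob C \<Longrightarrow> Z \<in> Ob C \<Longrightarrow>
          f \<in> Hom C W X \<Longrightarrow> g \<in> Hom C X Y \<Longrightarrow> h \<in> Hom C Y Z \<Longrightarrow>
          Comp C W Y Z h (Comp C W X Y g f) = Comp C W X Z (Comp C X Y Z h g) f"

definition isos :: "('o, 'm) cat \<Rightarrow> 'o \<Rightarrow> 'o \<Rightarrow> 'm set" where
  "isos C X Y = {f \<in> Hom C X Y. \<exists>g \<in> Hom C Y X.
     Comp C X Y X g f = Id C X \<and> Comp C Y X Y f g = Id C Y}"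

text \<open>
  An orthogonal factorization system: the classes \<open>E X Y\<close> and \<open>M X Y\<close> of morphisms from \<open>X\<close> to
  \<open>Y\<close> contain the isomorphisms and are closed under composition, every morphism factors as one
  in \<open>E\<close> followed by one in \<open>M\<close>, and every commuting square with an \<open>E\<close>-side and an opposite
  \<open>M\<close>-side has a unique diagonal.
\<close>

locale factorization_system = category C for C :: "('o, 'm) cat" +
  fixes E M :: "'o \<Rightarrow> 'o \<Rightarrow> 'm set"
  assumes E_Hom: "X \<in> Ob C \<Longrightarrow> Y \<in> Ob C \<Longrightarrow> E X Y \<subseteq> Hom C X Y"
    and M_Hom: "X \<in> Ob C \<Longrightarrow> Y \<in> Ob C \<Longrightarrow> M X Y \<subseteq> Hom C X Y"
    and isos_E: "X \<in> Ob C \<Longrightarrow> Y \<in> Ob C \<Longrightarrow> isos C X Y \<subseteq> E X Y"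
    and isos_M: "X \<in> Ob C \<Longrightarrow> Y \<in> Ob C \<Longrightarrow> isos C X Y \<subseteq> M X Y"
    and Comp_E: "X \<in> Ob C \<Longrightarrow> Y \<in> Ob C \<Longrightarrow> Z \<in> Ob C \<Longrightarrow>
          f \<in> E X Y \<Longrightarrow> g \<in> E Y Z \<Longrightarrow> Comp C X Y Z g f \<in> E X Z"
    and Comp_M: "X \<in> Ob C \<Longrightarrow> Y \<in> Ob C \<Longrightarrow> Z \<in> Ob C \<Longrightarrow>
          f \<in> M X Y \<Longrightarrow> g \<in> M Y Z \<Longrightarrow> Comp C X Y Z g f \<in> M X Z"
    and factorization: "X \<in> Ob C \<Longrightarrow> Y \<in> Ob C \<Longrightarrow> f \<in> Hom C X Y \<Longrightarrow>
          \<exists>Z \<in> Ob C. \<exists>e \<in> E X Z. \<exists>m \<in> M Z Y. Comp C X Z Y m e = f"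
    and orthogonality: "A \<in> Ob C \<Longrightarrow> B \<in> Ob C \<Longrightarrow> X \<in> Ob C \<Longrightarrow> Y \<in> Ob C \<Longrightarrow>
          e \<in> E A B \<Longrightarrow> m \<in> M X Y \<Longrightarrow> u \<in> Hom C A X \<Longrightarrow> v \<in> Hom C B Y \<Longrightarrow>
          Comp C A X Y m u = Comp C A B Y v e \<Longrightarrow>
          \<exists>!w. w \<in> Hom C B X \<and> Comp C A B X w e = u \<and> Comp C B X Y m w = v"


section \<open>Inner and outer maps\<close>

text \<open>
  The object \<open>S\<^sup>*\<close> is represented by \<open>S\<close> itself: the objects are the positive opetopic cardinals and
  the morphisms from \<open>S\<close> to \<open>T\<close> are all \<omega>-functors from \<^term>\<open>star S\<close> to \<^term>\<open>star T\<close>.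
\<close>

definition pOpeCard_omega :: "('a hypergraph, nat \<Rightarrow> 'a hypergraph \<Rightarrow> 'a hypergraph) cat" where
  "pOpeCard_omega = \<lparr>
     Ob = {S. positive_opetopic_cardinal S},
     Hom = (\<lambda>S T. {f. omega_functor (star S) (star T) f}),
     Id = (\<lambda>S n. restrict (\<lambda>X. X) (cells (star S) n)),
     Comp = (\<lambda>S T U g f n. compose (cells (star S) n) (g n) (f n))\<rparr>"

definition image_cell ::
  "'a hypergraph \<Rightarrow> (nat \<Rightarrow> 'a hypergraph \<Rightarrow> 'b hypergraph) \<Rightarrow> 'b hypergraph" where
  "image_cell S f = f (hdim S) S"

definition inner ::
  "'a hypergraph \<Rightarrow> 'a hypergraph \<Rightarrow> (nat \<Rightarrow> 'a hypergraph \<Rightarrow> 'a hypergraph) set" where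
  "inner S T = {f \<in> Hom pOpeCard_omega S T. image_cell S f = T}"

definition outer ::
  "'a hypergraph \<Rightarrow> 'a hypergraph \<Rightarrow> (nat \<Rightarrow> 'a hypergraph \<Rightarrow> 'a hypergraph) set" where
  "outer S T = {f \<in> Hom pOpeCard_omega S T. \<exists>g. hmorphism S T g \<and> f = star_map S T g}"

end

theory Submission
  imports Defs
begin

text \<open>
  The order \<open><\<^sup>+\<close> makes every set of faces \<open>S\<^sub>k\<close> a forest. A set of \<open>(k + 1)\<close>-faces that is
  closed under \<open><\<^sup>+\<close>-comparability and initial for \<open><\<^sup>-\<close> therefore cuts \<open>S\<close> into two positive
  opetopic cardinals whose \<open>k\<close>-composite is \<open>S\<close>; the trivial cuts give domains and codomains, and
  conversely composable cells glue, so that \<open>S\<^sup>*\<close> is an \<open>\<omega>\<close>-category.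

  Unless \<open>S\<close> is generated by a single face it has a non-trivial cut. Hence every cell \<open>X\<close> is an
  iterated composite of the principal cells \<open>S[a]\<close> of its faces \<open>a\<close>, and an \<open>\<omega>\<close>-functor \<open>f\<close>
  satisfies \<open>f(X) = \<Union>\<^sub>a f(S[a])\<close>. In particular \<open>f\<close> is monotone and factors through \<open>f(S)\<^sup>*\<close>.
  Morphisms of positive opetopic cardinals are injective by pencil linearity, so an outer map is an
  isomorphism onto the cells contained in its image, along which functors lift uniquely. An
  isomorphism permutes the principal cells, which makes it outer.
\<close>

section \<open>The orders on faces\<close>

text \<open>The obstacle is that a set of faces closed under \<gamma> and \<delta> need not be a
  cell. Globularity, strictness and disjointness pass to it for free, but linearity of vertices and
  pencils asks for witnesses of the upper order inside the set. Hence much of the order theory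
  reroutes upper paths through prescribed faces: minimal ones, or those on one side of a cut. The
  decisive tool is \<open>upper_gamD\<close>, which lifts a comparison of codomains to an upper or a
  lower comparison of the faces themselves; disjointness then excludes one alternative. Internal
  faces \<iota> measure which part of a boundary is lost while climbing the upper order, which is
  the reason why a codomain deletes them one dimension lower. On the side of functors, identities
  are inclusions, so the value of a functor on a cell is the same in every dimension in which the
  cell is considered; this makes induction over decompositions possible. Principal cells are closed
  sets by construction, but that they are cells is itself a result of such an induction.\<close>

definition step :: "'a hypergraph \<Rightarrow> 'a set \<Rightarrow> 'a rel" where
  "step S A = {(a, b). \<exists>\<alpha>\<in>A. a \<in> del S \<alpha> \<and> gam S \<alpha> = b}"

lemma upper_eq: "upper S k = (step S (faces S (Suc k)))\<^sup>+"
  by (simp add: upper_def step_def)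

lemma step_mono: "A \<subseteq> B \<Longrightarrow> step S A \<subseteq> step S B"
  by (auto simp: step_def)

lemma stepI: "\<alpha> \<in> A \<Longrightarrow> a \<in> del S \<alpha> \<Longrightarrow> (a, gam S \<alpha>) \<in> step S A"
  by (auto simp: step_def)

lemma upper_trans: "(a, b) \<in> upper S k \<Longrightarrow> (b, c) \<in> upper S k \<Longrightarrow> (a, c) \<in> upper S k"
  unfolding upper_def by (rule trancl_trans)

text \<open>Reflexivity holds for arbitrary elements, not only for faces of dimension
  \<open>k\<close>, so face membership is supplied separately where it matters.\<close>

definition ule :: "'a hypergraph \<Rightarrow> nat \<Rightarrow> 'a \<Rightarrow> 'a \<Rightarrow> bool" where
  "ule S k a b \<longleftrightarrow> a = b \<or> (a, b) \<in> upper S k"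

lemma ule_rtrancl: "ule S k a b \<longleftrightarrow> (a, b) \<in> (step S (faces S (Suc k)))\<^sup>*"
  by (auto simp: ule_def upper_eq rtrancl_eq_or_trancl)

lemma ule_refl [simp]: "ule S k a a"
  by (simp add: ule_def)

lemma ule_trans: "ule S k a b \<Longrightarrow> ule S k b c \<Longrightarrow> ule S k a c"
  unfolding ule_rtrancl by (rule rtrancl_trans)

lemma ule_upper_trans: "ule S k a b \<Longrightarrow> (b, c) \<in> upper S k \<Longrightarrow> (a, c) \<in> upper S k"
  unfolding ule_def using upper_trans by metis

lemma upper_ule_trans: "(a, b) \<in> upper S k \<Longrightarrow> ule S k b c \<Longrightarrow> (a, c) \<in> upper S k"
  unfolding ule_def using upper_trans by metis

lemma upper_ule: "(a, b) \<in> upper S k \<Longrightarrow> ule S k a b"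
  by (simp add: ule_def)

lemma delU_iff: "x \<in> delU S A \<longleftrightarrow> (\<exists>a\<in>A. x \<in> del S a)"
  by (auto simp: delU_def)

lemma iot_iff: "x \<in> iot S a \<longleftrightarrow> (\<exists>c\<in>del S a. x \<in> del S c) \<and> (\<exists>c\<in>del S a. x = gam S c)"
  by (auto simp: iot_def delU_def)

lemma iotU_iff: "x \<in> iotU S A \<longleftrightarrow> (\<exists>a\<in>A. x \<in> iot S a)"
  by (auto simp: iotU_def)

context positive_hypergraph
begin

lemma del_face: "a \<in> faces S (Suc k) \<Longrightarrow> x \<in> del S a \<Longrightarrow> x \<in> faces S k"
  using del_faces by blast

lemma faces_eq: "a \<in> faces S i \<Longrightarrow> a \<in> faces S j \<Longrightarrow> i = j"
  using faces_disjoint by blast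

lemma upper_faces: "(a, b) \<in> upper S k \<Longrightarrow> a \<in> faces S k \<and> b \<in> faces S k"
  unfolding upper_eq
  by (induction rule: trancl_induct) (auto simp: step_def intro: gam_face del_face)

lemma upper_step: "\<alpha> \<in> faces S (Suc k) \<Longrightarrow> a \<in> del S \<alpha> \<Longrightarrow> (a, gam S \<alpha>) \<in> upper S k"
  by (auto simp: upper_eq step_def)

lemma finite_upper: "finite (upper S k)"
  by (rule finite_subset[of _ "faces S k \<times> faces S k"]) (auto dest: upper_faces simp: finite_faces)

lemma lower_Suc:
  "lower S (Suc k) =
    {(a, b). a \<in> faces S (Suc k) \<and> b \<in> faces S (Suc k) \<and> gam S a \<in> del S b}\<^sup>+"
  by (simp add: lower_def)

lemma lower_step: "a \<in> faces S (Suc k) \<Longrightarrow> b \<in> faces S (Suc k) \<Longrightarrow> gam S a \<in> del S b \<Longrightarrow>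
    (a, b) \<in> lower S (Suc k)"
  by (auto simp: lower_Suc)

lemma lower_trans: "(a, b) \<in> lower S k \<Longrightarrow> (b, c) \<in> lower S k \<Longrightarrow> (a, c) \<in> lower S k"
  unfolding lower_def by (auto split: if_splits)

lemma lower_faces: "(a, b) \<in> lower S k \<Longrightarrow> a \<in> faces S k \<and> b \<in> faces S k"
  unfolding lower_def
  by (cases "k = 0") (auto elim: converse_tranclE tranclE)

text \<open>A lower step from a to b is, after taking codomains, an upper step through b.
  Irreflexivity of the lower order thereby reduces to strictness.\<close>

lemma lower_gam: "(a, b) \<in> lower S (Suc k) \<Longrightarrow> (gam S a, gam S b) \<in> upper S k"
  unfolding lower_Suc
  by (induction rule: trancl_induct) (auto intro: upper_step upper_trans)

end

context positive_opetopic_cardinal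
begin

lemma upper_irrefl: "(a, a) \<notin> upper S k"
  using strictness by (auto simp: irrefl_def)

lemma upper_asym: "(a, b) \<in> upper S k \<Longrightarrow> \<not> ule S k b a"
  using upper_irrefl upper_trans by (metis ule_def)

lemma ule_antisym: "ule S k a b \<Longrightarrow> ule S k b a \<Longrightarrow> a = b"
  using upper_asym by (metis ule_def)

lemma wf_upper: "wf (upper S k)"
proof (rule finite_acyclic_wf[OF finite_upper])
  show "acyclic (upper S k)"
    using strictness by (simp add: acyclic_irrefl upper_def)
qed

lemma wf_upper_converse: "wf ((upper S k)\<inverse>)"
proof (rule finite_acyclic_wf_converse[OF finite_upper])
  show "acyclic (upper S k)"
    using strictness by (simp add: acyclic_irrefl upper_def)
qed

lemma lower_irrefl: "(a, a) \<notin> lower S k"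
  using lower_gam upper_irrefl by (cases k) (auto simp: lower_def[of S 0], blast)

lemma not_upper_lower: "(a, b) \<in> upper S k \<Longrightarrow> (a, b) \<notin> lower S k \<and> (b, a) \<notin> lower S k"
  using disjointness[of k a b] upper_faces[of a b k]
  by (cases "k = 0") (auto simp: perp_def lower_def[of S 0])

lemma not_ule_lower: "ule S k a b \<Longrightarrow> (a, b) \<notin> lower S k \<and> (b, a) \<notin> lower S k"
  using not_upper_lower lower_irrefl by (metis ule_def)

lemma pencil_gam_ule: "a \<in> faces S (Suc k) \<Longrightarrow> b \<in> faces S (Suc k) \<Longrightarrow> gam S a = gam S b \<Longrightarrow>
    ule S (Suc k) a b \<or> ule S (Suc k) b a"
  using pencil_gam[of "gam S a" k] gam_face[of a k] by (auto simp: total_on_def ule_def)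

lemma pencil_del_ule: "a \<in> faces S (Suc k) \<Longrightarrow> b \<in> faces S (Suc k) \<Longrightarrow> x \<in> del S a \<Longrightarrow> x \<in> del S b \<Longrightarrow>
    ule S (Suc k) a b \<or> ule S (Suc k) b a"
  using pencil_del[of x k] del_face[of a k] by (auto simp: total_on_def ule_def)

lemma gam_gam_in: "\<alpha> \<in> faces S (Suc (Suc k)) \<Longrightarrow> \<exists>c\<in>del S \<alpha>. gam S (gam S \<alpha>) = gam S c"
  using globularity_gam by fastforce

lemma gam_gam_notin: "\<alpha> \<in> faces S (Suc (Suc k)) \<Longrightarrow> c \<in> del S \<alpha> \<Longrightarrow> gam S (gam S \<alpha>) \<notin> del S c"
  using globularity_gam by (fastforce simp: delU_iff)

lemma gam_gam_notin_iot: "\<alpha> \<in> faces S (Suc (Suc k)) \<Longrightarrow> gam S (gam S \<alpha>) \<notin> iot S \<alpha>"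
  using gam_gam_notin by (auto simp: iot_iff)

lemma gam_del_cases:
  "\<alpha> \<in> faces S (Suc (Suc k)) \<Longrightarrow> c \<in> del S \<alpha> \<Longrightarrow> gam S c \<notin> iot S \<alpha> \<Longrightarrow> gam S c = gam S (gam S \<alpha>)"
  using globularity_gam unfolding iot_def by fastforce

lemma del_del_cases:
  "\<alpha> \<in> faces S (Suc (Suc k)) \<Longrightarrow> c \<in> del S \<alpha> \<Longrightarrow> x \<in> del S c \<Longrightarrow> x \<notin> iot S \<alpha> \<Longrightarrow>
    x \<in> del S (gam S \<alpha>)"
  using globularity_del unfolding iot_def by (auto simp: delU_iff)

lemma del_gamD: "\<alpha> \<in> faces S (Suc (Suc k)) \<Longrightarrow> x \<in> del S (gam S \<alpha>) \<Longrightarrow> \<exists>c\<in>del S \<alpha>. x \<in> del S c"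
  using globularity_del by (auto simp: delU_iff)

lemma gam_notin_del: "a \<in> faces S (Suc k) \<Longrightarrow> gam S a \<notin> del S a"
  using upper_step upper_irrefl by blast

text \<open>Globularity allows a climb inside \<delta>(\<alpha>): as long as \<gamma>(c) is internal
  it lies in \<delta>(c') for some c' in \<delta>(\<alpha>), and once it is not internal it equals
  \<gamma>\<gamma>(\<alpha>).\<close>

lemma gam_del_path:
  assumes "\<alpha> \<in> faces S (Suc (Suc k))" "c \<in> del S \<alpha>"
  shows "(gam S c, gam S (gam S \<alpha>)) \<in> (step S (del S \<alpha>))\<^sup>*"
  using assms(2)
proof (induction "gam S c" arbitrary: c rule: wf_induct_rule[OF wf_upper_converse[of k]])
  case 1
  show ?case
  proof (cases "gam S c \<in> iot S \<alpha>")
    case True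
    then obtain c' where c': "c' \<in> del S \<alpha>" "gam S c \<in> del S c'"
      by (auto simp: iot_iff)
    then have s: "(gam S c, gam S c') \<in> step S (del S \<alpha>)"
      by (auto simp: step_def)
    have "(gam S c, gam S c') \<in> upper S k"
      using c' assms(1) by (meson del_face upper_step)
    with 1 c' have "(gam S c', gam S (gam S \<alpha>)) \<in> (step S (del S \<alpha>))\<^sup>*"
      by auto
    with s show ?thesis by auto
  next
    case False
    then show ?thesis using gam_del_cases[OF assms(1) 1(2)] by simp
  qed
qed

lemma del_del_path:
  assumes "\<alpha> \<in> faces S (Suc (Suc k))" "c \<in> del S \<alpha>" "x \<in> del S c"
  shows "(x, gam S (gam S \<alpha>)) \<in> (step S (del S \<alpha>))\<^sup>+"
  using gam_del_path[OF assms(1,2)] stepI[OF assms(2,3)] by (rule rtrancl_into_trancl2[rotated])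

lemma step_del_upper: "\<alpha> \<in> faces S (Suc (Suc k)) \<Longrightarrow> (a, b) \<in> (step S (del S \<alpha>))\<^sup>* \<Longrightarrow> ule S k a b"
  unfolding ule_rtrancl using rtrancl_mono[OF step_mono, OF del_faces] by blast

lemma gam_del_ule: "\<alpha> \<in> faces S (Suc (Suc k)) \<Longrightarrow> c \<in> del S \<alpha> \<Longrightarrow> ule S k (gam S c) (gam S (gam S \<alpha>))"
  using step_del_upper gam_del_path by blast

lemma iot_upper: "\<alpha> \<in> faces S (Suc (Suc k)) \<Longrightarrow> x \<in> iot S \<alpha> \<Longrightarrow> (x, gam S (gam S \<alpha>)) \<in> upper S k"
  using gam_del_ule gam_gam_notin_iot by (metis iot_iff ule_def)

lemma upper_gam:
  assumes "(a, b) \<in> upper S (Suc k)" shows "ule S k (gam S a) (gam S b)"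
  using assms unfolding upper_eq
proof (induction rule: trancl_induct)
  case (base b)
  then show ?case by (auto simp: step_def intro: gam_del_ule)
next
  case (step b c)
  then have "ule S k (gam S b) (gam S c)" by (auto simp: step_def intro: gam_del_ule)
  with step.IH show ?case by (rule ule_trans)
qed

lemma ule_gam: "ule S (Suc k) a b \<Longrightarrow> ule S k (gam S a) (gam S b)"
  using upper_gam by (auto simp: ule_def)

section \<open>Minimal and maximal faces, and the forest structure of the upper order\<close>

definition minf :: "nat \<Rightarrow> 'a set" where
  "minf k = faces S k - gam S ` faces S (Suc k)"

definition maxf :: "nat \<Rightarrow> 'a set" where
  "maxf k = faces S k - delU S (faces S (Suc k))"

lemma minf_ule: "c \<in> minf k \<Longrightarrow> ule S k b c \<Longrightarrow> b = c"
  unfolding ule_def upper_eq minf_def by (auto dest!: tranclD2 simp: step_def)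

lemma maxf_ule: "c \<in> maxf k \<Longrightarrow> ule S k c b \<Longrightarrow> b = c"
  unfolding ule_def upper_eq maxf_def by (auto dest!: tranclD simp: step_def delU_iff)

lemma ex_minf: "a \<in> faces S k \<Longrightarrow> \<exists>c\<in>minf k. ule S k c a"
proof (induction a rule: wf_induct_rule[OF wf_upper[of k]])
  case (1 a)
  show ?case
  proof (cases "a \<in> minf k")
    case False
    with 1 obtain \<alpha> where \<alpha>: "\<alpha> \<in> faces S (Suc k)" "a = gam S \<alpha>"
      by (auto simp: minf_def)
    then obtain c where "c \<in> del S \<alpha>" using del_nonempty by blast
    with \<alpha> have "(c, a) \<in> upper S k" by (simp add: upper_step)
    with 1 upper_faces ule_trans upper_ule show ?thesis by metis
  qed (use ule_refl in metis)
qed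

lemma ex_maxf: "a \<in> faces S k \<Longrightarrow> \<exists>c\<in>maxf k. ule S k a c"
proof (induction a rule: wf_induct_rule[OF wf_upper_converse[of k]])
  case (1 a)
  show ?case
  proof (cases "a \<in> maxf k")
    case False
    with 1 obtain \<alpha> where \<alpha>: "\<alpha> \<in> faces S (Suc k)" "a \<in> del S \<alpha>"
      by (auto simp: maxf_def delU_iff)
    then have "(a, gam S \<alpha>) \<in> upper S k" by (simp add: upper_step)
    with 1 upper_faces ule_trans upper_ule converse_iff show ?thesis by metis
  qed (use ule_refl in metis)
qed

text \<open>Any step through \<open>\<gamma>(A)\<close> can be rerouted through the faces of \<open>\<delta>(A)\<close>, which are smaller.\<close>

lemma del_path_minf:
  assumes "\<alpha> \<in> faces S (Suc k)" "x \<in> del S \<alpha>"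
  shows "(x, gam S \<alpha>) \<in> (step S (minf (Suc k)))\<^sup>+"
  using assms
proof (induction \<alpha> arbitrary: x rule: wf_induct_rule[OF wf_upper[of "Suc k"]])
  case (1 \<alpha>)
  show ?case
  proof (cases "\<alpha> \<in> minf (Suc k)")
    case True
    with 1 show ?thesis by (auto intro: stepI)
  next
    case False
    with 1 obtain A where A: "A \<in> faces S (Suc (Suc k))" "\<alpha> = gam S A"
      by (auto simp: minf_def)
    with 1 obtain c where c: "c \<in> del S A" "x \<in> del S c"
      using del_gamD by blast
    have "step S (del S A) \<subseteq> (step S (minf (Suc k)))\<^sup>+"
      using 1(1) A upper_step del_face by (fastforce simp: step_def)
    then have "(step S (del S A))\<^sup>+ \<subseteq> (step S (minf (Suc k)))\<^sup>+"
      by (metis trancl_mono_subset trancl_id trans_trancl)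
    with del_del_path[OF A(1) c] A show ?thesis by auto
  qed
qed

text \<open>Wherever a cut deletes only codomains from the faces one dimension higher, the minimal
  faces survive there, so every comparison of \<open>S\<close> remains realised.\<close>

lemma upper_minf: "upper S k = (step S (minf (Suc k)))\<^sup>+"
proof
  have "step S (faces S (Suc k)) \<subseteq> (step S (minf (Suc k)))\<^sup>+"
    using del_path_minf by (auto simp: step_def)
  then show "upper S k \<subseteq> (step S (minf (Suc k)))\<^sup>+"
    unfolding upper_eq by (metis trancl_mono_subset trancl_id trans_trancl)
  show "(step S (minf (Suc k)))\<^sup>+ \<subseteq> upper S k"
    unfolding upper_eq by (rule trancl_mono_subset, rule step_mono) (auto simp: minf_def)
qed

text \<open>Two paths leaving c start with faces \<alpha>, \<beta> that have c in their \<delta>, so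
  pencil linearity makes \<alpha> and \<beta> comparable. Monotonicity of \<gamma> places the
  smaller of \<gamma>(\<alpha>), \<gamma>(\<beta>) below both targets, and the induction continues
  from that strictly larger face.\<close>

lemma ule_forest:
  assumes "ule S k c a" "ule S k c b"
  shows "ule S k a b \<or> ule S k b a"
  using assms
proof (induction c rule: wf_induct_rule[OF wf_upper_converse[of k]])
  case (1 c)
  note IH = 1(1)
  show ?case
  proof (cases "c = a \<or> c = b")
    case False
    with 1 have "(c, a) \<in> upper S k" "(c, b) \<in> upper S k" by (auto simp: ule_def)
    then obtain \<alpha> \<beta> where \<alpha>: "\<alpha> \<in> faces S (Suc k)" "c \<in> del S \<alpha>" "ule S k (gam S \<alpha>) a"
      and \<beta>: "\<beta> \<in> faces S (Suc k)" "c \<in> del S \<beta>" "ule S k (gam S \<beta>) b"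
      unfolding upper_eq ule_rtrancl by (auto simp: step_def dest!: tranclD)
    consider "ule S (Suc k) \<alpha> \<beta>" | "ule S (Suc k) \<beta> \<alpha>"
      using pencil_del_ule \<alpha> \<beta> by blast
    then show ?thesis
    proof cases
      case 1
      then have "ule S k (gam S \<alpha>) b" using \<beta> ule_gam ule_trans by metis
      with \<alpha> IH upper_step show ?thesis by (meson converse_iff)
    next
      case 2
      then have "ule S k (gam S \<beta>) a" using \<alpha> ule_gam ule_trans by metis
      with \<beta> IH upper_step show ?thesis by (meson converse_iff)
    qed
  qed (use 1 in auto)
qed

text \<open>At each step, globularity leaves two possibilities: x remains in \<delta> of the next
  face, or it becomes internal to the face just crossed. The set \<open>A\<close> is kept as a
  parameter since for cuts the crossed faces must lie in \<open>D\<close>.\<close>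

lemma del_along_path:
  assumes "(c, b) \<in> (step S A)\<^sup>*" "A \<subseteq> faces S (Suc (Suc k))" "x \<in> del S c"
  shows "x \<in> del S b \<or> (\<exists>\<alpha>\<in>A. x \<in> iot S \<alpha> \<and> (gam S \<alpha>, b) \<in> (step S A)\<^sup>*)"
  using assms(1,3)
proof (induction rule: converse_rtrancl_induct)
  case (step y z)
  then obtain \<alpha> where \<alpha>: "\<alpha> \<in> A" "y \<in> del S \<alpha>" "gam S \<alpha> = z"
    by (auto simp: step_def)
  then show ?case using step del_del_cases[of \<alpha> k y x] assms(2) by blast
qed auto

lemma gam_along_path:
  assumes "(c, b) \<in> (step S A)\<^sup>*" "A \<subseteq> faces S (Suc (Suc k))"
  shows "gam S c = gam S b \<or> (\<exists>\<alpha>\<in>A. gam S c \<in> iot S \<alpha> \<and> (gam S \<alpha>, b) \<in> (step S A)\<^sup>*)"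
  using assms(1)
proof (induction rule: converse_rtrancl_induct)
  case (step y z)
  then obtain \<alpha> where \<alpha>: "\<alpha> \<in> A" "y \<in> del S \<alpha>" "gam S \<alpha> = z"
    by (auto simp: step_def)
  then show ?case using step gam_del_cases[of \<alpha> k y] assms(2) by (metis subsetD)
qed auto

lemma del_ule:
  "ule S (Suc k) c b \<Longrightarrow> x \<in> del S c \<Longrightarrow>
    x \<in> del S b \<or> (\<exists>\<alpha>\<in>faces S (Suc (Suc k)). x \<in> iot S \<alpha> \<and> ule S (Suc k) (gam S \<alpha>) b)"
  unfolding ule_rtrancl using del_along_path by blast

lemma gam_ule_cases:
  "ule S (Suc k) c b \<Longrightarrow>
    gam S c = gam S b \<or> (\<exists>\<alpha>\<in>faces S (Suc (Suc k)). gam S c \<in> iot S \<alpha> \<and> ule S (Suc k) (gam S \<alpha>) b)"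
  unfolding ule_rtrancl using gam_along_path by blast

lemma iot_ule_gam:
  assumes "\<alpha> \<in> faces S (Suc (Suc k))" "x \<in> iot S \<alpha>" "ule S (Suc k) (gam S \<alpha>) b"
  shows "x \<noteq> gam S b"
  using iot_upper[OF assms(1,2)] ule_gam[OF assms(3)] upper_asym by metis

text \<open>An internal x is \<gamma>(c) for some c that is upper-below b. If x were in \<delta>(b),
  then c would be lower-below b as well, against disjointness.\<close>

lemma iot_ule_del:
  assumes "\<alpha> \<in> faces S (Suc (Suc k))" "x \<in> iot S \<alpha>" "ule S (Suc k) (gam S \<alpha>) b" "b \<in> faces S (Suc k)"
  shows "x \<notin> del S b"
proof
  assume x: "x \<in> del S b"
  obtain c where c: "c \<in> del S \<alpha>" "x = gam S c" using assms(2) by (auto simp: iot_iff)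
  have cf: "c \<in> faces S (Suc k)" using c assms(1) del_face by blast
  have "(c, b) \<in> upper S (Suc k)" using c assms upper_step upper_ule_trans by metis
  moreover have "(c, b) \<in> lower S (Suc k)" using c x cf assms lower_step by blast
  ultimately show False using not_upper_lower by blast
qed

text \<open>A converse to \<open>upper_gam\<close> and \<open>lower_gam\<close> taken together. The
  path from \<gamma>(a) to \<gamma>(b) is followed through minimal faces, so that pencil comparisons
  can only point upwards from the faces on the path.\<close>

lemma upper_gamD:
  assumes ab: "a \<in> faces S (Suc k)" "b \<in> faces S (Suc k)" and lt: "(gam S a, gam S b) \<in> upper S k"
  shows "(a, b) \<in> upper S (Suc k) \<or> (a, b) \<in> lower S (Suc k)"
proof -
  \<comment> \<open>The invariant, propagated backwards from \<gamma>(b): the face by which the path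
    leaves x may be replaced by a minimal one below b in one of the two orders.\<close>
  have "\<exists>c\<in>minf (Suc k). x \<in> del S c \<and> (ule S (Suc k) c b \<or> (c, b) \<in> lower S (Suc k))"
    if "(x, gam S b) \<in> (step S (minf (Suc k)))\<^sup>+" for x
    using that
  proof (induction rule: converse_trancl_induct)
    case (base x)
    then obtain c where c: "c \<in> minf (Suc k)" "x \<in> del S c" "gam S c = gam S b"
      by (auto simp: step_def)
    then have "ule S (Suc k) c b"
      using pencil_gam_ule ab minf_ule by (metis DiffD1 minf_def ule_refl)
    with c show ?case by blast
  next
    case (step x y)
    then obtain c c' where c: "c \<in> minf (Suc k)" "x \<in> del S c" "gam S c = y"
      and c': "c' \<in> minf (Suc k)" "y \<in> del S c'" "ule S (Suc k) c' b \<or> (c', b) \<in> lower S (Suc k)"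
      by (auto simp: step_def)
    have f: "c \<in> faces S (Suc k)" "c' \<in> faces S (Suc k)" using c c' by (auto simp: minf_def)
    have cc': "(c, c') \<in> lower S (Suc k)" using c c' f lower_step by blast
    show ?case
    proof (cases "(c', b) \<in> lower S (Suc k)")
      case True
      with c cc' lower_trans show ?thesis by metis
    next
      case False
      with c' have "ule S (Suc k) c' b" by blast
      then consider "y \<in> del S b"
        | \<alpha> where "\<alpha> \<in> faces S (Suc (Suc k))" "y \<in> iot S \<alpha>" "ule S (Suc k) (gam S \<alpha>) b"
        using del_ule c' by blast
      then show ?thesis
      proof cases
        case 1
        with c f ab lower_step show ?thesis by blast
      next
        case 2
        then obtain d where d: "d \<in> del S \<alpha>" "y = gam S d" by (auto simp: iot_iff)
        \<comment> \<open>Both faces have codomain y, and minimality of c excludes that d lies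
          strictly below it.\<close>
        then have "ule S (Suc k) c d"
          using pencil_gam_ule[of c k d] c f 2 minf_ule del_face by (metis ule_refl)
        with 2 d upper_step ule_trans upper_ule c show ?thesis by metis
      qed
    qed
  qed
  with lt obtain c where c: "c \<in> minf (Suc k)" "gam S a \<in> del S c"
    "ule S (Suc k) c b \<or> (c, b) \<in> lower S (Suc k)"
    unfolding upper_minf by blast
  have f: "c \<in> faces S (Suc k)" using c by (auto simp: minf_def)
  have ac: "(a, c) \<in> lower S (Suc k)" using ab c f lower_step by blast
  show ?thesis
  proof (cases "(c, b) \<in> lower S (Suc k)")
    case True
    with ac lower_trans show ?thesis by metis
  next
    case False
    with c have "ule S (Suc k) c b" by blast
    then consider "gam S a \<in> del S b"
      | \<alpha> where "\<alpha> \<in> faces S (Suc (Suc k))" "gam S a \<in> iot S \<alpha>" "ule S (Suc k) (gam S \<alpha>) b"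
      using del_ule c by blast
    then show ?thesis
    proof cases
      case 1
      with ab lower_step show ?thesis by blast
    next
      case 2
      then obtain d where d: "d \<in> del S \<alpha>" "gam S a = gam S d" by (auto simp: iot_iff)
      have db: "(d, b) \<in> upper S (Suc k)" using d 2 upper_step upper_ule_trans by metis
      \<comment> \<open>Here a need not be minimal, so both directions of the pencil comparison
        remain; the forest property turns either into comparability of a and b.\<close>
      have "ule S (Suc k) a d \<or> ule S (Suc k) d a"
        using pencil_gam_ule ab d 2 del_face by metis
      then have "ule S (Suc k) a b \<or> ule S (Suc k) b a"
        using db ule_forest ule_upper_trans upper_ule by metis
      moreover have "\<not> ule S (Suc k) b a" using ule_gam lt upper_asym by blast
      ultimately show ?thesis by (auto simp: ule_def)
    qed
  qed
qed

end

section \<open>Cells and cuts\<close>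

definition subcell :: "'a hypergraph \<Rightarrow> 'a hypergraph \<Rightarrow> bool" where
  "subcell X S \<longleftrightarrow> subhypergraph X S \<and> positive_opetopic_cardinal X"

lemma subcell_faces: "subcell X S \<Longrightarrow> a \<in> faces X k \<Longrightarrow> a \<in> faces S k"
  by (auto simp: subcell_def subhypergraph_def)

lemma subcell_gam: "subcell X S \<Longrightarrow> gam X = gam S"
  by (auto simp: subcell_def subhypergraph_def)

lemma subcell_del: "subcell X S \<Longrightarrow> del X = del S"
  by (auto simp: subcell_def subhypergraph_def)

lemma subcell_poc: "subcell X S \<Longrightarrow> positive_opetopic_cardinal X"
  by (auto simp: subcell_def)

lemma subcell_step: "subcell X S \<Longrightarrow> step X A = step S A"
  by (simp add: step_def subcell_def subhypergraph_def)

lemma subcell_upper: "subcell X S \<Longrightarrow> (a, b) \<in> upper X k \<Longrightarrow> (a, b) \<in> upper S k"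
  unfolding upper_eq using step_mono[of "faces X (Suc k)" "faces S (Suc k)" S] subcell_step[of X S]
  by (auto elim!: trancl_mono dest: subcell_faces)

lemma subcell_ule: "subcell X S \<Longrightarrow> ule X k a b \<Longrightarrow> ule S k a b"
  by (auto simp: ule_def subcell_upper)

lemma subcell_lower: "subcell X S \<Longrightarrow> (a, b) \<in> lower X k \<Longrightarrow> (a, b) \<in> lower S k"
  unfolding lower_def subcell_def subhypergraph_def
  by (auto split: if_splits elim!: trancl_mono)

lemma subcell_refl: "positive_opetopic_cardinal S \<Longrightarrow> subcell S S"
  by (auto simp: subcell_def subhypergraph_def positive_opetopic_cardinal_def)

lemma subcell_trans: "subcell X Y \<Longrightarrow> subcell Y Z \<Longrightarrow> subcell X Z"
  by (fastforce simp: subcell_def subhypergraph_def)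

lemma hypergraph_eqI:
  "gam X = gam Y \<Longrightarrow> del X = del Y \<Longrightarrow> (\<And>k. faces X k = faces Y k) \<Longrightarrow> X = (Y :: 'a hypergraph)"
  by (cases X; cases Y) (auto simp: fun_eq_iff)

context positive_opetopic_cardinal
begin

text \<open>
  A comparison \<open>a <\<^sup>+ b\<close> lost in \<open>Z\<close> would turn into \<open>a <\<^sup>- b\<close>, contradicting disjointness in \<open>S\<close>.
\<close>

lemma subcell_upperD:
  assumes Z: "subcell Z S" and "a \<in> faces Z k" "b \<in> faces Z k" "(a, b) \<in> upper S k"
  shows "(a, b) \<in> upper Z k"
proof -
  interpret Z: positive_opetopic_cardinal Z using Z by (rule subcell_poc)
  have "ule S k a b \<Longrightarrow> ule Z k a b" if "a \<in> faces Z k" "b \<in> faces Z k" for a b k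
    using that
  proof (induction k arbitrary: a b)
    case 0
    then show ?case
      using Z.linearity_0 subcell_upper[OF Z] upper_asym ule_antisym
      by (metis total_on_def ule_def)
  next
    case (Suc k)
    have "ule Z k (gam S a) (gam S b)"
      using Suc Z.gam_face ule_gam subcell_gam[OF Z] by metis
    then consider "gam Z a = gam Z b" | "(gam Z a, gam Z b) \<in> upper Z k"
      using subcell_gam[OF Z] by (auto simp: ule_def)
    then show ?case
    proof cases
      case 1
      then have "ule Z (Suc k) a b \<or> ule Z (Suc k) b a"
        using Z.pencil_gam_ule Suc by metis
      then show ?thesis
        using Suc subcell_ule[OF Z] ule_antisym by blast
    next
      case 2
      then have "(a, b) \<in> upper Z (Suc k) \<or> (a, b) \<in> lower Z (Suc k)"
        using Z.upper_gamD Suc by metis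
      moreover have "(a, b) \<notin> lower Z (Suc k)"
        using subcell_lower[OF Z] not_ule_lower Suc by metis
      ultimately show ?thesis by (simp add: ule_def)
    qed
  qed
  then show ?thesis using assms upper_irrefl by (metis ule_def)
qed

text \<open>Globularity, strictness and disjointness restrict from \<open>S\<close>, because the
  orders of \<open>X\<close> are contained in those of \<open>S\<close>. Only the linearity
  conditions assert that comparisons exist, so they must be checked in \<open>X\<close>
  itself.\<close>

lemma subcellI:
  assumes [simp]: "gam X = gam S" "del X = del S" and sub: "\<And>k a. a \<in> faces X k \<Longrightarrow> a \<in> faces S k"
    and g: "\<And>k a. a \<in> faces X (Suc k) \<Longrightarrow> gam S a \<in> faces X k"
    and d: "\<And>k a x. a \<in> faces X (Suc k) \<Longrightarrow> x \<in> del S a \<Longrightarrow> x \<in> faces X k"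
    and ne: "faces X 0 \<noteq> {}"
    and lin: "\<And>a b. a \<in> faces X 0 \<Longrightarrow> b \<in> faces X 0 \<Longrightarrow> ule X 0 a b \<or> ule X 0 b a"
    and pg: "\<And>k a b. a \<in> faces X (Suc k) \<Longrightarrow> b \<in> faces X (Suc k) \<Longrightarrow> gam S a = gam S b \<Longrightarrow>
      ule X (Suc k) a b \<or> ule X (Suc k) b a"
    and pd: "\<And>k a b x. a \<in> faces X (Suc k) \<Longrightarrow> b \<in> faces X (Suc k) \<Longrightarrow> x \<in> del S a \<Longrightarrow> x \<in> del S b \<Longrightarrow>
      ule X (Suc k) a b \<or> ule X (Suc k) b a"
  shows "subcell X S"
proof -
  have "step X A = step S A" for A by (simp add: step_def)
  then have up: "upper X k \<subseteq> upper S k" for k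
    unfolding upper_eq using trancl_mono_subset[OF step_mono, of "faces X (Suc k)" "faces S (Suc k)" S] sub
    by auto
  have lo: "lower X k \<subseteq> lower S k" for k
    unfolding lower_def by (auto elim!: trancl_mono dest: sub)
  have [simp]: "delU X = delU S" by (auto simp: delU_def fun_eq_iff)
  have X: "positive_hypergraph X"
  proof
    show "finite (faces X k)" for k
      using finite_faces[of k] sub by (meson finite_subset subsetI)
    show "i \<noteq> j \<Longrightarrow> faces X i \<inter> faces X j = {}" for i j
      using sub faces_eq by blast
    show "finite {k. faces X k \<noteq> {}}"
      by (rule finite_subset[OF _ finitely_many_dims]) (use sub in blast)
    show "is_singleton (del X a)" if "a \<in> faces X 1" for a
      using del_singleton sub that by simp
    show "del X a \<noteq> {}" if "a \<in> faces X (Suc k)" for a k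
      using del_nonempty[OF sub[OF that]] by simp
  qed (use g d in auto)
  interpret positive_hypergraph X by (fact X)
  have "positive_opetopic_cardinal X"
  proof
    show "{gam X (gam X a)} = gam X ` del X a - delU X (del X a)" if "a \<in> faces X (Suc (Suc k))" for a k
      using globularity_gam[OF sub[OF that]] by simp
    show "del X (gam X a) = delU X (del X a) - gam X ` del X a" if "a \<in> faces X (Suc (Suc k))" for a k
      using globularity_del[OF sub[OF that]] by simp
    show "irrefl (upper X k)" for k
      using strictness up by (auto simp: irrefl_def)
    show "total_on (faces X 0) (upper X 0)"
      using lin by (auto simp: total_on_def ule_def)
    show "\<not> (perp (upper X k) a b \<and> perp (lower X k) a b)" if "0 < k" "a \<in> faces X k" "b \<in> faces X k" for a b k
      using disjointness[of k a b] sub that up lo unfolding perp_def by blast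
    show "total_on {a \<in> faces X (Suc k). x = gam X a} (upper X (Suc k))" for x k
      using pg by (auto simp: total_on_def ule_def)
    show "total_on {a \<in> faces X (Suc k). x \<in> del X a} (upper X (Suc k))" for x k
      using pd by (auto simp: total_on_def ule_def)
  qed (fact ne)
  then show ?thesis
    using X sub by (auto simp: subcell_def subhypergraph_def)
qed

text \<open>If \<open>X\<close> realises every comparison of \<open>S\<close> between its own faces,
  linearity is inherited as well. By \<open>subcell_upperD\<close> this sufficient condition is also
  necessary.\<close>

lemma subcell_fullI:
  assumes X: "gam X = gam S" "del X = del S" "\<And>k a. a \<in> faces X k \<Longrightarrow> a \<in> faces S k"
    "\<And>k a. a \<in> faces X (Suc k) \<Longrightarrow> gam S a \<in> faces X k"
    "\<And>k a x. a \<in> faces X (Suc k) \<Longrightarrow> x \<in> del S a \<Longrightarrow> x \<in> faces X k"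
    "faces X 0 \<noteq> {}"
    and full: "\<And>k a b. a \<in> faces X k \<Longrightarrow> b \<in> faces X k \<Longrightarrow> (a, b) \<in> upper S k \<Longrightarrow>
      (a, b) \<in> (step S (faces X (Suc k)))\<^sup>+"
  shows "subcell X S"
proof -
  have "step X A = step S A" for A using X by (simp add: step_def)
  then have full': "ule X k a b" if "a \<in> faces X k" "b \<in> faces X k" "ule S k a b" for k a b
    using that full unfolding ule_def upper_eq by auto
  show ?thesis
  proof (rule subcellI)
    show "ule X 0 a b \<or> ule X 0 b a" if "a \<in> faces X 0" "b \<in> faces X 0" for a b
      using that full' linearity_0 X(3) by (metis total_on_def ule_def)
    show "ule X (Suc k) a b \<or> ule X (Suc k) b a"
      if "a \<in> faces X (Suc k)" "b \<in> faces X (Suc k)" "gam S a = gam S b" for k a b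
      using that full' pencil_gam_ule X(3) by metis
    show "ule X (Suc k) a b \<or> ule X (Suc k) b a"
      if "a \<in> faces X (Suc k)" "b \<in> faces X (Suc k)" "x \<in> del S a" "x \<in> del S b" for k a b x
      using that full' pencil_del_ule X(3) by metis
  qed (fact X)+
qed

text \<open>The faces traversed by an upper path are consecutive for the lower order, and the last
  of them has codomain b; for the empty path it is c itself.\<close>

lemma lower_path:
  assumes "c \<in> faces S (Suc k)" "ule S k (gam S c) b"
  shows "\<exists>d\<in>faces S (Suc k). gam S d = b \<and> (c = d \<or> (c, d) \<in> lower S (Suc k))"
  using assms(2) unfolding ule_rtrancl
proof (induction rule: rtrancl_induct)
  case base
  then show ?case using assms(1) by blast
next
  case (step y z)
  then obtain d e where d: "d \<in> faces S (Suc k)" "gam S d = y" "c = d \<or> (c, d) \<in> lower S (Suc k)"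
    and e: "e \<in> faces S (Suc k)" "y \<in> del S e" "gam S e = z"
    by (auto simp: step_def)
  then have "(d, e) \<in> lower S (Suc k)" using lower_step by blast
  with d e lower_trans show ?case by metis
qed

end

text \<open>
  A cut at dimension \<open>k\<close> divides the faces of dimension \<open>k + 1\<close> (and with them those of higher
  dimension) into an initial and a final part; it writes \<open>S\<close> as a \<open>k\<close>-composite. The two trivial
  cuts give the \<open>k\<close>-th domain and codomain.
\<close>

locale cut = positive_opetopic_cardinal S for S :: "'a hypergraph" +
  fixes k :: nat and D :: "'a set"
  assumes D_faces: "D \<subseteq> faces S (Suc k)"
    and D_connected: "\<alpha> \<in> faces S (Suc (Suc k)) \<Longrightarrow> c \<in> del S \<alpha> \<Longrightarrow> c \<in> D \<longleftrightarrow> gam S \<alpha> \<in> D"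
    and D_lower: "c \<in> D \<Longrightarrow> d \<in> faces S (Suc k) \<Longrightarrow> gam S d \<in> del S c \<Longrightarrow> d \<in> D"
begin

text \<open>The faces above dimension \<open>k\<close> whose iterated codomain of dimension
  \<open>k + 1\<close> lies in \<open>D\<close>. Up to dimension \<open>k\<close> the value is empty
  by convention; \<open>low\<close> and \<open>high\<close> are described directly there.\<close>

primrec part :: "nat \<Rightarrow> 'a set" where
  "part 0 = {}"
| "part (Suc l) = (if l < k then {} else if l = k then D else {b \<in> faces S (Suc l). gam S b \<in> part l})"

definition low :: "'a hypergraph" where
  "low = S\<lparr>faces := (\<lambda>l.
     if l < k then faces S l
     else if l = k then (faces S k - gam S ` faces S (Suc k)) \<union> gam S ` D
     else part l)\<rparr>"

text \<open>Faces consumed by \<open>D\<close> disappear in dimension \<open>k\<close>. The internal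
  faces of \<open>D\<close> then bound none of the remaining \<open>k\<close>-faces, by
  \<open>iot_D_boundary\<close>, and disappear one dimension lower.\<close>

definition high :: "'a hypergraph" where
  "high = S\<lparr>faces := (\<lambda>l.
     if Suc l < k then faces S l
     else if Suc l = k then faces S l - iotU S D
     else if l = k then faces S k - delU S D
     else faces S l - part l)\<rparr>"

lemma D_face: "d \<in> D \<Longrightarrow> d \<in> faces S (Suc k)"
  using D_faces by blast

lemma iotU_D_del: "k = Suc j \<Longrightarrow> iotU S D \<subseteq> delU S (faces S (Suc j))"
  using D_face del_face unfolding iotU_iff iot_iff delU_iff subset_iff by metis

lemma iotU_D_gam: "k = Suc j \<Longrightarrow> iotU S D \<subseteq> gam S ` faces S (Suc j)"
  using D_face del_face unfolding iotU_iff iot_iff subset_iff image_iff by metis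

lemma part_faces: "x \<in> part l \<Longrightarrow> x \<in> faces S l"
  using D_faces by (cases l) (auto split: if_splits)

text \<open>Membership is constant on comparability classes: in dimension \<open>k + 1\<close> by
  \<open>D_connected\<close>, above it because \<gamma> is monotone. Pencil linearity then yields
  \<open>D_gam\<close> and \<open>D_del\<close>.\<close>

lemma part_ule: "k < l \<Longrightarrow> ule S l x y \<Longrightarrow> x \<in> part l \<longleftrightarrow> y \<in> part l"
proof (induction l arbitrary: x y)
  case (Suc l)
  show ?case
  proof (cases "l = k")
    case True
    with Suc(3) show ?thesis
      unfolding ule_rtrancl
      by (induction rule: rtrancl_induct) (auto simp: step_def D_connected)
  next
    case False
    with Suc have "gam S x \<in> part l \<longleftrightarrow> gam S y \<in> part l" using ule_gam by simp
    with Suc False show ?thesis using upper_faces by (auto simp: ule_def)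
  qed
qed simp

lemma part_del: "k < l \<Longrightarrow> b \<in> faces S (Suc l) \<Longrightarrow> c \<in> del S b \<Longrightarrow> c \<in> part l \<longleftrightarrow> b \<in> part (Suc l)"
  using part_ule[of l c "gam S b", OF _ upper_ule[OF upper_step]] by auto

lemma D_ule: "ule S (Suc k) c d \<Longrightarrow> c \<in> D \<longleftrightarrow> d \<in> D"
  using part_ule[of "Suc k"] by simp

lemma D_gam: "c \<in> D \<Longrightarrow> d \<in> faces S (Suc k) \<Longrightarrow> gam S c = gam S d \<Longrightarrow> d \<in> D"
  using pencil_gam_ule D_ule D_face by metis

lemma D_del: "c \<in> D \<Longrightarrow> d \<in> faces S (Suc k) \<Longrightarrow> x \<in> del S c \<Longrightarrow> x \<in> del S d \<Longrightarrow> d \<in> D"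
  using pencil_del_ule D_ule D_face by metis

lemma path_part:
  assumes "k < l" "(a, b) \<in> upper S l" "a \<in> part l"
  shows "(a, b) \<in> (step S (part (Suc l)))\<^sup>+"
  using assms(2,3) unfolding upper_eq
proof (induction rule: converse_trancl_induct)
  case (base a)
  then obtain \<alpha> where "\<alpha> \<in> faces S (Suc l)" "a \<in> del S \<alpha>" "gam S \<alpha> = b"
    by (auto simp: step_def)
  with base part_del assms(1) stepI[of \<alpha> "part (Suc l)"] show ?case by blast
next
  case (step a b)
  then obtain \<alpha> where \<alpha>: "\<alpha> \<in> faces S (Suc l)" "a \<in> del S \<alpha>" "gam S \<alpha> = b"
    by (auto simp: step_def)
  with step part_del assms(1) have "\<alpha> \<in> part (Suc l)" by blast
  moreover from this \<alpha> assms(1) have "b \<in> part l" by simp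
  ultimately show ?case using step \<alpha> stepI by (metis trancl_into_trancl2)
qed

lemma path_not_part:
  assumes "k < l" "(a, b) \<in> upper S l" "a \<notin> part l"
  shows "(a, b) \<in> (step S (faces S (Suc l) - part (Suc l)))\<^sup>+"
  using assms(2,3) unfolding upper_eq
proof (induction rule: converse_trancl_induct)
  case (base a)
  then obtain \<alpha> where "\<alpha> \<in> faces S (Suc l)" "a \<in> del S \<alpha>" "gam S \<alpha> = b"
    by (auto simp: step_def)
  with base part_del assms(1) stepI[of \<alpha> "faces S (Suc l) - part (Suc l)"] show ?case by blast
next
  case (step a b)
  then obtain \<alpha> where \<alpha>: "\<alpha> \<in> faces S (Suc l)" "a \<in> del S \<alpha>" "gam S \<alpha> = b"
    by (auto simp: step_def)
  with step part_del assms(1) have n: "\<alpha> \<notin> part (Suc l)" by blast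
  with \<alpha> assms(1) have "b \<notin> part l" by simp
  then show ?case using step \<alpha> n stepI[of \<alpha>] by (metis DiffI trancl_into_trancl2)
qed

text \<open>Read from the end: a face whose codomain lies in \<gamma>(D) belongs to \<open>D\<close>
  by \<open>D_gam\<close>, and the face before it on the path by \<open>D_lower\<close>.\<close>

lemma path_D:
  assumes "(a, b) \<in> upper S k" "b \<in> gam S ` D"
  shows "(a, b) \<in> (step S D)\<^sup>+"
  using assms unfolding upper_eq
proof (induction rule: trancl_induct)
  case (base b)
  then obtain \<alpha> where "\<alpha> \<in> D" "a \<in> del S \<alpha>" "gam S \<alpha> = b"
    using D_gam[OF _ _ sym] by (auto simp: step_def)
  with stepI[of \<alpha> D] show ?case by blast
next
  case (step b c)
  then obtain \<alpha> where \<alpha>: "\<alpha> \<in> D" "b \<in> del S \<alpha>" "gam S \<alpha> = c"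
    using D_gam[OF _ _ sym] by (auto simp: step_def)
  from step(1) obtain \<beta> where "\<beta> \<in> faces S (Suc k)" "gam S \<beta> = b"
    by (auto simp: step_def dest: tranclD2)
  with \<alpha> D_lower step have "(a, b) \<in> (step S D)\<^sup>+" by blast
  with \<alpha> show ?case using stepI[of \<alpha> D] by (metis trancl_into_trancl)
qed

lemma path_not_D:
  assumes "(a, b) \<in> upper S k" "a \<notin> delU S D"
  shows "(a, b) \<in> (step S (faces S (Suc k) - D))\<^sup>+"
  using assms unfolding upper_eq
proof (induction rule: converse_trancl_induct)
  case (base a)
  then obtain \<alpha> where "\<alpha> \<in> faces S (Suc k) - D" "a \<in> del S \<alpha>" "gam S \<alpha> = b"
    by (auto simp: step_def delU_iff)
  with stepI[of \<alpha> "faces S (Suc k) - D"] show ?case by blast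
next
  case (step a b)
  then obtain \<alpha> where \<alpha>: "\<alpha> \<in> faces S (Suc k)" "a \<in> del S \<alpha>" "gam S \<alpha> = b" "\<alpha> \<notin> D"
    by (auto simp: step_def delU_iff)
  with D_lower have "b \<notin> delU S D" by (auto simp: delU_iff)
  with step have "(b, b') \<in> (step S (faces S (Suc k) - D))\<^sup>+ \<longrightarrow> (a, b') \<in> (step S (faces S (Suc k) - D))\<^sup>+" for b'
    using \<alpha> stepI[of \<alpha> "faces S (Suc k) - D"] by (metis DiffI trancl_into_trancl2)
  with step \<open>b \<notin> _\<close> show ?case by blast
qed

lemma not_D_not_below: "b \<notin> delU S D \<Longrightarrow> \<alpha> \<in> D \<Longrightarrow> (b, gam S \<alpha>) \<notin> upper S k"
  using path_D[of b "gam S \<alpha>"] by (auto simp: step_def delU_iff dest: tranclD)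

text \<open>If x bounded b, pencil linearity would compare b with some c in \<delta>(\<alpha>).
  Being outside \<delta>(D), b cannot lie below \<gamma>(\<alpha>), so by the forest property it
  lies above, where an internal face of \<alpha> no longer occurs.\<close>

lemma iot_D_boundary:
  assumes k: "k = Suc j" and b: "b \<in> faces S k" "b \<notin> delU S D" and \<alpha>: "\<alpha> \<in> D" "x \<in> iot S \<alpha>"
  shows "x \<noteq> gam S b \<and> x \<notin> del S b"
proof -
  have \<alpha>f: "\<alpha> \<in> faces S (Suc (Suc j))" using \<alpha> D_face k by blast
  have above: "ule S k (gam S \<alpha>) b" if c: "c \<in> del S \<alpha>" "ule S k c b \<or> ule S k b c" for c
  proof -
    have c': "(c, gam S \<alpha>) \<in> upper S k" using c \<alpha>f k upper_step by blast
    have "b \<noteq> c" using b \<alpha> c by (auto simp: delU_iff)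
    moreover have "(b, c) \<notin> upper S k"
      using c' not_D_not_below b \<alpha> upper_trans by metis
    ultimately have "ule S k c b" using c by (auto simp: ule_def)
    then have "ule S k (gam S \<alpha>) b \<or> ule S k b (gam S \<alpha>)"
      using ule_forest c' upper_ule by metis
    then show ?thesis using not_D_not_below b \<alpha> by (metis ule_def)
  qed
  show ?thesis
  proof (intro conjI notI)
    assume x: "x = gam S b"
    obtain c where c: "c \<in> del S \<alpha>" "x = gam S c" using \<alpha> by (auto simp: iot_iff)
    then have "ule S k c b \<or> ule S k b c" using pencil_gam_ule[of c j b] b k x \<alpha>f del_face by metis
    with above c x iot_ule_gam[OF \<alpha>f] \<alpha> k show False by metis
  next
    assume x: "x \<in> del S b"
    obtain c where c: "c \<in> del S \<alpha>" "x \<in> del S c" using \<alpha> by (auto simp: iot_iff)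
    then have "ule S k c b \<or> ule S k b c" using pencil_del_ule[of c j b] b k x \<alpha>f del_face by metis
    with above c x iot_ule_del[OF \<alpha>f] \<alpha> k b show False by metis
  qed
qed

lemma ex_above_not_del_D:
  "c \<in> faces S k \<Longrightarrow> \<exists>d\<in>faces S k - delU S D. (c, d) \<in> (step S D)\<^sup>*"
proof (induction c rule: wf_induct_rule[OF wf_upper_converse[of k]])
  case (1 c)
  show ?case
  proof (cases "c \<in> delU S D")
    case True
    then obtain \<alpha> where \<alpha>: "\<alpha> \<in> D" "c \<in> del S \<alpha>" by (auto simp: delU_iff)
    then have "(c, gam S \<alpha>) \<in> upper S k" "(c, gam S \<alpha>) \<in> step S D"
      using D_face by (auto intro: upper_step stepI)
    with 1 gam_face D_face \<alpha> show ?thesis by (metis converse_iff converse_rtrancl_into_rtrancl)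
  qed (use 1 in auto)
qed

text \<open>This realises the upper order of \<open>high\<close> in dimension \<open>k - 1\<close>.
  The first face c of a path is pushed up along \<open>D\<close> until it leaves \<delta>(D); a
  stays in its \<delta> because a is not internal to \<open>D\<close>. The real issue is that the
  codomain of the raised face c' must not overshoot b.\<close>

lemma path_not_del_D:
  assumes k: "k = Suc j" and ab: "(a, b) \<in> upper S j" "a \<notin> iotU S D" "b \<notin> iotU S D"
  shows "(a, b) \<in> (step S (faces S k - delU S D))\<^sup>+"
  using ab
proof (induction a rule: wf_induct_rule[OF wf_upper_converse[of j]])
  case (1 a)
  from 1(2) obtain c where c: "c \<in> faces S k" "a \<in> del S c" "ule S j (gam S c) b"
    unfolding upper_eq ule_rtrancl k by (auto simp: step_def dest!: tranclD)
  obtain c' where c': "c' \<in> faces S k - delU S D" "(c, c') \<in> (step S D)\<^sup>*"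
    using ex_above_not_del_D c by blast
  have Df: "D \<subseteq> faces S (Suc (Suc j))" using D_faces k by simp
  have cc': "ule S k c c'" 
    unfolding ule_rtrancl using c'(2) rtrancl_mono[OF step_mono, OF D_faces] by blast
  have ac': "a \<in> del S c'"
    using del_along_path[OF c'(2) Df c(2)] 1 by (auto simp: iotU_iff)
  then have s: "(a, gam S c') \<in> step S (faces S k - delU S D)" "(a, gam S c') \<in> upper S j"
    using c' k by (auto intro: stepI upper_step)
  \<comment> \<open>If it overshot, a face d with \<gamma>(d) = b, equal to c or lower-above it,
    would be upper-below c'. Then c' is a codomain of \<open>D\<close>, the path from d to c' runs
    inside \<open>D\<close>, and it makes b internal to \<open>D\<close>, contrary to
    assumption.\<close>
  have "ule S j (gam S c') b"
  proof (rule ccontr)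
    assume neg: "\<not> ?thesis"
    then have lt: "(b, gam S c') \<in> upper S j"
      using ule_forest[of j a b "gam S c'"] s 1 by (metis ule_def)
    obtain d where d: "d \<in> faces S k" "gam S d = b" "c = d \<or> (c, d) \<in> lower S k"
      using lower_path[of c j b] c k by auto
    have "(d, c') \<in> upper S k \<or> (d, c') \<in> lower S k"
      using upper_gamD[of d j c'] d c' lt k by auto
    moreover have "(d, c') \<notin> lower S k"
      using d cc' not_ule_lower lower_trans by metis
    ultimately have dc': "(d, c') \<in> upper S k" by blast
    then have "c \<noteq> c'" using d upper_irrefl not_upper_lower by metis
    then have "c' \<in> gam S ` D" using c'(2)
      by (auto simp: step_def rtrancl_eq_or_trancl dest!: tranclD2)
    then have "(d, c') \<in> (step S D)\<^sup>*" using path_D dc' by (simp add: trancl_into_rtrancl)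
    from gam_along_path[OF this Df] d 1 lt upper_irrefl show False
      by (auto simp: iotU_iff)
  qed
  then consider "gam S c' = b" | "(gam S c', b) \<in> upper S j" by (auto simp: ule_def)
  then show ?case
  proof cases
    case 1
    with s show ?thesis by auto
  next
    case 2
    have "gam S c' \<notin> iotU S D"
      using iot_D_boundary[OF k] c' by (auto simp: iotU_iff)
    with 1 2 s have "(gam S c', b) \<in> (step S (faces S k - delU S D))\<^sup>+" by simp
    with s(1) show ?thesis by (rule trancl_into_trancl2)
  qed
qed

lemma subcell_low: "subcell low S"
proof (rule subcell_fullI)
  show "gam low = gam S" "del low = del S" by (auto simp: low_def)
  show low_sub: "a \<in> faces low l \<Longrightarrow> a \<in> faces S l" for a l
    using part_faces by (auto simp: low_def D_face gam_face split: if_splits)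
  show "gam S a \<in> faces low l" if "a \<in> faces low (Suc l)" for a l
    using that D_face gam_face by (fastforce simp: low_def split: if_splits)
  show "x \<in> faces low l" if a: "a \<in> faces low (Suc l)" and x: "x \<in> del S a" for a l x
  proof -
    consider "l < k" | "l = k" | "k < l" by linarith
    then show ?thesis
    proof cases
      case 1
      with low_sub[OF a] x del_face show ?thesis by (simp add: low_def)
    next
      case 2
      with a have aD: "a \<in> D" by (auto simp: low_def)
      \<comment> \<open>Since \<open>D\<close> is initial, a face of \<delta>(a) that is a codomain
        at all is the codomain of a member of \<open>D\<close>, and so it was kept.\<close>
      then have "x \<in> gam S ` D" if "x \<in> gam S ` faces S (Suc k)"
        using that x D_lower by blast
      then show ?thesis using x 2 del_face[OF D_face[OF aD] x] by (auto simp: low_def)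
    next
      case 3
      then have "a \<in> part (Suc l)" using a by (auto simp: low_def)
      then have "x \<in> part l" using 3 x part_del part_faces by blast
      with 3 show ?thesis by (simp add: low_def)
    qed
  qed
  obtain x where "x \<in> faces S 0" using nonempty by blast
  then have "minf 0 \<noteq> {}" using ex_minf by blast
  moreover have "minf 0 \<subseteq> faces low 0" by (auto simp: low_def minf_def)
  ultimately show "faces low 0 \<noteq> {}" by blast
  show "(a, b) \<in> (step S (faces low (Suc l)))\<^sup>+"
    if "a \<in> faces low l" "b \<in> faces low l" "(a, b) \<in> upper S l" for a b l
  proof -
    consider "l < k" | "l = k" | "k < l" by linarith
    then show ?thesis
    proof cases
      case 1
      then have "minf (Suc l) \<subseteq> faces low (Suc l)"
        by (cases "Suc l = k") (auto simp: low_def minf_def)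
      with that(3) show ?thesis unfolding upper_minf using trancl_mono_subset[OF step_mono] by blast
    next
      case 2
      have "b \<in> gam S ` faces S (Suc k)"
        using that(3) 2 unfolding upper_eq by (auto simp: step_def dest!: tranclD2)
      with that 2 have "b \<in> gam S ` D" by (auto simp: low_def)
      with path_D that 2 show ?thesis by (auto simp: low_def)
    next
      case 3
      with that path_part show ?thesis by (auto simp: low_def)
    qed
  qed
qed

lemma subcell_high: "subcell high S"
proof (rule subcell_fullI)
  show "gam high = gam S" "del high = del S" by (auto simp: high_def)
  show high_sub: "a \<in> faces high l \<Longrightarrow> a \<in> faces S l" for a l
    by (auto simp: high_def split: if_splits)
  have "gam S a \<in> faces high l \<and> (\<forall>x\<in>del S a. x \<in> faces high l)" if "a \<in> faces high (Suc l)" for a l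
  proof -
    consider "Suc l < k" | "Suc l = k" | "l = k" | "k < l" by linarith
    then show ?thesis
    proof cases
      case 1
      with high_sub[OF that] gam_face del_face show ?thesis by (simp add: high_def)
    next
      case 2
      then have "a \<in> faces S k" "a \<notin> delU S D" using that by (auto simp: high_def)
      with 2 iot_D_boundary[of l a] gam_face[of a l] del_face[of a l] show ?thesis
        by (auto simp: high_def iotU_iff)
    next
      case 3
      then have a: "a \<in> faces S (Suc k)" "a \<notin> D" using that by (auto simp: high_def)
      then have "gam S a \<notin> delU S D" "\<forall>x\<in>del S a. x \<notin> delU S D"
        unfolding delU_iff using D_lower D_del a by blast+
      with 3 gam_face[OF a(1)] del_faces[OF a(1)] show ?thesis by (auto simp: high_def)
    next
      case 4
      then have a: "a \<in> faces S (Suc l)" "a \<notin> part (Suc l)" using that by (auto simp: high_def)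
      with 4 part_del have "\<forall>x\<in>del S a. x \<notin> part l" by blast
      with 4 a gam_face[OF a(1)] del_faces[OF a(1)] show ?thesis by (auto simp: high_def)
    qed
  qed
  then show "a \<in> faces high (Suc l) \<Longrightarrow> gam S a \<in> faces high l"
    "a \<in> faces high (Suc l) \<Longrightarrow> x \<in> del S a \<Longrightarrow> x \<in> faces high l" for a l x by blast+
  obtain x where "x \<in> faces S 0" using nonempty by blast
  then have "maxf 0 \<noteq> {}" using ex_maxf by blast
  moreover have "maxf 0 \<subseteq> faces high 0"
  proof (cases "k = 0")
    case True
    show ?thesis unfolding high_def maxf_def using True D_faces by (simp add: delU_def) blast
  next
    case False
    then show ?thesis unfolding high_def maxf_def using iotU_D_del[of 0] by auto
  qed
  ultimately show "faces high 0 \<noteq> {}" by blast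
  show "(a, b) \<in> (step S (faces high (Suc l)))\<^sup>+"
    if "a \<in> faces high l" "b \<in> faces high l" "(a, b) \<in> upper S l" for a b l
  proof -
    consider "Suc l < k" | "Suc l = k" | "l = k" | "k < l" by linarith
    then show ?thesis
    proof cases
      case 1
      \<comment> \<open>In dimension \<open>k - 1\<close> only internal faces are deleted; these are
        codomains, hence not minimal.\<close>
      then have "minf (Suc l) \<subseteq> faces high (Suc l)"
        using iotU_D_gam[of "Suc l"] by (auto simp: high_def minf_def)
      with that(3) show ?thesis unfolding upper_minf using trancl_mono_subset[OF step_mono] by blast
    next
      case 2
      with that have "a \<notin> iotU S D" "b \<notin> iotU S D" by (auto simp: high_def)
      with path_not_del_D[of l a b] that 2 have "(a, b) \<in> (step S (faces S k - delU S D))\<^sup>+" by simp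
      moreover have "faces high (Suc l) = faces S k - delU S D" using 2 by (auto simp: high_def)
      ultimately show ?thesis by simp
    next
      case 3
      with that path_not_D show ?thesis by (auto simp: high_def)
    next
      case 4
      with that path_not_part show ?thesis by (auto simp: high_def)
    qed
  qed
qed

end

section \<open>The \<open>\<omega>\<close>-category of a positive opetopic cardinal\<close>

lemma hypergraph_update_simps [simp]:
  "delU (S\<lparr>faces := F\<rparr>) = delU S"
  "iot (S\<lparr>faces := F\<rparr>) = iot S"
  "iotU (S\<lparr>faces := F\<rparr>) = iotU S"
  by (simp_all add: fun_eq_iff delU_def iot_def iotU_def)

lemma hdom_simps [simp]:
  "gam (hdom k X) = gam X" "del (hdom k X) = del X" "delU (hdom k X) = delU X" "iotU (hdom k X) = iotU X"
  by (simp_all add: hdom_def)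

lemma hcod_simps [simp]:
  "gam (hcod k X) = gam X" "del (hcod k X) = del X" "delU (hcod k X) = delU X" "iotU (hcod k X) = iotU X"
  by (simp_all add: hcod_def)

lemma hunion_simps [simp]:
  "gam (hunion X Y) = gam X" "del (hunion X Y) = del X" "delU (hunion X Y) = delU X"
  "iotU (hunion X Y) = iotU X" "faces (hunion X Y) l = faces X l \<union> faces Y l"
  by (simp_all add: hunion_def)

lemma faces_hdom:
  "faces (hdom k X) l =
    (if l < k then faces X l else if l = k then faces X k - gam X ` faces X (Suc k) else {})"
  by (simp add: hdom_def)

lemma faces_hcod:
  "faces (hcod k X) l =
    (if Suc l < k then faces X l
     else if Suc l = k then faces X l - iotU X (faces X (Suc k))
     else if l = k then faces X k - delU X (faces X (Suc k))
     else {})"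
  by (simp add: hcod_def)

lemma gam_del_cong:
  assumes "gam X = gam S" "del X = del S"
  shows "delU X = delU S" "iot X = iot S" "iotU X = iotU S"
  using assms by (simp_all add: fun_eq_iff delU_def iot_def iotU_def)

lemma subcell_eqs:
  "subcell X S \<Longrightarrow> delU X = delU S" "subcell X S \<Longrightarrow> iot X = iot S" "subcell X S \<Longrightarrow> iotU X = iotU S"
  using gam_del_cong[of X S] subcell_gam[of X S] subcell_del[of X S] by auto

section \<open>Domains, codomains and the globular identities\<close>

context positive_opetopic_cardinal
begin

lemma cut_empty: "cut S k {}"
  by unfold_locales auto

lemma cut_full: "cut S k (faces S (Suc k))"
  by unfold_locales (use gam_face del_face in blast)+

lemma subcell_hdom: "subcell (hdom k S) S"
proof -
  interpret cut S k "{}" by (rule cut_empty)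
  have "part l = {}" for l by (induction l) auto
  then have "low = hdom k S" by (intro hypergraph_eqI) (auto simp: low_def faces_hdom)
  with subcell_low show ?thesis by simp
qed

lemma subcell_hcod: "subcell (hcod k S) S"
proof -
  interpret cut S k "faces S (Suc k)" by (rule cut_full)
  have "part l = faces S l" if "k < l" for l
    using that by (induction l) (auto simp: less_Suc_eq intro: gam_face)
  then have "high = hcod k S" by (intro hypergraph_eqI) (auto simp: high_def faces_hcod)
  with subcell_high show ?thesis by simp
qed

lemma hdim_le_iff: "hdim S \<le> n \<longleftrightarrow> (\<forall>l>n. faces S l = {})"
  unfolding hdim_def using nonempty finitely_many_dims
  by (subst Max_le_iff) (auto simp: not_le[symmetric])

text \<open>Descent by globularity: \<gamma>(\<alpha>) shares its codomain with some face of
  \<delta>(\<alpha>), which is strictly smaller. With \<open>ex_minf_del\<close> and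
  \<open>ex_minf_iot\<close> it shows that \<gamma>, \<delta> and \<iota> of the set of all faces do
  not change when non-minimal faces are dropped.\<close>

lemma ex_minf_gam:
  "c \<in> faces S (Suc k) \<Longrightarrow> \<exists>d\<in>minf (Suc k). ule S (Suc k) d c \<and> gam S d = gam S c"
proof (induction c rule: wf_induct_rule[OF wf_upper[of "Suc k"]])
  case (1 c)
  show ?case
  proof (cases "c \<in> minf (Suc k)")
    case True
    then show ?thesis using ule_refl by metis
  next
    case False
    with 1 obtain \<alpha> where \<alpha>: "\<alpha> \<in> faces S (Suc (Suc k))" "c = gam S \<alpha>" by (auto simp: minf_def)
    then obtain d where d: "d \<in> del S \<alpha>" "gam S c = gam S d" using gam_gam_in by blast
    then have "(d, c) \<in> upper S (Suc k)" using \<alpha> upper_step by blast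
    with 1 d upper_faces ule_trans upper_ule show ?thesis by metis
  qed
qed

lemma ex_minf_del:
  "c \<in> faces S (Suc k) \<Longrightarrow> x \<in> del S c \<Longrightarrow> \<exists>d\<in>minf (Suc k). ule S (Suc k) d c \<and> x \<in> del S d"
proof (induction c rule: wf_induct_rule[OF wf_upper[of "Suc k"]])
  case (1 c)
  show ?case
  proof (cases "c \<in> minf (Suc k)")
    case True
    then show ?thesis using ule_refl 1 by metis
  next
    case False
    with 1 obtain \<alpha> where \<alpha>: "\<alpha> \<in> faces S (Suc (Suc k))" "c = gam S \<alpha>" by (auto simp: minf_def)
    then obtain d where d: "d \<in> del S \<alpha>" "x \<in> del S d" using del_gamD 1 by blast
    then have "(d, c) \<in> upper S (Suc k)" using \<alpha> upper_step by blast
    with 1 d upper_faces ule_trans upper_ule show ?thesis by metis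
  qed
qed

text \<open>
  For \<open>\<subseteq>\<close>, one climbs in \<open>\<delta>(\<alpha>)\<close> along faces with the same codomain; for \<open>\<supseteq>\<close>, one descends
  from \<open>\<delta>(c)\<close> to \<open>\<delta>\<gamma>(\<alpha>)\<close>.
\<close>

lemma iot_gam:
  assumes \<alpha>: "\<alpha> \<in> faces S (Suc (Suc (Suc k)))"
  shows "iot S (gam S \<alpha>) = iotU S (del S \<alpha>)"
proof
  show "iot S (gam S \<alpha>) \<subseteq> iotU S (del S \<alpha>)"
  proof
    fix y assume y: "y \<in> iot S (gam S \<alpha>)"
    have g\<alpha>: "gam S \<alpha> \<in> faces S (Suc (Suc k))" using \<alpha> gam_face by blast
    have climb: "y \<in> iotU S (del S \<alpha>)" if "c \<in> del S \<alpha>" "x \<in> del S c" "gam S x = y" for c x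
      using that
    proof (induction x arbitrary: c rule: wf_induct_rule[OF wf_upper_converse[of "Suc k"]])
      case (1 x)
      have cf: "c \<in> faces S (Suc (Suc k))" using 1 \<alpha> del_face by blast
      show ?case
      proof (cases "y \<in> iot S c")
        case True
        with 1 show ?thesis by (auto simp: iotU_iff)
      next
        case False
        then have y': "y = gam S (gam S c)" using gam_del_cases[OF cf] 1 by metis
        have "gam S c \<noteq> gam S (gam S \<alpha>)" using gam_gam_notin_iot[OF g\<alpha>] y y' by metis
        then obtain c' where c': "c' \<in> del S \<alpha>" "gam S c \<in> del S c'"
          using gam_del_cases[OF \<alpha>] 1 by (metis iot_iff)
        then show ?thesis using 1(1)[of "gam S c" c'] upper_step[OF cf] 1 y' by simp
      qed
    qed
    obtain x where x: "x \<in> del S (gam S \<alpha>)" "gam S x = y" using y by (auto simp: iot_iff)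
    then obtain c where "c \<in> del S \<alpha>" "x \<in> del S c" using del_gamD[OF \<alpha>] by blast
    with climb x show "y \<in> iotU S (del S \<alpha>)" by blast
  qed
  show "iotU S (del S \<alpha>) \<subseteq> iot S (gam S \<alpha>)"
  proof
    fix y assume "y \<in> iotU S (del S \<alpha>)"
    then obtain c where c: "c \<in> del S \<alpha>" "y \<in> iot S c" by (auto simp: iotU_iff)
    have descend_gam: "\<exists>x\<in>del S (gam S \<alpha>). gam S x = y" if "c \<in> del S \<alpha>" "x \<in> del S c" "gam S x = y" for c x
      using that
    proof (induction x arbitrary: c rule: wf_induct_rule[OF wf_upper[of "Suc k"]])
      case (1 x)
      show ?case
      proof (cases "x \<in> iot S \<alpha>")
        case False
        with 1 del_del_cases[OF \<alpha>] show ?thesis by blast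
      next
        case True
        then obtain d where d: "d \<in> del S \<alpha>" "x = gam S d" by (auto simp: iot_iff)
        then have df: "d \<in> faces S (Suc (Suc k))" using \<alpha> del_face by blast
        obtain x' where x': "x' \<in> del S d" "gam S x = gam S x'" using gam_gam_in[OF df] d by auto
        then show ?thesis using 1(1)[of x' d] upper_step[OF df] d 1 by simp
      qed
    qed
    have descend_del: "\<exists>x\<in>del S (gam S \<alpha>). y \<in> del S x" if "c \<in> del S \<alpha>" "x \<in> del S c" "y \<in> del S x" for c x
      using that
    proof (induction x arbitrary: c rule: wf_induct_rule[OF wf_upper[of "Suc k"]])
      case (1 x)
      show ?case
      proof (cases "x \<in> iot S \<alpha>")
        case False
        with 1 del_del_cases[OF \<alpha>] show ?thesis by blast
      next
        case True
        then obtain d where d: "d \<in> del S \<alpha>" "x = gam S d" by (auto simp: iot_iff)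
        then have df: "d \<in> faces S (Suc (Suc k))" using \<alpha> del_face by blast
        obtain x' where x': "x' \<in> del S d" "y \<in> del S x'" using del_gamD[OF df, of y] d 1 by blast
        then show ?thesis using 1(1)[of x' d] upper_step[OF df] d by simp
      qed
    qed
    show "y \<in> iot S (gam S \<alpha>)"
      using c descend_gam descend_del unfolding iot_iff by metis
  qed
qed

lemma ex_minf_iot:
  "c \<in> faces S (Suc (Suc k)) \<Longrightarrow> x \<in> iot S c \<Longrightarrow> \<exists>d\<in>minf (Suc (Suc k)). x \<in> iot S d"
proof (induction c rule: wf_induct_rule[OF wf_upper[of "Suc (Suc k)"]])
  case (1 c)
  show ?case
  proof (cases "c \<in> minf (Suc (Suc k))")
    case False
    with 1 obtain \<alpha> where \<alpha>: "\<alpha> \<in> faces S (Suc (Suc (Suc k)))" "c = gam S \<alpha>" by (auto simp: minf_def)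
    then obtain d where d: "d \<in> del S \<alpha>" "x \<in> iot S d" using iot_gam 1 by (auto simp: iotU_iff)
    then have "(d, c) \<in> upper S (Suc (Suc k))" using \<alpha> upper_step by blast
    with 1 d upper_faces show ?thesis by metis
  qed (use 1 in blast)
qed

text \<open>By \<open>iot_gam\<close>, climbing loses no internal faces. For \<gamma> and \<delta>
  it can lose faces, but only internal ones, as \<open>gam_maxf\<close> and \<open>del_maxf\<close>
  record.\<close>

lemma ex_maxf_iot:
  "c \<in> faces S (Suc (Suc k)) \<Longrightarrow> x \<in> iot S c \<Longrightarrow> \<exists>d\<in>maxf (Suc (Suc k)). x \<in> iot S d"
proof (induction c rule: wf_induct_rule[OF wf_upper_converse[of "Suc (Suc k)"]])
  case (1 c)
  show ?case
  proof (cases "c \<in> maxf (Suc (Suc k))")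
    case False
    with 1 obtain \<alpha> where \<alpha>: "\<alpha> \<in> faces S (Suc (Suc (Suc k)))" "c \<in> del S \<alpha>"
      by (auto simp: maxf_def delU_iff)
    then have "x \<in> iot S (gam S \<alpha>)" using iot_gam 1 by (auto simp: iotU_iff)
    moreover have "(c, gam S \<alpha>) \<in> upper S (Suc (Suc k))" using \<alpha> upper_step by blast
    ultimately show ?thesis using 1 upper_faces converse_iff by metis
  qed (use 1 in blast)
qed

lemma maxf_faces: "maxf k \<subseteq> faces S k"
  by (auto simp: maxf_def)

lemma gam_minf: "minf (Suc k) \<subseteq> A \<Longrightarrow> A \<subseteq> faces S (Suc k) \<Longrightarrow> gam S ` A = gam S ` faces S (Suc k)"
  using ex_minf_gam unfolding image_iff set_eq_iff subset_iff by metis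

lemma del_minf: "minf (Suc k) \<subseteq> A \<Longrightarrow> A \<subseteq> faces S (Suc k) \<Longrightarrow> delU S A = delU S (faces S (Suc k))"
  using ex_minf_del unfolding delU_iff set_eq_iff subset_iff by metis

lemma iot_minf: "minf (Suc (Suc k)) \<subseteq> A \<Longrightarrow> A \<subseteq> faces S (Suc (Suc k)) \<Longrightarrow>
    iotU S A = iotU S (faces S (Suc (Suc k)))"
  using ex_minf_iot unfolding iotU_iff set_eq_iff subset_iff by metis

lemma iot_maxf: "iotU S (maxf (Suc (Suc k))) = iotU S (faces S (Suc (Suc k)))"
  using ex_maxf_iot maxf_faces unfolding iotU_iff set_eq_iff subset_iff by metis

text \<open>Climbing from c to a maximal face either preserves \<gamma>(c) or makes it internal.
  Hence deleting \<iota> and then the codomains of the maximal faces deletes exactly all codomains,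
  which is \<open>hdom_hcod\<close> for adjacent dimensions.\<close>

lemma gam_maxf: "gam S ` faces S (Suc k) = gam S ` maxf (Suc k) \<union> iotU S (faces S (Suc (Suc k)))"
proof
  show "gam S ` faces S (Suc k) \<subseteq> gam S ` maxf (Suc k) \<union> iotU S (faces S (Suc (Suc k)))"
  proof
    fix x assume "x \<in> gam S ` faces S (Suc k)"
    then obtain c where c: "c \<in> faces S (Suc k)" "x = gam S c" by blast
    then obtain d where "d \<in> maxf (Suc k)" "ule S (Suc k) c d" using ex_maxf by blast
    with gam_ule_cases c show "x \<in> gam S ` maxf (Suc k) \<union> iotU S (faces S (Suc (Suc k)))"
      unfolding iotU_iff Un_iff image_iff by metis
  qed
  show "gam S ` maxf (Suc k) \<union> iotU S (faces S (Suc (Suc k))) \<subseteq> gam S ` faces S (Suc k)"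
    using maxf_faces cut.iotU_D_gam[OF cut_full] by blast
qed

lemma del_maxf: "delU S (faces S (Suc k)) = delU S (maxf (Suc k)) \<union> iotU S (faces S (Suc (Suc k)))"
proof
  show "delU S (faces S (Suc k)) \<subseteq> delU S (maxf (Suc k)) \<union> iotU S (faces S (Suc (Suc k)))"
  proof
    fix x assume "x \<in> delU S (faces S (Suc k))"
    then obtain c where c: "c \<in> faces S (Suc k)" "x \<in> del S c" by (auto simp: delU_iff)
    then obtain d where "d \<in> maxf (Suc k)" "ule S (Suc k) c d" using ex_maxf by blast
    with del_ule c show "x \<in> delU S (maxf (Suc k)) \<union> iotU S (faces S (Suc (Suc k)))"
      unfolding iotU_iff Un_iff delU_iff by metis
  qed
  show "delU S (maxf (Suc k)) \<union> iotU S (faces S (Suc (Suc k))) \<subseteq> delU S (faces S (Suc k))"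
    using maxf_faces[of "Suc k"] cut.iotU_D_del[OF cut_full] unfolding delU_def by blast
qed

lemma hdom_between: "l < k \<Longrightarrow> minf (Suc l) \<subseteq> faces (hdom k S) (Suc l) \<and> faces (hdom k S) (Suc l) \<subseteq> faces S (Suc l)"
  by (cases "Suc l = k") (auto simp: faces_hdom minf_def)

text \<open>The range stops one dimension earlier than in \<open>hdom_between\<close>: in dimension
  \<open>k\<close> the codomain keeps the maximal faces instead of the minimal ones. Adjacent
  dimensions are therefore a separate case in \<open>hdom_hcod\<close> and
  \<open>hcod_hcod\<close>.\<close>

lemma hcod_between: "Suc l < k \<Longrightarrow> minf (Suc l) \<subseteq> faces (hcod k S) (Suc l) \<and> faces (hcod k S) (Suc l) \<subseteq> faces S (Suc l)"
  using gam_maxf[of "Suc l"] by (cases "Suc (Suc l) = k") (auto simp: faces_hcod minf_def)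

lemma hdom_hdom: "j < k \<Longrightarrow> hdom j (hdom k S) = hdom j S"
  using gam_minf[of j "faces (hdom k S) (Suc j)"] hdom_between[of j k]
  by (intro hypergraph_eqI) (simp_all, simp add: faces_hdom)

lemma hdom_hcod: "j < k \<Longrightarrow> hdom j (hcod k S) = hdom j S"
proof (rule hypergraph_eqI)
  fix l assume jk: "j < k"
  show "faces (hdom j (hcod k S)) l = faces (hdom j S) l"
  proof (cases "Suc j = k")
    case True
    then show ?thesis using gam_maxf[of j]
      by (cases "l = j") (auto simp: faces_hdom faces_hcod maxf_def)
  next
    case False
    with jk have "Suc j < k" by simp
    then have "gam S ` faces (hcod k S) (Suc j) = gam S ` faces S (Suc j)"
      using gam_minf[of j "faces (hcod k S) (Suc j)"] hcod_between[of j k] by simp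
    then show ?thesis using \<open>Suc j < k\<close> by (simp add: faces_hdom) (simp add: faces_hcod)
  qed
qed simp_all

lemma hcod_hdom: "j < k \<Longrightarrow> hcod j (hdom k S) = hcod j S"
proof (rule hypergraph_eqI)
  fix l assume jk: "j < k"
  have "delU S (faces (hdom k S) (Suc j)) = delU S (faces S (Suc j))"
    using del_minf[of j "faces (hdom k S) (Suc j)"] hdom_between[of j k] jk by simp
  moreover have "iotU S (faces (hdom k S) (Suc j)) = iotU S (faces S (Suc j))" if "Suc l = j"
    using iot_minf[of l "faces (hdom k S) (Suc j)"] hdom_between[of j k] jk that by auto
  ultimately show "faces (hcod j (hdom k S)) l = faces (hcod j S) l"
    using jk by (simp add: faces_hcod) (simp add: faces_hdom)
qed simp_all

lemma hcod_hcod: "j < k \<Longrightarrow> hcod j (hcod k S) = hcod j S"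
proof (rule hypergraph_eqI)
  fix l assume jk: "j < k"
  show "faces (hcod j (hcod k S)) l = faces (hcod j S) l"
  proof (cases "Suc j = k")
    case True
    have "faces (hcod k S) (Suc j) = maxf (Suc j)" using True by (auto simp: faces_hcod maxf_def)
    moreover have "iotU S (maxf (Suc j)) = iotU S (faces S (Suc j))" if "Suc l = j"
      using iot_maxf[of l] that by auto
    moreover have "faces S j - iotU S (faces S (Suc k)) - delU S (maxf (Suc j)) =
        faces S j - delU S (faces S (Suc j))"
      using del_maxf[of j] True by auto
    ultimately show ?thesis using True by (simp add: faces_hcod[of j]) (auto simp: faces_hcod)
  next
    case False
    with jk have jk': "Suc j < k" by simp
    have "delU S (faces (hcod k S) (Suc j)) = delU S (faces S (Suc j))"
      using del_minf[of j "faces (hcod k S) (Suc j)"] hcod_between[of j k] jk' by simp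
    moreover have "iotU S (faces (hcod k S) (Suc j)) = iotU S (faces S (Suc j))" if "Suc l = j"
      using iot_minf[of l "faces (hcod k S) (Suc j)"] hcod_between[of j k] jk' that by auto
    ultimately show ?thesis
      using jk' by (simp add: faces_hcod[of j]) (simp add: faces_hcod)
  qed
qed simp_all

lemma hdom_id: "hdim S \<le> k \<Longrightarrow> hdom k S = S"
  by (intro hypergraph_eqI) (auto simp: faces_hdom hdim_le_iff)

lemma hcod_id: "hdim S \<le> k \<Longrightarrow> hcod k S = S"
  by (intro hypergraph_eqI) (auto simp: faces_hcod hdim_le_iff delU_iff iotU_iff)

end

section \<open>Gluing composable cells\<close>

locale composable = positive_opetopic_cardinal S for S :: "'a hypergraph" +
  fixes k :: nat and X Y :: "'a hypergraph"
  assumes X: "subcell X S" and Y: "subcell Y S" and comp: "hcod k X = hdom k Y"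
begin

interpretation X: positive_opetopic_cardinal X using X by (rule subcell_poc)
interpretation Y: positive_opetopic_cardinal Y using Y by (rule subcell_poc)

lemma eqs [simp]:
  "gam X = gam S" "del X = del S" "delU X = delU S" "iot X = iot S" "iotU X = iotU S"
  "gam Y = gam S" "del Y = del S" "delU Y = delU S" "iot Y = iot S" "iotU Y = iotU S"
  using X Y subcell_eqs[of X S] subcell_eqs[of Y S] subcell_gam subcell_del by auto

lemma faces_comp: "faces (hcod k X) l = faces (hdom k Y) l"
  using comp by simp

lemma below: "l < k \<Longrightarrow> faces Y l = (if Suc l = k then faces X l - iotU S (faces X (Suc k)) else faces X l)"
  using faces_comp[of l] by (auto simp: faces_hcod faces_hdom split: if_splits)

lemma below_subset: "l < k \<Longrightarrow> faces Y l \<subseteq> faces X l"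
  using below by auto

lemma top: "X.maxf k = Y.minf k"
  using faces_comp[of k] by (simp add: faces_hcod faces_hdom X.maxf_def Y.minf_def)

text \<open>The common boundary is itself a cell of \<open>S\<close> and has no faces above
  dimension \<open>k\<close>. By \<open>subcell_upperD\<close> a comparison in \<open>S\<close>
  would have to be realised there, where no upper step in dimension \<open>k\<close> exists.\<close>

lemma top_antichain:
  assumes "a \<in> X.maxf k" "b \<in> X.maxf k" shows "(a, b) \<notin> upper S k"
proof
  assume "(a, b) \<in> upper S k"
  have Z: "subcell (hcod k X) S" using X.subcell_hcod X by (rule subcell_trans)
  have "a \<in> faces (hcod k X) k" "b \<in> faces (hcod k X) k"
    using assms by (auto simp: faces_hcod X.maxf_def)
  with subcell_upperD[OF Z] \<open>(a, b) \<in> upper S k\<close> have "(a, b) \<in> upper (hcod k X) k" by blast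
  then show False by (auto simp: upper_eq faces_hcod step_def)
qed

lemma top_ule: "a \<in> X.maxf k \<Longrightarrow> b \<in> X.maxf k \<Longrightarrow> ule S k a b \<Longrightarrow> a = b"
  using top_antichain by (auto simp: ule_def)

lemma X_ule: "ule X l a b \<Longrightarrow> ule S l a b" and Y_ule: "ule Y l a b \<Longrightarrow> ule S l a b"
  using subcell_ule[OF X] subcell_ule[OF Y] by auto

text \<open>The face z lies above a minimal face of \<open>Y\<close> and below a maximal face of
  \<open>X\<close>; both belong to the antichain of \<open>top\<close>, so all three
  coincide.\<close>

lemma common:
  assumes "z \<in> faces X k" "z \<in> faces Y k" shows "z \<in> X.maxf k"
proof -
  obtain x where x: "x \<in> X.maxf k" "ule X k z x" using X.ex_maxf assms by blast
  obtain y where y: "y \<in> Y.minf k" "ule Y k y z" using Y.ex_minf assms by blast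
  have "ule S k y x" using x y X_ule Y_ule ule_trans by metis
  then have "y = x" using top_ule top x y by auto
  then have "z = x" using x y X_ule Y_ule ule_antisym by metis
  with x show ?thesis by simp
qed

lemma common_not_del: "z \<in> faces Y k \<Longrightarrow> z \<notin> delU S (faces X (Suc k))"
  using common X.del_face by (fastforce simp: X.maxf_def delU_iff)

lemma common_not_gam: "z \<in> faces X k \<Longrightarrow> z \<notin> gam S ` faces Y (Suc k)"
  using common top Y.gam_face by (fastforce simp: Y.minf_def)

lemma disjoint_above: "k < l \<Longrightarrow> faces X l \<inter> faces Y l = {}"
proof (induction l)
  case (Suc l)
  show ?case
  proof (cases "l = k")
    case True
    then show ?thesis using common_not_gam X.gam_face[of _ k] by auto
  next
    case False
    with Suc have "faces X l \<inter> faces Y l = {}" by simp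
    then show ?thesis using X.gam_face[of _ l] Y.gam_face[of _ l] by auto
  qed
qed simp

lemma ule_X: "ule X l a b \<Longrightarrow> ule (hunion X Y) l a b"
  unfolding ule_rtrancl by (rule rev_subsetD, assumption, rule rtrancl_mono) (auto simp: step_def)

lemma ule_Y: "ule Y l a b \<Longrightarrow> ule (hunion X Y) l a b"
  unfolding ule_rtrancl by (rule rev_subsetD, assumption, rule rtrancl_mono) (auto simp: step_def)

text \<open>Only dimension \<open>k\<close> is delicate. There a is raised to the top of
  \<open>X\<close> and b is lowered to the bottom of \<open>Y\<close> without changing the codomain;
  the end points meet in the antichain, so a is below b. Below \<open>k\<close> everything happens
  in \<open>X\<close>, and above \<open>k\<close> no such pair exists.\<close>

lemma pencil_gam_cross:
  assumes a: "a \<in> faces X (Suc j)" and b: "b \<in> faces Y (Suc j)" and eq: "gam S a = gam S b"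
  shows "ule (hunion X Y) (Suc j) a b \<or> ule (hunion X Y) (Suc j) b a"
proof -
  consider "Suc j < k" | "Suc j = k" | "k \<le> j" by linarith
  then show ?thesis
  proof cases
    case 1
    then have "b \<in> faces X (Suc j)" using below_subset b by blast
    then show ?thesis using X.pencil_gam_ule a eq ule_X by (metis eqs(1))
  next
    case 2
    obtain x where x: "x \<in> X.maxf k" "ule X k a x" using X.ex_maxf a 2 by blast
    have "gam S a \<in> faces Y j" using Y.gam_face[OF b] eq by auto
    \<comment> \<open>As a face of \<open>Y\<close> it survived the deletion of the internal faces
      of \<open>X\<close>, so the climb to x cannot lose it.\<close>
    then have "gam S a \<notin> iotU S (faces X (Suc k))" using below[of j] 2 by auto
    then have gx: "gam S x = gam S a" using X.gam_ule_cases[of j a x] x 2 by (auto simp: iotU_iff)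
    obtain y where y: "y \<in> Y.minf k" "ule Y k y b" "gam S y = gam S b"
      using Y.ex_minf_gam[of b j] b 2 by auto
    have y': "y \<in> X.maxf k" using y top by simp
    have "ule X k x y \<or> ule X k y x"
      using X.pencil_gam_ule[of x j y] X.maxf_faces[of k] x y y' gx eq 2 by auto
    then have "x = y" using top_ule x y' X_ule by metis
    then show ?thesis using ule_trans ule_X ule_Y x y 2 by metis
  next
    case 3
    have "gam S a \<in> faces X j" "gam S a \<in> faces Y j"
      using X.gam_face[OF a] Y.gam_face[OF b] eq by auto
    then show ?thesis using 3 disjoint_above[of j] common_not_gam b eq by (cases "k = j") auto
  qed
qed

lemma pencil_del_cross:
  assumes a: "a \<in> faces X (Suc j)" and b: "b \<in> faces Y (Suc j)" and z: "z \<in> del S a" "z \<in> del S b"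
  shows "ule (hunion X Y) (Suc j) a b \<or> ule (hunion X Y) (Suc j) b a"
proof -
  consider "Suc j < k" | "Suc j = k" | "k \<le> j" by linarith
  then show ?thesis
  proof cases
    case 1
    then have "b \<in> faces X (Suc j)" using below_subset b by blast
    then show ?thesis using X.pencil_del_ule a z ule_X by (metis eqs(2))
  next
    case 2
    obtain x where x: "x \<in> X.maxf k" "ule X k a x" using X.ex_maxf a 2 by blast
    have "z \<in> faces Y j" using Y.del_face[OF b] z by auto
    then have "z \<notin> iotU S (faces X (Suc k))" using below[of j] 2 by auto
    then have zx: "z \<in> del S x" using X.del_ule[of j a x z] x z 2 by (auto simp: iotU_iff)
    obtain y where y: "y \<in> Y.minf k" "ule Y k y b" "z \<in> del S y"
      using Y.ex_minf_del[of b j z] b z 2 by auto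
    have y': "y \<in> X.maxf k" using y top by simp
    have "ule X k x y \<or> ule X k y x"
      using X.pencil_del_ule[of x j y z] X.maxf_faces[of k] x y y' zx 2 by auto
    then have "x = y" using top_ule x y' X_ule by metis
    then show ?thesis using ule_trans ule_X ule_Y x y 2 by metis
  next
    case 3
    have "z \<in> faces X j" "z \<in> faces Y j"
      using X.del_face[OF a] Y.del_face[OF b] z by auto
    then show ?thesis using 3 disjoint_above[of j] common_not_del[of z] a z
      by (cases "k = j") (auto simp: delU_iff)
  qed
qed

lemma linear_cross:
  assumes a: "a \<in> faces X 0" and b: "b \<in> faces Y 0"
  shows "ule (hunion X Y) 0 a b \<or> ule (hunion X Y) 0 b a"
proof (cases "k = 0")
  case True
  obtain x where x: "x \<in> X.maxf 0" "ule X 0 a x" using X.ex_maxf a by blast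
  obtain y where y: "y \<in> Y.minf 0" "ule Y 0 y b" using Y.ex_minf b by blast
  have y': "y \<in> X.maxf 0" using y top True by auto
  have "ule X 0 x y \<or> ule X 0 y x"
    using X.linearity_0 X.maxf_faces[of 0] x y' by (auto simp: total_on_def ule_def)
  then have "x = y" using top_ule x y' X_ule True by metis
  then show ?thesis using ule_trans ule_X ule_Y x y by metis
next
  case False
  then have "b \<in> faces X 0" using below_subset b by blast
  then have "ule X 0 a b \<or> ule X 0 b a"
    using X.linearity_0 a by (auto simp: total_on_def ule_def)
  then show ?thesis using ule_X by blast
qed

lemma subcell_hunion: "subcell (hunion X Y) S"
proof (rule subcellI)
  let ?U = "hunion X Y"
  show "gam ?U = gam S" "del ?U = del S" by auto
  show "a \<in> faces ?U l \<Longrightarrow> a \<in> faces S l" for a l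
    using X Y subcell_faces by auto
  show "a \<in> faces ?U (Suc l) \<Longrightarrow> gam S a \<in> faces ?U l" for a l
    using X.gam_face Y.gam_face by auto
  show "a \<in> faces ?U (Suc l) \<Longrightarrow> x \<in> del S a \<Longrightarrow> x \<in> faces ?U l" for a l x
    using X.del_face[of a l x] Y.del_face[of a l x] by auto
  show "faces ?U 0 \<noteq> {}" using X.nonempty by simp
  have XX: "ule X 0 a b \<or> ule X 0 b a" if "a \<in> faces X 0" "b \<in> faces X 0" for a b
    using X.linearity_0 that by (auto simp: total_on_def ule_def)
  have YY: "ule Y 0 a b \<or> ule Y 0 b a" if "a \<in> faces Y 0" "b \<in> faces Y 0" for a b
    using Y.linearity_0 that by (auto simp: total_on_def ule_def)
  show "ule ?U 0 a b \<or> ule ?U 0 b a" if "a \<in> faces ?U 0" "b \<in> faces ?U 0" for a b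
    using that linear_cross XX YY ule_X ule_Y unfolding hunion_simps(5) Un_iff by metis
  show "ule ?U (Suc l) a b \<or> ule ?U (Suc l) b a"
    if "a \<in> faces ?U (Suc l)" "b \<in> faces ?U (Suc l)" "gam S a = gam S b" for l a b
    using that pencil_gam_cross X.pencil_gam_ule Y.pencil_gam_ule ule_X ule_Y
    unfolding hunion_simps(5) Un_iff eqs by metis
  show "ule ?U (Suc l) a b \<or> ule ?U (Suc l) b a"
    if "a \<in> faces ?U (Suc l)" "b \<in> faces ?U (Suc l)" "x \<in> del S a" "x \<in> del S b" for l a b x
    using that pencil_del_cross X.pencil_del_ule Y.pencil_del_ule ule_X ule_Y
    unfolding hunion_simps(5) Un_iff eqs by metis
qed

lemma hdim_hunion: "hdim X \<le> n \<Longrightarrow> hdim Y \<le> n \<Longrightarrow> hdim (hunion X Y) \<le> n"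
  using X.hdim_le_iff Y.hdim_le_iff
    positive_opetopic_cardinal.hdim_le_iff[OF subcell_poc[OF subcell_hunion]] by simp

lemma delU_Un: "delU S (A \<union> B) = delU S A \<union> delU S B" and iotU_Un: "iotU S (A \<union> B) = iotU S A \<union> iotU S B"
  by (auto simp: delU_def iotU_def)

lemma hdom_hunion: "hdom k (hunion X Y) = hdom k X"
proof (rule hypergraph_eqI)
  show "faces (hdom k (hunion X Y)) l = faces (hdom k X) l" for l
    using below_subset[of l] common_not_gam top
    by (cases "l = k") (auto simp: faces_hdom X.maxf_def Y.minf_def)
qed simp_all

lemma hcod_hunion: "hcod k (hunion X Y) = hcod k Y"
proof (rule hypergraph_eqI)
  show "faces (hcod k (hunion X Y)) l = faces (hcod k Y) l" for l
    using below[of l] common_not_del top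
    by (cases "l = k") (auto simp: faces_hcod X.maxf_def Y.minf_def delU_Un iotU_Un)
qed simp_all

lemma hdom_hunion_above: "k < j \<Longrightarrow> hdom j (hunion X Y) = hunion (hdom j X) (hdom j Y)"
proof (rule hypergraph_eqI)
  assume "k < j"
  then have "gam S ` faces X (Suc j) \<subseteq> faces X j" "gam S ` faces Y (Suc j) \<subseteq> faces Y j"
    "faces X j \<inter> faces Y j = {}"
    using X.gam_face Y.gam_face disjoint_above by auto
  then show "faces (hdom j (hunion X Y)) l = faces (hunion (hdom j X) (hdom j Y)) l" for l
    by (cases "l = j") (auto simp: faces_hdom)
qed simp_all

lemma hcod_hunion_above: "k < j \<Longrightarrow> hcod j (hunion X Y) = hunion (hcod j X) (hcod j Y)"
proof (rule hypergraph_eqI)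
  assume kj: "k < j"
  have d: "delU S (faces X (Suc j)) \<subseteq> faces X j" "delU S (faces Y (Suc j)) \<subseteq> faces Y j"
    using X.del_faces[of _ j] Y.del_faces[of _ j] by (auto simp: delU_def)
  fix l
  show "faces (hcod j (hunion X Y)) l = faces (hunion (hcod j X) (hcod j Y)) l"
  proof (cases "Suc l = j")
    case True
    have "iotU S (faces X (Suc j)) \<subseteq> delU S (faces X j)" "iotU S (faces Y (Suc j)) \<subseteq> gam S ` faces Y j"
      using cut.iotU_D_del[OF X.cut_full, of j l] cut.iotU_D_gam[OF Y.cut_full, of j l] True by auto
    moreover have "delU S (faces X j) \<subseteq> faces X l" "gam S ` faces Y j \<subseteq> faces Y l"
      using X.del_faces[of _ l] Y.gam_face[of _ l] True by (auto simp: delU_def)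
    \<comment> \<open>For \<open>l = k\<close> the two cells do overlap, but only in faces that are
      neither consumed in \<open>X\<close> nor produced in \<open>Y\<close>.\<close>
    moreover have "delU S (faces X j) \<inter> faces Y l = {} \<and> faces X l \<inter> gam S ` faces Y j = {}"
    proof (cases "l = k")
      case True
      with \<open>Suc l = j\<close> show ?thesis using common_not_del common_not_gam by blast
    next
      case False
      with \<open>Suc l = j\<close> kj have "faces X l \<inter> faces Y l = {}" using disjoint_above[of l] by simp
      with calculation(3,4) show ?thesis by blast
    qed
    ultimately have "iotU S (faces X (Suc j)) \<inter> faces Y l = {}" "faces X l \<inter> iotU S (faces Y (Suc j)) = {}"
      by (meson disjoint_iff subset_iff)+
    then show ?thesis using True by (auto simp: faces_hcod delU_Un iotU_Un)
  next
    case False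
    then show ?thesis using d disjoint_above[OF kj]
      by (cases "l = j") (auto simp: faces_hcod delU_Un iotU_Un)
  qed
qed simp_all

end

lemma cells_star: "X \<in> cells (star S) n \<longleftrightarrow> subcell X S \<and> hdim X \<le> n"
  by (simp add: star_def subcell_def)

lemma star_simps [simp]:
  "cdom (star S) n k = hdom k" "ccod (star S) n k = hcod k" "cid (star S) k n = (\<lambda>X. X)"
  "ccomp (star S) n k = hunion"
  by (simp_all add: star_def)

theorem omega_category_star:
  assumes "positive_opetopic_cardinal S" shows "omega_category (star S)"
proof -
  interpret positive_opetopic_cardinal S by fact
  have cmp: "composable S k X Y"
    if "X \<in> cells (star S) n" "Y \<in> cells (star S) n" "hcod k X = hdom k Y" for k n X Y
    using that by unfold_locales (auto simp: cells_star)
  have poc: "positive_opetopic_cardinal X" if "X \<in> cells (star S) n" for X n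
    using that by (auto simp: cells_star subcell_poc)
  have g: "gam X = gam S" "del X = del S" if "X \<in> cells (star S) n" for X n
    using that by (auto simp: cells_star subcell_gam subcell_del)
  note hdim_le = positive_opetopic_cardinal.hdim_le_iff
  have hd: "hdom k X \<in> cells (star S) k" if "X \<in> cells (star S) n" for k n X
  proof -
    have "subcell (hdom k X) S"
      using that positive_opetopic_cardinal.subcell_hdom[OF poc[OF that]] subcell_trans
      by (auto simp: cells_star)
    then show ?thesis using hdim_le[of "hdom k X" k] by (auto simp: cells_star subcell_poc faces_hdom)
  qed
  have hc: "hcod k X \<in> cells (star S) k" if "X \<in> cells (star S) n" for k n X
  proof -
    have "subcell (hcod k X) S"
      using that positive_opetopic_cardinal.subcell_hcod[OF poc[OF that]] subcell_trans
      by (auto simp: cells_star)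
    then show ?thesis using hdim_le[of "hcod k X" k] by (auto simp: cells_star subcell_poc faces_hcod)
  qed
  show ?thesis
  proof
    fix k n X assume "k < n" "X \<in> cells (star S) n"
    then show "cdom (star S) n k X \<in> cells (star S) k" "ccod (star S) n k X \<in> cells (star S) k"
      "ccomp (star S) n k (cid (star S) k n (cdom (star S) n k X)) X = X"
      "ccomp (star S) n k X (cid (star S) k n (ccod (star S) n k X)) = X"
      using hd hc by (auto intro!: hypergraph_eqI simp: faces_hdom faces_hcod split: if_splits)
  next
    fix j k n X assume "j < k" "k < n" "X \<in> cells (star S) n"
    then show "cdom (star S) k j (cdom (star S) n k X) = cdom (star S) n j X"
      "cdom (star S) k j (ccod (star S) n k X) = cdom (star S) n j X"
      "ccod (star S) k j (cdom (star S) n k X) = ccod (star S) n j X"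
      "ccod (star S) k j (ccod (star S) n k X) = ccod (star S) n j X"
      using positive_opetopic_cardinal.hdom_hdom[OF poc] positive_opetopic_cardinal.hdom_hcod[OF poc]
        positive_opetopic_cardinal.hcod_hdom[OF poc] positive_opetopic_cardinal.hcod_hcod[OF poc]
      by auto
  next
    fix k n X assume "k < n" "X \<in> cells (star S) k"
    then show "cid (star S) k n X \<in> cells (star S) n"
      "cdom (star S) n k (cid (star S) k n X) = X" "ccod (star S) n k (cid (star S) k n X) = X"
      using positive_opetopic_cardinal.hdom_id[OF poc] positive_opetopic_cardinal.hcod_id[OF poc]
      by (auto simp: cells_star)
  next
    fix k n X Y assume XY: "k < n" "X \<in> cells (star S) n" "Y \<in> cells (star S) n"
      "ccod (star S) n k X = cdom (star S) n k Y"
    then interpret composable S k X Y using cmp by simp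
    have "hdim (hunion X Y) \<le> n"
      using XY hdim_hunion by (simp add: cells_star)
    with subcell_hunion show "ccomp (star S) n k X Y \<in> cells (star S) n"
      by (simp add: cells_star)
    show "cdom (star S) n k (ccomp (star S) n k X Y) = cdom (star S) n k X"
      "ccod (star S) n k (ccomp (star S) n k X Y) = ccod (star S) n k Y"
      using hdom_hunion hcod_hunion by auto
  next
    fix k j n X Y assume XY: "k < j" "j < n" "X \<in> cells (star S) n" "Y \<in> cells (star S) n"
      "ccod (star S) n k X = cdom (star S) n k Y"
    then interpret composable S k X Y using cmp by simp
    show "cdom (star S) n j (ccomp (star S) n k X Y) =
        ccomp (star S) j k (cdom (star S) n j X) (cdom (star S) n j Y)"
      "ccod (star S) n j (ccomp (star S) n k X Y) =
        ccomp (star S) j k (ccod (star S) n j X) (ccod (star S) n j Y)"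
      using hdom_hunion_above hcod_hunion_above XY by auto
  qed (auto intro!: hypergraph_eqI simp: g)
qed

section \<open>Principal cells\<close>

text \<open>Reachability by iterated \<gamma> and \<delta>. The relation leaves only faces of
  positive dimension, since the values of \<open>gam\<close> and \<open>del\<close> elsewhere carry
  no meaning.\<close>

definition desc :: "'a hypergraph \<Rightarrow> 'a \<Rightarrow> 'a set" where
  "desc S a = {b. (b, a) \<in> {(x, c). \<exists>k. c \<in> faces S (Suc k) \<and> (x \<in> del S c \<or> x = gam S c)}\<^sup>*}"

definition principal :: "'a hypergraph \<Rightarrow> 'a \<Rightarrow> 'a hypergraph" where
  "principal S a = S\<lparr>faces := (\<lambda>l. faces S l \<inter> desc S a)\<rparr>"

lemma principal_simps [simp]:
  "gam (principal S a) = gam S" "del (principal S a) = del S"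
  "faces (principal S a) l = faces S l \<inter> desc S a"
  by (simp_all add: principal_def)

lemma desc_refl [simp]: "a \<in> desc S a"
  by (simp add: desc_def)

lemma desc_step: "c \<in> desc S a \<Longrightarrow> c \<in> faces S (Suc k) \<Longrightarrow> x \<in> del S c \<or> x = gam S c \<Longrightarrow> x \<in> desc S a"
  unfolding desc_def by (blast intro: converse_rtrancl_into_rtrancl)

lemma subcell_antisym:
  "subcell X S \<Longrightarrow> subcell Y S \<Longrightarrow> (\<And>k. faces X k \<subseteq> faces Y k) \<Longrightarrow> (\<And>k. faces Y k \<subseteq> faces X k) \<Longrightarrow> X = Y"
  by (rule hypergraph_eqI) (auto simp: subcell_gam subcell_del)

lemma subcell_subcell: "subcell X S \<Longrightarrow> subcell Y S \<Longrightarrow> (\<And>k. faces X k \<subseteq> faces Y k) \<Longrightarrow> subcell X Y"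
  by (auto simp: subcell_def subhypergraph_def)

context positive_hypergraph
begin

lemma descD:
  assumes "a \<in> faces S k" "b \<in> desc S a"
  shows "\<exists>l\<le>k. b \<in> faces S l \<and> (l = k \<longrightarrow> b = a) \<and> (Suc l = k \<longrightarrow> b \<in> del S a \<or> b = gam S a)"
  using assms(2) unfolding desc_def mem_Collect_eq
proof (induction rule: converse_rtrancl_induct)
  case base
  then show ?case using assms(1) by auto
next
  case (step b c)
  then obtain m where m: "c \<in> faces S (Suc m)" "b \<in> del S c \<or> b = gam S c" by auto
  obtain l where l: "l \<le> k" "c \<in> faces S l" "l = k \<longrightarrow> c = a" using step by blast
  have "l = Suc m" using l m faces_eq by blast
  moreover have "b \<in> faces S m" using m del_face gam_face by blast
  ultimately show ?case using l m by (intro exI[of _ m]) auto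
qed

lemma desc_faceD:
  assumes "a \<in> faces S k" "b \<in> desc S a" "b \<in> faces S l"
  shows "l \<le> k \<and> (l = k \<longrightarrow> b = a) \<and> (Suc l = k \<longrightarrow> b \<in> del S a \<or> b = gam S a)"
  using descD[OF assms(1,2)] faces_eq[OF assms(3)] by metis

lemma principal_faces_top: "a \<in> faces S k \<Longrightarrow> faces (principal S a) k = {a}"
  using desc_faceD[of a k _ k] by auto

lemma principal_faces_above: "a \<in> faces S k \<Longrightarrow> k < l \<Longrightarrow> faces (principal S a) l = {}"
  using desc_faceD[of a k _ l] by auto

lemma principal_faces_below:
  assumes "a \<in> faces S (Suc k)" shows "faces (principal S a) k = insert (gam S a) (del S a)"
proof
  show "faces (principal S a) k \<subseteq> insert (gam S a) (del S a)"
    using desc_faceD[OF assms, of _ k] by auto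
  show "insert (gam S a) (del S a) \<subseteq> faces (principal S a) k"
    using assms desc_step[OF desc_refl assms] gam_face del_face by auto
qed

lemma principal_least:
  assumes X: "subcell X S" and a: "a \<in> faces X k"
  shows "faces (principal S a) l \<subseteq> faces X l"
proof
  fix b assume b: "b \<in> faces (principal S a) l"
  interpret X: positive_opetopic_cardinal X using X by (rule subcell_poc)
  have "\<exists>m. b \<in> faces X m"
    using b unfolding principal_simps desc_def Int_iff mem_Collect_eq
  proof (induction rule: conjunct2[THEN converse_rtrancl_induct, consumes 1, case_names base step])
    case base
    then show ?case using a by blast
  next
    case (step b c)
    then obtain m n where "c \<in> faces S (Suc m)" "b \<in> del S c \<or> b = gam S c" "c \<in> faces X n" by auto
    then have "c \<in> faces X (Suc m)" "b \<in> del X c \<or> b = gam X c"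
      using subcell_faces[OF X] faces_eq subcell_gam[OF X] subcell_del[OF X] by metis+
    then show ?case using X.del_face X.gam_face by blast
  qed
  then show "b \<in> faces X l" using b subcell_faces[OF X] faces_eq by (metis Int_iff principal_simps(3))
qed

text \<open>Whatever is reached from a stays in \<open>X\<close>, because \<open>X\<close> is
  closed. Principal cells thus do not depend on the ambient cardinal, and inductions over subcells
  can speak of \<open>principal S a\<close> throughout.\<close>

lemma principal_subcell_eq:
  assumes X: "subcell X S" and a: "a \<in> faces X k"
  shows "principal X a = principal S a"
proof -
  have "{(x, c). \<exists>k. c \<in> faces X (Suc k) \<and> (x \<in> del X c \<or> x = gam X c)} \<subseteq>
      {(x, c). \<exists>k. c \<in> faces S (Suc k) \<and> (x \<in> del S c \<or> x = gam S c)}"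
    using subcell_faces[OF X] subcell_gam[OF X] subcell_del[OF X] by auto
  then have sub: "desc X a \<subseteq> desc S a"
    unfolding desc_def using rtrancl_mono by blast
  interpret X: positive_opetopic_cardinal X using X by (rule subcell_poc)
  have "b \<in> desc X a" if "b \<in> desc S a" for b
    using that unfolding desc_def[of S] mem_Collect_eq
  proof (induction rule: converse_rtrancl_induct)
    case (step b c)
    then obtain m where m: "c \<in> faces S (Suc m)" "b \<in> del S c \<or> b = gam S c" by auto
    have "c \<in> faces (principal S a) (Suc m)" using step(3) sub m by auto
    then have "c \<in> faces X (Suc m)" using principal_least[OF X a] by blast
    then show ?case using desc_step[OF step(3)] m subcell_gam[OF X] subcell_del[OF X] by metis
  qed simp
  with sub have "desc X a = desc S a" by blast
  then show ?thesis
    using principal_least[OF X a] subcell_faces[OF X] subcell_gam[OF X] subcell_del[OF X]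
    by (intro hypergraph_eqI) auto
qed

lemma finite_all_faces: "finite (\<Union>k. faces S k)"
proof -
  have "(\<Union>k. faces S k) = (\<Union>k\<in>{k. faces S k \<noteq> {}}. faces S k)" by auto
  then show ?thesis using finitely_many_dims finite_faces by simp
qed

end

lemma poc_induct [consumes 1, case_names step]:
  assumes "positive_opetopic_cardinal X"
    and "\<And>X. positive_opetopic_cardinal X \<Longrightarrow> (\<And>Y. subcell Y X \<Longrightarrow> Y \<noteq> X \<Longrightarrow> P Y) \<Longrightarrow> P X"
  shows "P X"
  using assms(1)
proof (induction "card (\<Union>k. faces X k)" arbitrary: X rule: less_induct)
  case less
  interpret positive_opetopic_cardinal X by fact
  show ?case
  proof (rule assms(2)[OF less(2)])
    fix Y assume Y: "subcell Y X" "Y \<noteq> X"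
    then obtain k where "faces Y k \<noteq> faces X k"
      using hypergraph_eqI[of Y X] subcell_gam subcell_del by blast
    then obtain a where a: "a \<in> faces X k" "a \<notin> faces Y k" using subcell_faces[OF Y(1)] by blast
    have "a \<notin> faces Y j" for j using subcell_faces[OF Y(1), of a j] a faces_eq by blast
    then have "(\<Union>k. faces Y k) \<subset> (\<Union>k. faces X k)"
      using subcell_faces[OF Y(1)] a(1) by blast
    then have "card (\<Union>k. faces Y k) < card (\<Union>k. faces X k)"
      by (rule psubset_card_mono[OF finite_all_faces])
    then show "P Y" using less(1) subcell_poc[OF Y(1)] by blast
  qed
qed

section \<open>Decomposition of cells into principal cells\<close>

context cut
begin

lemma composable_low_high: "hcod k low = hdom k high"
proof (rule hypergraph_eqI)
  have g: "gam S ` D \<inter> gam S ` (faces S (Suc k) - D) = {}" using D_gam by blast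
  have "iotU low = iotU S" "delU low = delU S" by (auto simp: low_def)
  moreover have "gam high = gam S" by (simp add: high_def)
  moreover have "part (Suc k) = D" by simp
  moreover have "gam S ` D \<subseteq> faces S k" "gam S ` faces S (Suc k) = gam S ` D \<union> gam S ` (faces S (Suc k) - D)"
    using D_face gam_face by auto
  ultimately show "faces (hcod k low) l = faces (hdom k high) l" for l
    unfolding faces_hcod faces_hdom using g
    by (auto simp: low_def high_def simp del: part.simps)
qed (simp_all add: low_def high_def)

lemma hunion_low_high: "hunion low high = S"
proof (rule hypergraph_eqI)
  have "x \<in> gam S ` D" if "x \<in> delU S D" "x \<in> gam S ` faces S (Suc k)" for x
    using that D_lower unfolding delU_iff by blast
  moreover have "gam S ` D \<subseteq> faces S k" "delU S D \<subseteq> faces S k"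
    using gam_face[OF D_face] del_face[OF D_face] unfolding delU_iff subset_iff by auto
  ultimately show "faces (hunion low high) l = faces S l" for l
    using part_faces[of _ l]
    by (cases l k rule: linorder_cases) (auto simp: low_def high_def simp del: part.simps)
qed (simp_all add: low_def)

end

context positive_opetopic_cardinal
begin

lemma wf_lower: "wf (lower S (Suc k))"
proof (rule finite_acyclic_wf)
  show "finite (lower S (Suc k))"
    by (rule finite_subset[of _ "faces S (Suc k) \<times> faces S (Suc k)"])
      (auto dest: lower_faces simp: finite_faces)
  have "trans (lower S (Suc k))" by (intro transI) (rule lower_trans)
  then show "acyclic (lower S (Suc k))"
    using lower_irrefl by (simp add: acyclic_def)
qed

text \<open>The set below m is closed under comparability, because m is maximal and the order is a
  forest. It is initial, because a face outside it that feeds into it would produce a maximal face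
  lower-below m.\<close>

lemma cut_below_maxf:
  assumes m: "m \<in> maxf (Suc k)" and min: "\<And>c. (c, m) \<in> lower S (Suc k) \<Longrightarrow> c \<notin> maxf (Suc k)"
  shows "cut S k {c \<in> faces S (Suc k). ule S (Suc k) c m}"
proof unfold_locales
  have mf: "m \<in> faces S (Suc k)" using m maxf_faces by blast
  show "{c \<in> faces S (Suc k). ule S (Suc k) c m} \<subseteq> faces S (Suc k)" by blast
  show "c \<in> {c \<in> faces S (Suc k). ule S (Suc k) c m} \<longleftrightarrow> gam S \<alpha> \<in> {c \<in> faces S (Suc k). ule S (Suc k) c m}"
    if \<alpha>: "\<alpha> \<in> faces S (Suc (Suc k))" and c: "c \<in> del S \<alpha>" for \<alpha> c
  proof -
    have lt: "ule S (Suc k) c (gam S \<alpha>)" by (rule upper_ule[OF upper_step[OF \<alpha> c]])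
    have "ule S (Suc k) (gam S \<alpha>) m" if "ule S (Suc k) c m"
      using ule_forest[OF lt that] maxf_ule[OF m] ule_refl by metis
    then show ?thesis using ule_trans[OF lt] del_face[OF \<alpha> c] gam_face[OF \<alpha>] by blast
  qed
  show "d \<in> {c \<in> faces S (Suc k). ule S (Suc k) c m}"
    if c: "c \<in> {c \<in> faces S (Suc k). ule S (Suc k) c m}" and d: "d \<in> faces S (Suc k)"
      and dc: "gam S d \<in> del S c" for c d
  proof (rule ccontr)
    assume "\<not> ?thesis"
    then have n: "\<not> ule S (Suc k) d m" using d by blast
    \<comment> \<open>Were \<gamma>(d) lost on the way up to m, it would be the codomain of some c2
      below m; d and c2 then share a pencil, and d would lie below m.\<close>
    have "gam S d \<in> del S m"
    proof (rule ccontr)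
      assume "gam S d \<notin> del S m"
      then obtain \<alpha> where \<alpha>: "\<alpha> \<in> faces S (Suc (Suc k))" "gam S d \<in> iot S \<alpha>" "ule S (Suc k) (gam S \<alpha>) m"
        using del_ule c dc by blast
      then obtain c2 where c2: "c2 \<in> del S \<alpha>" "gam S d = gam S c2" by (auto simp: iot_iff)
      have "ule S (Suc k) c2 m"
        by (rule ule_trans[OF upper_ule[OF upper_step[OF \<alpha>(1) c2(1)]] \<alpha>(3)])
      moreover have "ule S (Suc k) d c2 \<or> ule S (Suc k) c2 d"
        using pencil_gam_ule c2 d \<alpha> del_face by metis
      ultimately show False
        using n ule_trans ule_forest[of "Suc k" c2 d m] maxf_ule[OF m, of d] ule_refl by metis
    qed
    moreover obtain m2 where m2: "m2 \<in> maxf (Suc k)" "ule S (Suc k) d m2" using ex_maxf d by blast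
    \<comment> \<open>The codomain of d bounds the maximal face m, so it is not internal to any face
      and survives the climb from d to m2.\<close>
    moreover have "gam S m2 = gam S d"
      using gam_ule_cases[OF m2(2)] cut.iot_D_boundary[OF cut_full refl, of m] mf m \<open>gam S d \<in> del S m\<close>
      by (auto simp: maxf_def)
    ultimately show False using min lower_step maxf_faces mf by (metis subsetD)
  qed
qed

text \<open>Two maximal faces of the same positive dimension are separated by a cut. Otherwise each
  dimension has at most one maximal face, and from the top dimension downwards every face is reached
  from a: a non-maximal face lies in some \<delta>, and a maximal one is a codomain.\<close>

lemma principal_or_composite:
  obtains (principal) k a where "a \<in> faces S k" "S = principal S a"
  | (composite) k X Y where "subcell X S" "subcell Y S" "hcod k X = hdom k Y" "S = hunion X Y"
      "X \<noteq> S" "Y \<noteq> S"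
proof (cases "\<exists>k m m'. m \<in> maxf (Suc k) \<and> m' \<in> maxf (Suc k) \<and> m \<noteq> m'")
  case True
  then obtain k m0 m1 where m01: "m0 \<in> maxf (Suc k)" "m1 \<in> maxf (Suc k)" "m0 \<noteq> m1" by blast
  obtain m where m: "m \<in> maxf (Suc k)" "\<And>c. (c, m) \<in> lower S (Suc k) \<Longrightarrow> c \<notin> maxf (Suc k)"
    using wfE_min[OF wf_lower m01(1)] by blast
  obtain m' where m': "m' \<in> maxf (Suc k)" "m' \<noteq> m" using m01 by metis
  let ?D = "{c \<in> faces S (Suc k). ule S (Suc k) c m}"
  interpret cut S k ?D using m by (rule cut_below_maxf)
  have "m \<in> ?D" "m' \<notin> ?D" "m' \<in> faces S (Suc k)" "m \<in> faces S (Suc k)"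
    using m m' maxf_ule[OF m'(1)] maxf_faces by (auto simp: maxf_def)
  then have "m' \<notin> faces low (Suc k)" "m \<notin> faces high (Suc k)" by (auto simp: low_def high_def)
  with \<open>m' \<in> faces S (Suc k)\<close> \<open>m \<in> faces S (Suc k)\<close> have "low \<noteq> S" "high \<noteq> S" by metis+
  then show ?thesis
    using composite subcell_low subcell_high composable_low_high hunion_low_high by metis
next
  case False
  have uniq: "m = m'" if "m \<in> maxf l" "m' \<in> maxf l" for l m m'
  proof (cases l)
    case 0
    then have "m \<in> faces S 0" "m' \<in> faces S 0" using that maxf_faces by auto
    then have "ule S 0 m m' \<or> ule S 0 m' m"
      using linearity_0 by (auto simp: total_on_def ule_def)
    then show ?thesis using maxf_ule that 0 by metis
  qed (use False that in blast)
  have empty: "faces S l = {}" if "hdim S < l" for l using hdim_le_iff that by auto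
  have "hdim S \<in> {k. faces S k \<noteq> {}}"
    unfolding hdim_def by (rule Max_in[OF finitely_many_dims]) (use nonempty in blast)
  then obtain a where a: "a \<in> faces S (hdim S)" by blast
  have "faces S (hdim S - i) \<subseteq> desc S a \<and> faces S (hdim S - i) \<noteq> {}" for i
  proof (induction i)
    case 0
    have "faces S (hdim S) = maxf (hdim S)" using empty[of "Suc (hdim S)"] by (simp add: maxf_def delU_def)
    then show ?case using uniq a by (auto, metis desc_refl)
  next
    case (Suc i)
    show ?case
    proof (cases "hdim S - i = 0")
      case False
      define l where "l = hdim S - Suc i"
      have l: "hdim S - i = Suc l" using False by (simp add: l_def)
      obtain c where c: "c \<in> faces S (Suc l)" using Suc l by auto
      obtain m where m: "m \<in> maxf l" "ule S l (gam S c) m" using ex_maxf c gam_face by blast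
      \<comment> \<open>Since m lies above the codomain \<gamma>(c), it is itself a codomain,
        possibly that of c.\<close>
      obtain \<beta> where \<beta>: "\<beta> \<in> faces S (Suc l)" "m = gam S \<beta>"
        using m(2) c unfolding ule_rtrancl rtrancl_eq_or_trancl by (auto simp: step_def dest!: tranclD2)
      have "x \<in> desc S a" if x: "x \<in> faces S l" for x
      proof (cases "x \<in> maxf l")
        case True
        then have "x = gam S \<beta>" using uniq m \<beta> by blast
        then show ?thesis using desc_step[of \<beta>] \<beta> Suc l by auto
      next
        case False
        then obtain c where "c \<in> faces S (Suc l)" "x \<in> del S c" using x by (auto simp: maxf_def delU_iff)
        then show ?thesis using desc_step[of c] Suc l by auto
      qed
      then show ?thesis using c gam_face unfolding l_def by blast
    qed (use Suc in auto)
  qed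
  then have "faces S l \<subseteq> desc S a" for l
    using empty[of l] by (cases "l \<le> hdim S") (metis diff_diff_cancel, auto)
  then have "S = principal S a" by (intro hypergraph_eqI) auto
  with principal a show ?thesis by blast
qed

end

text \<open>In the principal case the hypothesis covers all proper subcells. It is applied to the
  domain and codomain, which by \<open>principal_boundary\<close> contain every face except the
  generator.\<close>

lemma poc_decompose_induct [consumes 1, case_names principal composite]:
  assumes "positive_opetopic_cardinal X"
    and prin: "\<And>X k a. positive_opetopic_cardinal X \<Longrightarrow> a \<in> faces X k \<Longrightarrow> X = principal X a \<Longrightarrow>
      (\<And>Y. subcell Y X \<Longrightarrow> Y \<noteq> X \<Longrightarrow> P Y) \<Longrightarrow> P X"
    and comp: "\<And>X Y Z k. positive_opetopic_cardinal Z \<Longrightarrow> subcell X Z \<Longrightarrow> subcell Y Z \<Longrightarrow> hcod k X = hdom k Y \<Longrightarrow> Z = hunion X Y \<Longrightarrow>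
      P X \<Longrightarrow> P Y \<Longrightarrow> P Z"
  shows "P X"
  using assms(1)
proof (induction rule: poc_induct)
  case (step X)
  interpret positive_opetopic_cardinal X by fact
  show ?case
  proof (rule principal_or_composite)
    show "P X" if "a \<in> faces X k" "X = principal X a" for k a
      using prin that step by blast
    show "P X" if "subcell Y X" "subcell Z X" "hcod k Y = hdom k Z" "X = hunion Y Z" "Y \<noteq> X" "Z \<noteq> X" for k Y Z
      using comp that step by blast
  qed
qed

context positive_opetopic_cardinal
begin

lemma principal_boundary:
  assumes S: "S = principal S a" and a: "a \<in> faces S (Suc k)" and b: "b \<in> faces S l" "b \<noteq> a"
  shows "b \<in> faces (hdom k S) l \<or> b \<in> faces (hcod k S) l"
proof -
  have "b \<in> desc S a" using b S by (metis Int_iff principal_simps(3))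
  then obtain l' where l': "l' \<le> Suc k" "b \<in> faces S l'" "l' = Suc k \<longrightarrow> b = a"
    "l' = k \<longrightarrow> b \<in> del S a \<or> b = gam S a"
    using descD[OF a] by (metis Suc_inject)
  have top: "faces S (Suc k) = {a}" using principal_faces_top[OF a] S by simp
  have "l' = l" using faces_eq l' b by blast
  then consider "l < k" | "l = k" "b \<in> del S a" | "l = k" "b = gam S a" using l' b by linarith
  then show ?thesis
    using b gam_notin_del[OF a] by cases (auto simp: faces_hdom faces_hcod top delU_def)
qed

lemma boundary_proper: "a \<in> faces S (Suc k) \<Longrightarrow> hdom k S \<noteq> S \<and> hcod k S \<noteq> S"
  using faces_hdom[of k S "Suc k"] faces_hcod[of k S "Suc k"] by auto

end

text \<open>Reachability gives no direct access to the linearity conditions. Instead, a face that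
  does not generate the whole cardinal lies in a smaller cell, where its principal cell is already
  known to be a cell.\<close>

lemma subcell_principal_self:
  assumes "positive_opetopic_cardinal S"
  shows "\<forall>k. \<forall>a\<in>faces S k. subcell (principal S a) S"
  using assms
proof (induction rule: poc_decompose_induct)
  case (principal X k b)
  interpret positive_opetopic_cardinal X by fact
  have *: "subcell (principal X a) X" if "subcell Y X" "Y \<noteq> X" "a \<in> faces Y l" for a l Y
    using principal(4)[OF that(1,2)] that principal_subcell_eq[OF that(1,3)] subcell_trans by metis
  show ?case
  proof (intro allI ballI)
    fix l a assume a: "a \<in> faces X l"
    show "subcell (principal X a) X"
    proof (cases "a = b")
      case True
      then show ?thesis using principal(1,3) subcell_refl by metis
    next
      case False
      then obtain j where j: "k = Suc j"
        using descD[OF principal(2), of a] a principal(3) by (metis Int_iff le_zero_eq not0_implies_Suc principal_simps(3))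
      then have "a \<in> faces (hdom j X) l \<or> a \<in> faces (hcod j X) l"
        using principal_boundary principal False a by blast
      then show ?thesis
        using * subcell_hdom subcell_hcod boundary_proper principal(2) j by blast
    qed
  qed
next
  case (composite X Y Z k)
  interpret positive_opetopic_cardinal Z by fact
  show ?case
  proof (intro allI ballI)
    fix l a assume "a \<in> faces Z l"
    then have "a \<in> faces X l \<or> a \<in> faces Y l" using composite(5) by (metis UnE hunion_simps(5))
    then show "subcell (principal Z a) Z"
      using composite principal_subcell_eq subcell_trans by metis
  qed
qed

section \<open>Functors between the \<open>\<omega>\<close>-categories\<close>

locale star_functor =
  S: positive_opetopic_cardinal S + T: positive_opetopic_cardinal T + omega_functor "star S" "star T" f
  for S :: "'a hypergraph" and T :: "'b hypergraph" and f
begin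

text \<open>Identities are inclusions, so preservation of identities makes the value on a cell
  independent of the dimension in which the cell is regarded.\<close>

lemma cell_eq:
  assumes "subcell X S" "hdim X \<le> n" shows "f n X = image_cell X f"
proof (cases "hdim X = n")
  case False
  with assms have "hdim X < n" by simp
  then show ?thesis using map_id[of "hdim X" n X] assms by (simp add: cells_star image_cell_def)
qed (simp add: image_cell_def)

lemma image_cells: "X \<in> cells (star S) n \<Longrightarrow> f n X \<in> cells (star T) n"
  using map_cells by blast

lemma subcell_image:
  assumes "subcell X S" shows "subcell (image_cell X f) T" "hdim (image_cell X f) \<le> hdim X"
  using image_cells[of X "hdim X"] assms by (auto simp: cells_star image_cell_def)

lemma image_hdom:
  assumes X: "subcell X S" shows "image_cell (hdom k X) f = hdom k (image_cell X f)"
proof -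
  \<comment> \<open>Strictly above \<open>k\<close>, because preservation of domains is stated for
    \<open>k < n\<close>, while \<open>k\<close> may exceed the dimension of
    \<open>X\<close>.\<close>
  define n where "n = Suc (max k (hdim X))"
  have n: "k < n" "hdim X \<le> n" by (auto simp: n_def)
  then have c: "X \<in> cells (star S) n" using X by (simp add: cells_star)
  have "hdom k X \<in> cells (star S) k" using dom.dom_cell[OF n(1) c] by simp
  with map_dom[OF n(1) c] show ?thesis using cell_eq X n by (simp add: cells_star)
qed

lemma image_hcod:
  assumes X: "subcell X S" shows "image_cell (hcod k X) f = hcod k (image_cell X f)"
proof -
  define n where "n = Suc (max k (hdim X))"
  have n: "k < n" "hdim X \<le> n" by (auto simp: n_def)
  then have c: "X \<in> cells (star S) n" using X by (simp add: cells_star)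
  have "hcod k X \<in> cells (star S) k" using dom.cod_cell[OF n(1) c] by simp
  with map_cod[OF n(1) c] show ?thesis using cell_eq X n by (simp add: cells_star)
qed

lemma image_hunion:
  assumes X: "subcell X S" and Y: "subcell Y S" and XY: "hcod k X = hdom k Y"
  shows "image_cell (hunion X Y) f = hunion (image_cell X f) (image_cell Y f)"
proof -
  define n where "n = Suc (max k (max (hdim X) (hdim Y)))"
  have n: "k < n" "hdim X \<le> n" "hdim Y \<le> n" by (auto simp: n_def)
  then have c: "X \<in> cells (star S) n" "Y \<in> cells (star S) n" using X Y by (auto simp: cells_star)
  have "hunion X Y \<in> cells (star S) n" using dom.comp_cell[OF n(1) c] XY by simp
  with map_comp[OF n(1) c] show ?thesis using cell_eq X Y XY n by (simp add: cells_star)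
qed

text \<open>A composite containing a has a factor containing it. In a principal cell, any face but
  the generator lies in the domain or codomain, whose image is a boundary of the image. Together
  with \<open>image_covered\<close> this is the union formula.\<close>

lemma image_principal_subset:
  assumes "subcell X S" "a \<in> faces X k"
  shows "faces (image_cell (principal S a) f) l \<subseteq> faces (image_cell X f) l"
proof -
  have "positive_opetopic_cardinal X" using assms(1) by (rule subcell_poc)
  then have "subcell X S \<longrightarrow> (\<forall>k. \<forall>a\<in>faces X k.
      faces (image_cell (principal S a) f) l \<subseteq> faces (image_cell X f) l)"
  proof (induction rule: poc_decompose_induct)
    case (principal X k b)
    interpret X: positive_opetopic_cardinal X by fact
    show ?case
    proof (intro impI allI ballI)
      fix j a assume X: "subcell X S" and a: "a \<in> faces X j"
      show "faces (image_cell (principal S a) f) l \<subseteq> faces (image_cell X f) l"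
      proof (cases "a = b")
        case True
        then have "principal S a = X" using S.principal_subcell_eq[OF X a] principal(3) by simp
        then show ?thesis by simp
      next
        case False
        then obtain i where i: "k = Suc i"
          using X.descD[OF principal(2), of a] a principal(3)
          by (metis Int_iff le_zero_eq not0_implies_Suc principal_simps(3))
        have IH: "faces (image_cell (principal S a) f) l \<subseteq> faces (image_cell Y f) l"
          if "subcell Y X" "Y \<noteq> X" "a \<in> faces Y j" for Y
          using principal(4)[OF that(1,2)] that subcell_trans X by blast
        consider "a \<in> faces (hdom i X) j" | "a \<in> faces (hcod i X) j"
          using X.principal_boundary principal False a i by blast
        then show ?thesis
        proof cases
          case 1
          then have "faces (image_cell (principal S a) f) l \<subseteq> faces (hdom i (image_cell X f)) l"
            using IH[OF X.subcell_hdom _ 1] X.boundary_proper principal(2) i image_hdom[OF X] by simp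
          then show ?thesis by (auto simp: faces_hdom split: if_splits)
        next
          case 2
          then have "faces (image_cell (principal S a) f) l \<subseteq> faces (hcod i (image_cell X f)) l"
            using IH[OF X.subcell_hcod _ 2] X.boundary_proper principal(2) i image_hcod[OF X] by simp
          then show ?thesis by (auto simp: faces_hcod split: if_splits)
        qed
      qed
    qed
  next
    case (composite X Y Z k)
    show ?case
    proof (intro impI allI ballI)
      fix j a assume Z: "subcell Z S" and a: "a \<in> faces Z j"
      have XY: "subcell X S" "subcell Y S" using composite Z subcell_trans by blast+
      have "image_cell Z f = hunion (image_cell X f) (image_cell Y f)"
        using image_hunion[OF XY] composite by simp
      moreover have "a \<in> faces X j \<or> a \<in> faces Y j" using a composite(5) by (metis UnE hunion_simps(5))
      ultimately show "faces (image_cell (principal S a) f) l \<subseteq> faces (image_cell Z f) l"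
        using composite(6,7) XY by (metis hunion_simps(5) le_supI1 le_supI2)
    qed
  qed
  with assms show ?thesis by blast
qed

lemma image_covered:
  assumes "subcell X S" "x \<in> faces (image_cell X f) l"
  obtains k a where "a \<in> faces X k" "x \<in> faces (image_cell (principal S a) f) l"
proof -
  have "positive_opetopic_cardinal X" using assms(1) by (rule subcell_poc)
  then have "subcell X S \<longrightarrow> x \<in> faces (image_cell X f) l \<longrightarrow>
      (\<exists>k. \<exists>a\<in>faces X k. x \<in> faces (image_cell (principal S a) f) l)"
  proof (induction rule: poc_decompose_induct)
    case (principal X k b)
    then show ?case using S.principal_subcell_eq by metis
  next
    case (composite X Y Z k)
    show ?case
    proof (intro impI)
      assume Z: "subcell Z S" and x: "x \<in> faces (image_cell Z f) l"
      have XY: "subcell X S" "subcell Y S" using composite Z subcell_trans by blast+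
      have "image_cell Z f = hunion (image_cell X f) (image_cell Y f)"
        using image_hunion[OF XY] composite by simp
      then have "x \<in> faces (image_cell X f) l \<or> x \<in> faces (image_cell Y f) l" using x by simp
      then show "\<exists>k. \<exists>a\<in>faces Z k. x \<in> faces (image_cell (principal S a) f) l"
        using composite(6,7) XY subcell_faces[OF composite(2)] subcell_faces[OF composite(3)] by blast
    qed
  qed
  with assms that show ?thesis by blast
qed

lemma image_mono:
  assumes "subcell X S" "subcell Y S" "\<And>k. faces X k \<subseteq> faces Y k"
  shows "faces (image_cell X f) l \<subseteq> faces (image_cell Y f) l"
proof
  fix x assume "x \<in> faces (image_cell X f) l"
  then obtain k a where "a \<in> faces X k" "x \<in> faces (image_cell (principal S a) f) l"
    by (rule image_covered[OF assms(1)])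
  with image_principal_subset[OF assms(2)] assms(3) show "x \<in> faces (image_cell Y f) l" by blast
qed

lemma image_subset:
  assumes X: "subcell X S" shows "faces (image_cell X f) l \<subseteq> faces (image_cell S f) l"
proof (rule image_mono[OF X])
  show "subcell S S" by (rule subcell_refl) (rule S.positive_opetopic_cardinal_axioms)
  show "faces X k \<subseteq> faces S k" for k using subcell_faces[OF X] by blast
qed

end

text \<open>As \<open>m\<close> is injective, the functor equations for the lift can be verified
  after applying \<open>m\<close>, where they become those of \<open>v\<close>.\<close>

lemma functor_lift:
  assumes v: "omega_functor C D v" and m: "omega_functor X D m"
    and inj: "\<And>n. inj_on (m n) (cells X n)"
    and range: "\<And>n x. x \<in> cells C n \<Longrightarrow> v n x \<in> m n ` cells X n"
  obtains w where "omega_functor C X w" "\<And>n x. x \<in> cells C n \<Longrightarrow> m n (w n x) = v n x"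
proof -
  interpret v: omega_functor C D v by fact
  interpret m: omega_functor X D m by fact
  define w where "w n = restrict (\<lambda>x. inv_into (cells X n) (m n) (v n x)) (cells C n)" for n
  have wc: "w n x \<in> cells X n" and mw: "m n (w n x) = v n x" if "x \<in> cells C n" for n x
    using range[OF that] that by (auto simp: w_def inv_into_into f_inv_into_f)
  have eq: "x = y" if "x \<in> cells X n" "y \<in> cells X n" "m n x = m n y" for n x y
    using inj that by (meson inj_onD)
  have "omega_functor C X w"
  proof unfold_locales
    show "w n \<in> cells C n \<rightarrow>\<^sub>E cells X n" for n
      using wc by (auto simp: w_def)
    show wdom: "w k (cdom C n k x) = cdom X n k (w n x)" if "k < n" "x \<in> cells C n" for k n x
      by (rule eq[of _ k]) (use that in \<open>simp_all add: wc mw v.dom.dom_cell m.dom.dom_cell v.map_dom m.map_dom\<close>)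
    show wcod: "w k (ccod C n k x) = ccod X n k (w n x)" if "k < n" "x \<in> cells C n" for k n x
      by (rule eq[of _ k]) (use that in \<open>simp_all add: wc mw v.dom.cod_cell m.dom.cod_cell v.map_cod m.map_cod\<close>)
    show "w n (cid C k n x) = cid X k n (w k x)" if "k < n" "x \<in> cells C k" for k n x
      by (rule eq[of _ n]) (use that in \<open>simp_all add: wc mw v.dom.id_cell m.dom.id_cell v.map_id m.map_id\<close>)
    show "w n (ccomp C n k x y) = ccomp X n k (w n x) (w n y)"
      if "k < n" "x \<in> cells C n" "y \<in> cells C n" "ccod C n k x = cdom C n k y" for k n x y
    proof -
      \<comment> \<open>Composability of the lifted cells is required before preservation of
        composition by \<open>m\<close> can be used.\<close>
      have "ccod X n k (w n x) = cdom X n k (w n y)" using wdom wcod that by metis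
      then show ?thesis
        by (intro eq[of _ n])
          (use that in \<open>simp_all add: wc mw v.dom.comp_cell m.dom.comp_cell v.map_comp m.map_comp\<close>)
    qed
  qed
  then show ?thesis using that mw by blast
qed

lemma functor_eqI:
  assumes "omega_functor C D w" "omega_functor C D w'" "\<And>n x. x \<in> cells C n \<Longrightarrow> w n x = w' n x"
  shows "w = w'"
proof
  interpret w: omega_functor C D w by fact
  interpret w': omega_functor C D w' by fact
  show "w n = w' n" for n
    using w.map_cells[of n] w'.map_cells[of n] assms(3) by (rule PiE_ext)
qed

section \<open>Images and preimages of cells under morphisms\<close>

locale hypergraph_map = S: positive_opetopic_cardinal S + T: positive_opetopic_cardinal T
  for S :: "'a hypergraph" and T :: "'b hypergraph" +
  fixes g :: "nat \<Rightarrow> 'a \<Rightarrow> 'b"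
  assumes mor: "hmorphism S T g"
begin

lemma map_face: "a \<in> faces S k \<Longrightarrow> g k a \<in> faces T k"
  using mor by (auto simp: hmorphism_def)

lemma map_gam: "a \<in> faces S (Suc k) \<Longrightarrow> g k (gam S a) = gam T (g (Suc k) a)"
  using mor by (auto simp: hmorphism_def)

lemma map_del: "a \<in> faces S (Suc k) \<Longrightarrow> g k ` del S a = del T (g (Suc k) a)"
  using mor by (auto simp: hmorphism_def bij_betw_def)

lemma map_upper:
  assumes "(a, b) \<in> upper S k" shows "(g k a, g k b) \<in> upper T k"
proof -
  have s: "(g k a, g k b) \<in> upper T k" if "(a, b) \<in> step S (faces S (Suc k))" for a b
  proof -
    from that obtain \<alpha> where \<alpha>: "\<alpha> \<in> faces S (Suc k)" "a \<in> del S \<alpha>" "gam S \<alpha> = b"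
      by (auto simp: step_def)
    then have "g k a \<in> del T (g (Suc k) \<alpha>)" using map_del[OF \<alpha>(1)] by blast
    then have "(g k a, gam T (g (Suc k) \<alpha>)) \<in> upper T k"
      by (rule T.upper_step[OF map_face[OF \<alpha>(1)]])
    then show ?thesis using map_gam[OF \<alpha>(1)] \<alpha>(3) by simp
  qed
  show ?thesis using assms unfolding upper_eq[of S]
    by (induction rule: trancl_induct) (use s in blast, use s upper_trans in metis)
qed

lemma map_ule: "ule S k a b \<Longrightarrow> g k a = g k b \<Longrightarrow> a = b"
  using map_upper T.upper_irrefl by (metis ule_def)

text \<open>Faces identified by \<open>g\<close> lie, by induction, in a common pencil, hence are \<open><\<^sup>+\<close>-comparable.\<close>

lemma map_inj: "inj_on (g k) (faces S k)"
proof (induction k)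
  case 0
  show ?case
  proof (rule inj_onI)
    fix a b assume "a \<in> faces S 0" "b \<in> faces S 0" "g 0 a = g 0 b"
    then show "a = b" using S.linearity_0 map_ule[of 0 a b] map_ule[of 0 b a]
      by (auto simp: total_on_def ule_def)
  qed
next
  case (Suc k)
  show ?case
  proof (rule inj_onI)
    fix a b assume ab: "a \<in> faces S (Suc k)" "b \<in> faces S (Suc k)" "g (Suc k) a = g (Suc k) b"
    then have "g k (gam S a) = g k (gam S b)" using map_gam by simp
    then have "gam S a = gam S b" using Suc ab S.gam_face by (meson inj_onD)
    then show "a = b" using S.pencil_gam_ule ab map_ule by metis
  qed
qed

lemma star_map_inj: "inj_on (star_map S T g n) (cells (star S) n)"
proof (rule inj_onI)
  fix X Y assume XY: "X \<in> cells (star S) n" "Y \<in> cells (star S) n" "star_map S T g n X = star_map S T g n Y"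
  have "g k ` faces X k = g k ` faces Y k" for k
    using arg_cong[OF XY(3), of "\<lambda>Z. faces Z k"] XY(1,2) by (simp add: star_map_def)
  moreover have sub: "subcell X S" "subcell Y S" using XY by (auto simp: cells_star)
  moreover have "faces X k \<subseteq> faces S k" "faces Y k \<subseteq> faces S k" for k
    using subcell_faces[OF sub(1)] subcell_faces[OF sub(2)] by blast+
  ultimately have "faces X k = faces Y k" for k
    using inj_on_image_eq_iff[OF map_inj] by metis
  then show "X = Y"
    using subcell_gam[OF sub(1)] subcell_gam[OF sub(2)] subcell_del[OF sub(1)] subcell_del[OF sub(2)]
    by (intro hypergraph_eqI) simp_all
qed

text \<open>The face-wise preimage is a cell by \<open>subcell_fullI\<close>: a comparison in
  \<open>S\<close> is mapped to one in \<open>T\<close>, which is realised in \<open>W\<close> by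
  \<open>subcell_upperD\<close>, and that path is pulled back face by face.\<close>

lemma preimage:
  assumes W: "subcell W T" and sub: "\<And>k. faces W k \<subseteq> g k ` faces S k" and n: "hdim W \<le> n"
  shows "W \<in> star_map S T g n ` cells (star S) n"
proof -
  interpret W: positive_opetopic_cardinal W using W by (rule subcell_poc)
  define Z where "Z = S\<lparr>faces := (\<lambda>k. {x \<in> faces S k. g k x \<in> faces W k})\<rparr>"
  have Zf: "x \<in> faces Z k \<longleftrightarrow> x \<in> faces S k \<and> g k x \<in> faces W k" for x k by (simp add: Z_def)
  have [simp]: "gam Z = gam S" "del Z = del S" by (simp_all add: Z_def)
  have Wgd: "gam W = gam T" "del W = del T" using W subcell_gam subcell_del by auto
  have pull: "\<exists>b\<in>faces S k. v = g k b \<and> (a, b) \<in> (step S (faces Z (Suc k)))\<^sup>+"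
    if "(g k a, v) \<in> (step W (faces W (Suc k)))\<^sup>+" "a \<in> faces S k" for k a v
    using that(1)
  proof -
    have one: "\<exists>b\<in>faces S k. v = g k b \<and> (a, b) \<in> step S (faces Z (Suc k))"
      if uv: "(g k a, v) \<in> step W (faces W (Suc k))" and a: "a \<in> faces S k" for a v
    proof -
      from uv obtain \<alpha>' where "\<alpha>' \<in> faces W (Suc k)" "g k a \<in> del T \<alpha>'" "gam T \<alpha>' = v"
        by (auto simp: step_def Wgd)
      moreover from this obtain \<alpha> where \<alpha>: "\<alpha> \<in> faces S (Suc k)" "\<alpha>' = g (Suc k) \<alpha>" using sub by blast
      ultimately have "g k a \<in> g k ` del S \<alpha>" "v = g k (gam S \<alpha>)" "\<alpha> \<in> faces Z (Suc k)"
        using map_del map_gam Zf by auto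
      \<comment> \<open>This takes injectivity on all faces of \<open>S\<close>, not merely on
        \<delta>(\<alpha>), since a is not yet known to lie in \<delta>(\<alpha>).\<close>
      moreover from this(1) have "a \<in> del S \<alpha>"
        using map_inj a \<alpha> S.del_faces by (meson inj_on_image_mem_iff)
      ultimately show ?thesis using S.gam_face \<alpha> stepI[of \<alpha> "faces Z (Suc k)" a S] by blast
    qed
    show ?thesis using that(1)
    proof (induction rule: trancl_induct)
      case (base v)
      then show ?case using one that(2) by blast
    next
      case (step v v')
      then obtain b where b: "b \<in> faces S k" "v = g k b" "(a, b) \<in> (step S (faces Z (Suc k)))\<^sup>+" by blast
      obtain b' where "b' \<in> faces S k" "v' = g k b'" "(b, b') \<in> step S (faces Z (Suc k))"
        using one[of b v'] step.hyps(2) b by blast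
      with b show ?case by (metis trancl_into_trancl)
    qed
  qed
  have img: "g k ` faces Z k = faces W k" for k using sub Zf by blast
  have Z: "subcell Z S"
  proof (rule S.subcell_fullI)
    show "gam S a \<in> faces Z k" if "a \<in> faces Z (Suc k)" for k a
      using that W.gam_face[of "g (Suc k) a" k] S.gam_face map_gam by (simp add: Zf Wgd)
    show "x \<in> faces Z k" if "a \<in> faces Z (Suc k)" "x \<in> del S a" for k a x
      using that W.del_faces[of "g (Suc k) a" k] S.del_face map_del[of a k] by (auto simp: Zf Wgd)
    show "faces Z 0 \<noteq> {}" using img[of 0] W.nonempty by auto
    show "(a, b) \<in> (step S (faces Z (Suc k)))\<^sup>+"
      if "a \<in> faces Z k" "b \<in> faces Z k" "(a, b) \<in> upper S k" for k a b
    proof -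
      have "(g k a, g k b) \<in> upper W k"
        using T.subcell_upperD[OF W] map_upper that Zf by blast
      then have p: "(g k a, g k b) \<in> (step W (faces W (Suc k)))\<^sup>+" by (simp add: upper_eq)
      have "a \<in> faces S k" "b \<in> faces S k" using that Zf by blast+
      moreover from pull[OF p this(1)] obtain b' where "b' \<in> faces S k" "g k b = g k b'"
        "(a, b') \<in> (step S (faces Z (Suc k)))\<^sup>+" by blast
      moreover from calculation have "b = b'" using map_inj by (meson inj_onD)
      ultimately show ?thesis by simp
    qed
  qed (simp_all add: Zf)
  interpret Z: positive_opetopic_cardinal Z using Z by (rule subcell_poc)
  have "hdim Z \<le> n" using n img unfolding Z.hdim_le_iff W.hdim_le_iff by (metis image_is_empty)
  with Z have Zn: "Z \<in> cells (star S) n" by (simp add: cells_star)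
  moreover have "W = star_map S T g n Z"
    using Zn img Wgd by (intro hypergraph_eqI) (simp_all add: star_map_def)
  ultimately show ?thesis by blast
qed

end

section \<open>The category of positive opetopic cardinals and functors\<close>

lemma Hom_iff: "f \<in> Hom pOpeCard_omega S T \<longleftrightarrow> omega_functor (star S) (star T) f"
  by (simp add: pOpeCard_omega_def)

lemma Ob_iff: "S \<in> Ob pOpeCard_omega \<longleftrightarrow> positive_opetopic_cardinal S"
  by (simp add: pOpeCard_omega_def)

lemma Comp_apply: "x \<in> cells (star S) n \<Longrightarrow> Comp pOpeCard_omega S T U g f n x = g n (f n x)"
  by (simp add: pOpeCard_omega_def compose_def)

lemma Id_apply: "x \<in> cells (star S) n \<Longrightarrow> Id pOpeCard_omega S n x = x"
  by (simp add: pOpeCard_omega_def)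

lemma omega_functor_Comp:
  assumes "omega_functor (star S) (star T) f" "omega_functor (star T) (star U) g"
  shows "omega_functor (star S) (star U) (Comp pOpeCard_omega S T U g f)"
proof -
  interpret f: omega_functor "star S" "star T" f by fact
  interpret g: omega_functor "star T" "star U" g by fact
  have fc: "x \<in> cells (star S) n \<Longrightarrow> f n x \<in> cells (star T) n" for n x using f.map_cells by blast
  have gc: "x \<in> cells (star T) n \<Longrightarrow> g n x \<in> cells (star U) n" for n x using g.map_cells by blast
  show ?thesis
  proof unfold_locales
    show "Comp pOpeCard_omega S T U g f n \<in> cells (star S) n \<rightarrow>\<^sub>E cells (star U) n" for n
      using fc gc by (auto simp: pOpeCard_omega_def compose_def)
  next
    fix k n X assume *: "k < n" "X \<in> cells (star S) n"
    show "Comp pOpeCard_omega S T U g f k (cdom (star S) n k X) = cdom (star U) n k (Comp pOpeCard_omega S T U g f n X)"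
      using * f.dom.dom_cell f.map_dom g.map_dom fc by (subst (1 2) Comp_apply) auto
    show "Comp pOpeCard_omega S T U g f k (ccod (star S) n k X) = ccod (star U) n k (Comp pOpeCard_omega S T U g f n X)"
      using * f.dom.cod_cell f.map_cod g.map_cod fc by (subst (1 2) Comp_apply) auto
  next
    fix k n X assume *: "k < n" "X \<in> cells (star S) k"
    show "Comp pOpeCard_omega S T U g f n (cid (star S) k n X) = cid (star U) k n (Comp pOpeCard_omega S T U g f k X)"
      using * f.dom.id_cell f.map_id g.map_id fc by (subst (1 2) Comp_apply) auto
  next
    fix k n X Y assume *: "k < n" "X \<in> cells (star S) n" "Y \<in> cells (star S) n"
      "ccod (star S) n k X = cdom (star S) n k Y"
    have "ccod (star T) n k (f n X) = cdom (star T) n k (f n Y)"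
      using * f.map_dom f.map_cod by metis
    then show "Comp pOpeCard_omega S T U g f n (ccomp (star S) n k X Y) =
        ccomp (star U) n k (Comp pOpeCard_omega S T U g f n X) (Comp pOpeCard_omega S T U g f n Y)"
      using * f.dom.comp_cell[of k n X Y] f.map_comp[of k n X Y] g.map_comp[of k n "f n X" "f n Y"] fc
      by (subst (1 2 3) Comp_apply) auto
  qed
qed

lemma omega_functor_Id:
  assumes "positive_opetopic_cardinal S"
  shows "omega_functor (star S) (star S) (Id pOpeCard_omega S)"
proof -
  interpret omega_category "star S" using assms by (rule omega_category_star)
  show ?thesis
    by unfold_locales
      (use dom_cell cod_cell id_cell comp_cell in \<open>auto simp: pOpeCard_omega_def\<close>)
qed

lemma category_pOpeCard_omega: "category pOpeCard_omega"
proof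
  fix X :: "'a hypergraph" assume "X \<in> Ob pOpeCard_omega"
  then show "Id pOpeCard_omega X \<in> Hom pOpeCard_omega X X"
    by (simp add: Ob_iff Hom_iff omega_functor_Id)
next
  fix X Y Z :: "'a hypergraph" and f g
  assume "f \<in> Hom pOpeCard_omega X Y" "g \<in> Hom pOpeCard_omega Y Z"
  then show "Comp pOpeCard_omega X Y Z g f \<in> Hom pOpeCard_omega X Z"
    by (simp add: Hom_iff omega_functor_Comp)
next
  fix X Y :: "'a hypergraph" and f
  assume "X \<in> Ob pOpeCard_omega" "Y \<in> Ob pOpeCard_omega" "f \<in> Hom pOpeCard_omega X Y"
  then have f: "omega_functor (star X) (star Y) f" and XY: "positive_opetopic_cardinal X" "positive_opetopic_cardinal Y"
    by (auto simp: Hom_iff Ob_iff)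
  have fc: "x \<in> cells (star X) n \<Longrightarrow> f n x \<in> cells (star Y) n" for n x
    using omega_functor.map_cells[OF f] by blast
  show "Comp pOpeCard_omega X Y Y (Id pOpeCard_omega Y) f = f"
    by (rule functor_eqI[OF omega_functor_Comp[OF f omega_functor_Id[OF XY(2)]] f])
      (simp add: Comp_apply Id_apply fc)
  show "Comp pOpeCard_omega X X Y f (Id pOpeCard_omega X) = f"
    by (rule functor_eqI[OF omega_functor_Comp[OF omega_functor_Id[OF XY(1)] f] f])
      (simp add: Comp_apply Id_apply)
next
  fix W X Y Z :: "'a hypergraph" and f g h
  assume "f \<in> Hom pOpeCard_omega W X" "g \<in> Hom pOpeCard_omega X Y" "h \<in> Hom pOpeCard_omega Y Z"
  then have fgh: "omega_functor (star W) (star X) f" "omega_functor (star X) (star Y) g" "omega_functor (star Y) (star Z) h"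
    by (auto simp: Hom_iff)
  have fc: "x \<in> cells (star W) n \<Longrightarrow> f n x \<in> cells (star X) n" for n x
    using omega_functor.map_cells[OF fgh(1)] by blast
  show "Comp pOpeCard_omega W Y Z h (Comp pOpeCard_omega W X Y g f) =
      Comp pOpeCard_omega W X Z (Comp pOpeCard_omega X Y Z h g) f"
    by (rule functor_eqI[of "star W" "star Z"])
      (use fgh in \<open>auto intro!: omega_functor_Comp simp: Comp_apply fc\<close>)
qed

lemma star_functorI:
  "S \<in> Ob pOpeCard_omega \<Longrightarrow> T \<in> Ob pOpeCard_omega \<Longrightarrow> f \<in> Hom pOpeCard_omega S T \<Longrightarrow> star_functor S T f"
  by (simp add: Ob_iff Hom_iff star_functor_def)

text \<open>The image of \<open>X\<close> may have smaller dimension than \<open>X\<close>, so the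
  two sides apply \<open>g\<close> in possibly different dimensions; \<open>cell_eq\<close>
  reconciles them.\<close>

lemma image_cell_Comp:
  assumes f: "star_functor S T f" and g: "star_functor T U g" and X: "subcell X S"
  shows "image_cell X (Comp pOpeCard_omega S T U g f) = image_cell (image_cell X f) g"
proof -
  interpret f: star_functor S T f by fact
  interpret g: star_functor T U g by fact
  have "X \<in> cells (star S) (hdim X)" using X by (simp add: cells_star)
  then show ?thesis
    using g.cell_eq[OF f.subcell_image[OF X]] by (simp add: image_cell_def Comp_apply)
qed

context positive_opetopic_cardinal
begin

lemma subcell_self: "subcell S S"
  by (rule subcell_refl) (rule positive_opetopic_cardinal_axioms)

lemma subcell_principal: "a \<in> faces S k \<Longrightarrow> subcell (principal S a) S"
  using subcell_principal_self positive_opetopic_cardinal_axioms by blast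

lemma principal_eqD:
  assumes "a \<in> faces S k" "b \<in> faces S k" "principal S a = principal S b" shows "a = b"
  using principal_faces_top[OF assms(1)] principal_faces_top[OF assms(2)] assms(3) by simp

lemma hdim_principal:
  assumes a: "a \<in> faces S k" shows "hdim (principal S a) = k"
proof -
  interpret P: positive_opetopic_cardinal "principal S a"
    using subcell_principal[OF a] by (rule subcell_poc)
  have "hdim (principal S a) \<le> k" using P.hdim_le_iff principal_faces_above[OF a] by blast
  moreover have "\<not> hdim (principal S a) < k"
    using P.hdim_le_iff[of "hdim (principal S a)"] principal_faces_top[OF a] by auto
  ultimately show ?thesis by simp
qed

text \<open>Since \<gamma>(a) and \<delta>(a) can be read off from the codomain and domain of the
  principal cell, a functor that permutes principal cells must respect them.\<close>

lemma faces_hcod_principal: "a \<in> faces S (Suc k) \<Longrightarrow> faces (hcod k (principal S a)) k = {gam S a}"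
  and faces_hdom_principal: "a \<in> faces S (Suc k) \<Longrightarrow> faces (hdom k (principal S a)) k = del S a"
proof -
  assume a: "a \<in> faces S (Suc k)"
  have "delU (principal S a) = delU S" by (rule gam_del_cong) simp_all
  with gam_notin_del[OF a] principal_faces_top[OF a] principal_faces_below[OF a]
  show "faces (hcod k (principal S a)) k = {gam S a}" "faces (hdom k (principal S a)) k = del S a"
    unfolding faces_hcod faces_hdom by (auto simp del: principal_simps(3) simp: delU_def)
qed

end

section \<open>Isomorphisms are both inner and outer\<close>

locale inverse_functors = F: star_functor S T f + G: star_functor T S h
  for S :: "'a hypergraph" and T :: "'b hypergraph" and f h +
  assumes left_inverse: "X \<in> cells (star S) n \<Longrightarrow> h n (f n X) = X"
    and right_inverse: "Y \<in> cells (star T) n \<Longrightarrow> f n (h n Y) = Y"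
begin

lemma image_left_inverse:
  assumes X: "subcell X S" shows "image_cell (image_cell X f) h = X"
  using left_inverse[of X "hdim X"] G.cell_eq[OF F.subcell_image[OF X]] X
  by (simp add: cells_star image_cell_def)

lemma image_right_inverse:
  assumes Y: "subcell Y T" shows "image_cell (image_cell Y h) f = Y"
  using right_inverse[of Y "hdim Y"] F.cell_eq[OF G.subcell_image[OF Y]] Y
  by (simp add: cells_star image_cell_def)

lemma image_all: "image_cell S f = T"
proof (rule subcell_antisym[of _ T])
  show "subcell (image_cell S f) T" by (rule F.subcell_image(1)[OF F.S.subcell_self])
  show "subcell T T" by (rule F.T.subcell_self)
  show "faces (image_cell S f) k \<subseteq> faces T k" for k
    using subcell_faces[OF F.subcell_image(1)[OF F.S.subcell_self]] by blast
  show "faces T k \<subseteq> faces (image_cell S f) k" for k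
    using F.image_subset[OF G.subcell_image(1)[OF F.T.subcell_self]]
      image_right_inverse[OF F.T.subcell_self] by simp
qed

text \<open>The face a of \<open>image_cell W h\<close> is covered by the image of some principal
  cell of b in \<open>W\<close>. Leastness of the principal cell of a and monotonicity of
  \<open>f\<close> put \<open>W\<close> inside the principal cell of b, hence they are equal.
  Dimensions agree because neither functor raises them.\<close>

lemma image_principal:
  assumes a: "a \<in> faces S k"
  obtains b where "b \<in> faces T k" "image_cell (principal S a) f = principal T b"
proof -
  let ?P = "principal S a"
  define W where "W = image_cell ?P f"
  have P: "subcell ?P S" using a by (rule F.S.subcell_principal)
  have W: "subcell W T" unfolding W_def using P by (rule F.subcell_image)
  have hW: "image_cell W h = ?P" unfolding W_def using P by (rule image_left_inverse)
  have "a \<in> faces (image_cell W h) k" unfolding hW using F.S.principal_faces_top[OF a] by simp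
  then obtain j b where b: "b \<in> faces W j" "a \<in> faces (image_cell (principal T b) h) k"
    by (rule G.image_covered[OF W])
  have bT: "b \<in> faces T j" using subcell_faces[OF W b(1)] .
  let ?Q = "principal T b"
  have Q: "subcell ?Q T" using bT by (rule F.T.subcell_principal)
  have hQ: "subcell (image_cell ?Q h) S" using Q by (rule G.subcell_image)
  have "faces W l \<subseteq> faces ?Q l" for l
    using F.image_mono[OF P hQ F.S.principal_least[OF hQ b(2)]] image_right_inverse[OF Q]
    by (simp add: W_def)
  moreover have "faces ?Q l \<subseteq> faces W l" for l using F.T.principal_least[OF W b(1)] .
  ultimately have WQ: "W = ?Q" using subcell_antisym[OF W Q] by blast
  have "hdim W \<le> hdim ?P" unfolding W_def using P by (rule F.subcell_image)
  moreover have "hdim ?P \<le> hdim W" using G.subcell_image(2)[OF W] hW by simp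
  ultimately have "j = k"
    using F.S.hdim_principal[OF a] F.T.hdim_principal[OF bT] WQ by simp
  with bT have "b \<in> faces T k" by simp
  then show ?thesis using WQ unfolding W_def by (rule that)
qed

end

lemma (in inverse_functors) inverse: "inverse_functors T S h f"
  by unfold_locales (auto intro: left_inverse right_inverse)

context inverse_functors
begin

interpretation I: inverse_functors T S h f by (rule inverse)

text \<open>The choice is forced: by \<open>principal_eqD\<close> a principal cell determines its
  generator among the faces of one dimension.\<close>

definition face_map :: "nat \<Rightarrow> 'a \<Rightarrow> 'b" where
  "face_map k a = (SOME b. b \<in> faces T k \<and> image_cell (principal S a) f = principal T b)"

lemma face_map:
  assumes "a \<in> faces S k"
  shows "face_map k a \<in> faces T k" "image_cell (principal S a) f = principal T (face_map k a)"
proof -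
  obtain b where "b \<in> faces T k \<and> image_cell (principal S a) f = principal T b"
    using image_principal[OF assms] by blast
  then have "face_map k a \<in> faces T k \<and> image_cell (principal S a) f = principal T (face_map k a)"
    unfolding face_map_def by (rule someI)
  then show "face_map k a \<in> faces T k" "image_cell (principal S a) f = principal T (face_map k a)"
    by blast+
qed

text \<open>A preimage of c is the generator of the principal cell that \<open>h\<close> assigns to
  c; it lies in \<open>X\<close> because \<open>h\<close> sends the image of \<open>X\<close> back
  to \<open>X\<close>.\<close>

lemma faces_image:
  assumes X: "subcell X S" shows "faces (image_cell X f) l = face_map l ` faces X l"
proof
  show "face_map l ` faces X l \<subseteq> faces (image_cell X f) l"
  proof
    fix b assume "b \<in> face_map l ` faces X l"
    then obtain a where a: "a \<in> faces X l" "b = face_map l a" by blast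
    have aS: "a \<in> faces S l" using subcell_faces[OF X a(1)] .
    then have "b \<in> faces (image_cell (principal S a) f) l"
      using face_map[OF aS] F.T.principal_faces_top a(2) by simp
    then show "b \<in> faces (image_cell X f) l" using F.image_principal_subset[OF X a(1)] by blast
  qed
  show "faces (image_cell X f) l \<subseteq> face_map l ` faces X l"
  proof
    fix c assume c: "c \<in> faces (image_cell X f) l"
    have fX: "subcell (image_cell X f) T" using X by (rule F.subcell_image)
    have cT: "c \<in> faces T l" using subcell_faces[OF fX c] .
    obtain a where a: "a \<in> faces S l" "image_cell (principal T c) h = principal S a"
      using I.image_principal[OF cT] .
    have "principal T (face_map l a) = principal T c"
      using face_map[OF a(1)] image_right_inverse[OF F.T.subcell_principal[OF cT]] a(2) by simp
    then have "face_map l a = c" using F.T.principal_eqD[OF face_map(1)[OF a(1)] cT] by simp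
    moreover have "a \<in> faces X l"
      using G.image_principal_subset[OF fX c, of l] a(2) image_left_inverse[OF X]
        F.S.principal_faces_top[OF a(1)] by auto
    ultimately show "c \<in> face_map l ` faces X l" by blast
  qed
qed

lemma hmorphism_face_map: "hmorphism S T face_map"
  unfolding hmorphism_def
proof (intro conjI allI ballI)
  show "face_map k \<in> faces S k \<rightarrow> faces T k" for k using face_map by blast
  fix k a assume a: "a \<in> faces S (Suc k)"
  let ?b = "face_map (Suc k) a"
  note b = face_map[OF a]
  have P: "subcell (principal S a) S" using a by (rule F.S.subcell_principal)
  have PP: "subcell (hcod k (principal S a)) S" "subcell (hdom k (principal S a)) S"
    using positive_opetopic_cardinal.subcell_hcod[OF subcell_poc[OF P]]
      positive_opetopic_cardinal.subcell_hdom[OF subcell_poc[OF P]] P subcell_trans by blast+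
  have "face_map k ` {gam S a} = {gam T ?b}"
    using faces_image[OF PP(1), of k] F.image_hcod[OF P] b
      F.S.faces_hcod_principal[OF a] F.T.faces_hcod_principal[OF b(1)] by simp
  then show "face_map k (gam S a) = gam T ?b" by simp
  have "face_map k ` del S a = del T ?b"
    using faces_image[OF PP(2), of k] F.image_hdom[OF P] b
      F.S.faces_hdom_principal[OF a] F.T.faces_hdom_principal[OF b(1)] by simp
  moreover have "inj_on (face_map k) (del S a)"
  proof (rule inj_onI)
    fix x y assume xy: "x \<in> del S a" "y \<in> del S a" "face_map k x = face_map k y"
    have x: "x \<in> faces S k" and y: "y \<in> faces S k" using xy F.S.del_face[OF a] by blast+
    have "principal S x = principal S y"
      using image_left_inverse[OF F.S.subcell_principal[OF x]]
        image_left_inverse[OF F.S.subcell_principal[OF y]] face_map(2)[OF x] face_map(2)[OF y] xy(3)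
      by simp
    then show "x = y" using F.S.principal_eqD[OF x y] by simp
  qed
  ultimately show "bij_betw (face_map k) (del S a) (del T ?b)" by (simp add: bij_betw_def)
qed

lemma star_map_face_map: "f = star_map S T face_map"
proof
  fix n
  show "f n = star_map S T face_map n"
  proof (rule extensionalityI[of _ "cells (star S) n"])
    show "f n \<in> extensional (cells (star S) n)" using F.map_cells[of n] by (simp add: PiE_def)
    show "star_map S T face_map n \<in> extensional (cells (star S) n)" by (simp add: star_map_def)
    fix X assume Xn: "X \<in> cells (star S) n"
    then have X: "subcell X S" and "hdim X \<le> n" by (auto simp: cells_star)
    then have fX: "f n X = image_cell X f" by (rule F.cell_eq)
    have "subcell (image_cell X f) T" using X by (rule F.subcell_image)
    from subcell_gam[OF this] subcell_del[OF this] show "f n X = star_map S T face_map n X"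
      unfolding fX using faces_image[OF X] Xn by (intro hypergraph_eqI) (simp_all add: star_map_def)
  qed
qed

end

lemma isosD:
  assumes "S \<in> Ob pOpeCard_omega" "T \<in> Ob pOpeCard_omega" "f \<in> isos pOpeCard_omega S T"
  obtains h where "inverse_functors S T f h"
proof -
  from assms obtain h where h: "f \<in> Hom pOpeCard_omega S T" "h \<in> Hom pOpeCard_omega T S"
    "Comp pOpeCard_omega S T S h f = Id pOpeCard_omega S"
    "Comp pOpeCard_omega T S T f h = Id pOpeCard_omega T"
    by (auto simp: isos_def)
  have "h n (f n X) = X" if "X \<in> cells (star S) n" for n X
    using Comp_apply[OF that, of T S h f] Id_apply[OF that] h(3) by simp
  moreover have "f n (h n Y) = Y" if "Y \<in> cells (star T) n" for n Y
    using Comp_apply[OF that, of S T f h] Id_apply[OF that] h(4) by simp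
  moreover have "star_functor S T f" "star_functor T S h"
    using star_functorI assms(1,2) h(1,2) by blast+
  ultimately have "inverse_functors S T f h"
    by (simp add: inverse_functors_def inverse_functors_axioms_def)
  then show ?thesis by (rule that)
qed

section \<open>The factorization system\<close>

lemma cells_star_trans:
  assumes "subcell Z T" "X \<in> cells (star Z) n" shows "X \<in> cells (star T) n"
  using assms subcell_trans by (auto simp: cells_star)

lemma star_map_inclusion:
  assumes Z: "subcell Z T" and X: "X \<in> cells (star Z) n"
  shows "star_map Z T (\<lambda>k x. x) n X = X"
proof -
  have "subcell X T" using cells_star_trans[OF assms] by (simp add: cells_star)
  then show ?thesis
    using X subcell_gam[of X T] subcell_del[of X T]
    by (intro hypergraph_eqI) (simp_all add: star_map_def)
qed

lemma omega_functor_inclusion: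
  assumes T: "positive_opetopic_cardinal T" and Z: "subcell Z T"
  shows "omega_functor (star Z) (star T) (star_map Z T (\<lambda>k x. x))"
proof -
  interpret T: omega_category "star T" using T by (rule omega_category_star)
  interpret Z: omega_category "star Z" using subcell_poc[OF Z] by (rule omega_category_star)
  let ?i = "star_map Z T (\<lambda>k x. x)"
  note [simp] = star_map_inclusion[OF Z]
  show ?thesis
  proof unfold_locales
    show "?i n \<in> cells (star Z) n \<rightarrow>\<^sub>E cells (star T) n" for n
    proof (rule PiE_I)
      show "?i n X \<in> cells (star T) n" if "X \<in> cells (star Z) n" for X
        using cells_star_trans[OF Z that] that by simp
      show "?i n X = undefined" if "X \<notin> cells (star Z) n" for X
        using that by (simp add: star_map_def)
    qed
  next
    fix k n X assume *: "k < n" "X \<in> cells (star Z) n"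
    show "?i k (cdom (star Z) n k X) = cdom (star T) n k (?i n X)"
      using Z.dom_cell[OF *] * by simp
    show "?i k (ccod (star Z) n k X) = ccod (star T) n k (?i n X)"
      using Z.cod_cell[OF *] * by simp
  next
    fix k n X assume *: "k < n" "X \<in> cells (star Z) k"
    show "?i n (cid (star Z) k n X) = cid (star T) k n (?i k X)"
      using Z.id_cell[OF *] * by simp
  next
    fix k n X Y assume *: "k < n" "X \<in> cells (star Z) n" "Y \<in> cells (star Z) n"
      "ccod (star Z) n k X = cdom (star Z) n k Y"
    show "?i n (ccomp (star Z) n k X Y) = ccomp (star T) n k (?i n X) (?i n Y)"
      using Z.comp_cell[OF *] * by simp
  qed
qed

lemma inclusion_outer:
  assumes "positive_opetopic_cardinal T" "subcell Z T"
  shows "star_map Z T (\<lambda>k x. x) \<in> outer Z T"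
proof -
  have "hmorphism Z T (\<lambda>k x. x)"
    using subcell_faces[OF assms(2)] subcell_gam[OF assms(2)] subcell_del[OF assms(2)]
    by (auto simp: hmorphism_def bij_betw_def)
  then show ?thesis
    unfolding outer_def Hom_iff using omega_functor_inclusion[OF assms] by blast
qed

text \<open>The inner factor is the lift of \<open>f\<close> along the inclusion of its image. The
  range condition is \<open>image_subset\<close>, and the lift has the same values on cells as
  \<open>f\<close>.\<close>

lemma image_factorization:
  assumes S: "S \<in> Ob pOpeCard_omega" and T: "T \<in> Ob pOpeCard_omega" and f: "f \<in> Hom pOpeCard_omega S T"
  shows "image_cell S f \<in> Ob pOpeCard_omega"
    and "\<exists>e\<in>inner S (image_cell S f). \<exists>m\<in>outer (image_cell S f) T.
      Comp pOpeCard_omega S (image_cell S f) T m e = f"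
proof -
  interpret star_functor S T f using assms by (rule star_functorI)
  let ?Z = "image_cell S f"
  let ?m = "star_map ?Z T (\<lambda>k x. x)"
  have Z: "subcell ?Z T" by (rule subcell_image[OF S.subcell_self])
  show ZO: "?Z \<in> Ob pOpeCard_omega" using Z by (simp add: Ob_iff subcell_poc)
  have m: "omega_functor (star ?Z) (star T) ?m"
    using T Z by (simp add: Ob_iff omega_functor_inclusion)
  have cell: "f n X \<in> cells (star ?Z) n" if X: "X \<in> cells (star S) n" for n X
  proof -
    have X': "subcell X S" "hdim X \<le> n" using X by (auto simp: cells_star)
    then have "f n X = image_cell X f" by (rule cell_eq)
    moreover have "subcell (image_cell X f) ?Z"
      using subcell_subcell[OF subcell_image(1)[OF X'(1)] Z] image_subset[OF X'(1)] by blast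
    ultimately show ?thesis using subcell_image(2)[OF X'(1)] X'(2) by (simp add: cells_star)
  qed
  have inj: "inj_on (?m n) (cells (star ?Z) n)" for n
    by (rule inj_onI) (simp add: star_map_inclusion[OF Z])
  have "f n X \<in> ?m n ` cells (star ?Z) n" if "X \<in> cells (star S) n" for n X
    using cell[OF that] star_map_inclusion[OF Z] by (metis image_eqI)
  then obtain e where e: "omega_functor (star S) (star ?Z) e"
    "\<And>n X. X \<in> cells (star S) n \<Longrightarrow> ?m n (e n X) = f n X"
    using functor_lift[OF omega_functor_axioms m inj] by blast
  have ef: "e n X = f n X" if "X \<in> cells (star S) n" for n X
    using e(2)[OF that] star_map_inclusion[OF Z] omega_functor.map_cells[OF e(1), of n] that
    by (metis PiE_mem)
  have "e (hdim S) S = f (hdim S) S" by (rule ef) (simp add: cells_star S.subcell_self)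
  then have "e \<in> inner S ?Z" using e(1) by (simp add: inner_def Hom_iff image_cell_def)
  moreover have "?m \<in> outer ?Z T" using inclusion_outer Z T by (simp add: Ob_iff)
  moreover have "Comp pOpeCard_omega S ?Z T ?m e = f"
    by (rule functor_eqI[OF omega_functor_Comp[OF e(1) m] omega_functor_axioms])
      (simp add: Comp_apply e(2))
  ultimately show "\<exists>e\<in>inner S ?Z. \<exists>m\<in>outer ?Z T. Comp pOpeCard_omega S ?Z T m e = f" by blast
qed

text \<open>Since \<open>e\<close> is inner, the image of \<open>B\<close> under \<open>v\<close> is
  the image under \<open>m\<close> of a cell of \<open>X\<close>. By monotonicity all values of
  \<open>v\<close> lie in the range of \<open>m\<close>, so \<open>v\<close> lifts; injectivity of
  \<open>m\<close> gives the other triangle and uniqueness.\<close>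

lemma unique_diagonal:
  assumes A: "A \<in> Ob pOpeCard_omega" and B: "B \<in> Ob pOpeCard_omega"
    and X: "X \<in> Ob pOpeCard_omega" and Y: "Y \<in> Ob pOpeCard_omega"
    and e: "e \<in> inner A B" and m: "m \<in> outer X Y"
    and u: "u \<in> Hom pOpeCard_omega A X" and v: "v \<in> Hom pOpeCard_omega B Y"
    and eq: "Comp pOpeCard_omega A X Y m u = Comp pOpeCard_omega A B Y v e"
  shows "\<exists>!w. w \<in> Hom pOpeCard_omega B X \<and>
    Comp pOpeCard_omega A B X w e = u \<and> Comp pOpeCard_omega B X Y m w = v"
proof -
  obtain g where g: "hmorphism X Y g" "m = star_map X Y g" and mH: "m \<in> Hom pOpeCard_omega X Y"
    using m by (auto simp: outer_def)
  have eH: "e \<in> Hom pOpeCard_omega A B" and eB: "image_cell A e = B" using e by (auto simp: inner_def)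
  interpret e: star_functor A B e using A B eH by (rule star_functorI)
  interpret m: star_functor X Y m using X Y mH by (rule star_functorI)
  interpret u: star_functor A X u using A X u by (rule star_functorI)
  interpret v: star_functor B Y v using B Y v by (rule star_functorI)
  interpret g: hypergraph_map X Y g
    using X Y g(1) by (simp add: hypergraph_map_def hypergraph_map_axioms_def Ob_iff)
  have inj: "inj_on (m n) (cells (star X) n)" for n
    unfolding g(2) by (rule g.star_map_inj)
  have vB: "image_cell B v = image_cell (image_cell A u) m"
    using image_cell_Comp[OF u.star_functor_axioms m.star_functor_axioms e.S.subcell_self]
      image_cell_Comp[OF e.star_functor_axioms v.star_functor_axioms e.S.subcell_self] eq eB by simp
  have uA: "subcell (image_cell A u) X" by (rule u.subcell_image[OF e.S.subcell_self])
  have "faces (image_cell B v) k \<subseteq> g k ` faces X k" for k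
  proof -
    have "image_cell A u \<in> cells (star X) (hdim (image_cell A u))" using uA by (simp add: cells_star)
    then have "faces (image_cell B v) k = g k ` faces (image_cell A u) k"
      unfolding vB by (simp add: image_cell_def[of "image_cell A u"] g(2) star_map_def)
    then show ?thesis using subcell_faces[OF uA] by auto
  qed
  then have range: "v n Z \<in> m n ` cells (star X) n" if "Z \<in> cells (star B) n" for n Z
  proof -
    have Z: "subcell Z B" "hdim Z \<le> n" using that by (auto simp: cells_star)
    have "faces (image_cell Z v) k \<subseteq> g k ` faces X k" for k
      using v.image_subset[OF Z(1), of k] \<open>\<And>k. _ \<subseteq> g k ` faces X k\<close>[of k] by blast
    then show ?thesis unfolding v.cell_eq[OF Z] g(2)
      using g.preimage[OF v.subcell_image(1)[OF Z(1)]] v.subcell_image(2)[OF Z(1)] Z(2) le_trans by blast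
  qed
  obtain w where w: "omega_functor (star B) (star X) w"
    "\<And>n Z. Z \<in> cells (star B) n \<Longrightarrow> m n (w n Z) = v n Z"
    using functor_lift[OF v.omega_functor_axioms m.omega_functor_axioms inj range] by blast
  have wc: "Z \<in> cells (star B) n \<Longrightarrow> w n Z \<in> cells (star X) n" for n Z
    using omega_functor.map_cells[OF w(1)] by blast
  show ?thesis
  proof (rule ex1I[of _ w], intro conjI)
    show "w \<in> Hom pOpeCard_omega B X" using w(1) by (simp add: Hom_iff)
    show "Comp pOpeCard_omega A B X w e = u"
    proof (rule functor_eqI[OF omega_functor_Comp[OF e.omega_functor_axioms w(1)] u.omega_functor_axioms])
      fix n Z assume Z: "Z \<in> cells (star A) n"
      have "m n (w n (e n Z)) = m n (u n Z)"
        using w(2)[OF e.image_cells[OF Z]] fun_cong[OF fun_cong[OF eq, of n], of Z] Z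
        by (simp add: Comp_apply)
      then have "w n (e n Z) = u n Z"
        by (rule inj_onD[OF inj _ wc[OF e.image_cells[OF Z]] u.image_cells[OF Z]])
      then show "Comp pOpeCard_omega A B X w e n Z = u n Z" using Z by (simp add: Comp_apply)
    qed
    show "Comp pOpeCard_omega B X Y m w = v"
      by (rule functor_eqI[OF omega_functor_Comp[OF w(1) m.omega_functor_axioms] v.omega_functor_axioms])
        (simp add: Comp_apply w(2))
  next
    fix w' assume w': "w' \<in> Hom pOpeCard_omega B X \<and>
      Comp pOpeCard_omega A B X w' e = u \<and> Comp pOpeCard_omega B X Y m w' = v"
    show "w' = w"
    proof (rule functor_eqI[OF _ w(1)])
      show w'F: "omega_functor (star B) (star X) w'" using w' by (simp add: Hom_iff)
      fix n Z assume Z: "Z \<in> cells (star B) n"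
      have "w' n Z \<in> cells (star X) n" using omega_functor.map_cells[OF w'F] Z by blast
      moreover have "m n (w' n Z) = m n (w n Z)" using w' w(2)[OF Z] Z by (metis Comp_apply)
      ultimately show "w' n Z = w n Z" using inj wc[OF Z] by (meson inj_onD)
    qed
  qed
qed

lemma inner_Comp:
  assumes "X \<in> Ob pOpeCard_omega" "Y \<in> Ob pOpeCard_omega" "Z \<in> Ob pOpeCard_omega"
    and f: "f \<in> inner X Y" and g: "g \<in> inner Y Z"
  shows "Comp pOpeCard_omega X Y Z g f \<in> inner X Z"
proof -
  have fg: "omega_functor (star X) (star Y) f" "omega_functor (star Y) (star Z) g"
    "image_cell X f = Y" "image_cell Y g = Z" using f g by (auto simp: inner_def Hom_iff)
  have "star_functor X Y f" "star_functor Y Z g" "subcell X X"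
    using assms(1-3) fg(1,2) by (auto simp: Ob_iff Hom_iff intro: star_functorI subcell_refl)
  then have "image_cell X (Comp pOpeCard_omega X Y Z g f) = Z"
    using image_cell_Comp fg(3,4) by metis
  then show ?thesis using fg(1,2) by (simp add: inner_def Hom_iff omega_functor_Comp)
qed

lemma outer_Comp:
  assumes f: "f \<in> outer X Y" and g: "g \<in> outer Y Z"
  shows "Comp pOpeCard_omega X Y Z g f \<in> outer X Z"
proof -
  from f g obtain p q where p: "hmorphism X Y p" "f = star_map X Y p" and q: "hmorphism Y Z q" "g = star_map Y Z q"
    and fg: "omega_functor (star X) (star Y) f" "omega_functor (star Y) (star Z) g"
    by (auto simp: outer_def Hom_iff)
  have "hmorphism X Z (\<lambda>k. q k \<circ> p k)"
    using p(1) q(1) unfolding hmorphism_def by (fastforce intro: bij_betw_trans)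
  moreover have "Comp pOpeCard_omega X Y Z g f = star_map X Z (\<lambda>k. q k \<circ> p k)"
  proof (intro ext)
    fix n C
    show "Comp pOpeCard_omega X Y Z g f n C = star_map X Z (\<lambda>k. q k \<circ> p k) n C"
    proof (cases "C \<in> cells (star X) n")
      case True
      then have "f n C \<in> cells (star Y) n" using omega_functor.map_cells[OF fg(1)] by blast
      with True show ?thesis by (simp add: Comp_apply p(2) q(2) star_map_def image_comp)
    next
      case False
      then show ?thesis by (simp add: star_map_def pOpeCard_omega_def compose_def)
    qed
  qed
  ultimately show ?thesis using omega_functor_Comp[OF fg] by (auto simp: outer_def Hom_iff)
qed

lemma factorization_system_inner_outer: "factorization_system pOpeCard_omega inner outer"
proof -
  interpret category pOpeCard_omega by (rule category_pOpeCard_omega)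
  show ?thesis
  proof
    fix X Y :: "'a hypergraph"
    assume XY: "X \<in> Ob pOpeCard_omega" "Y \<in> Ob pOpeCard_omega"
    show "inner X Y \<subseteq> Hom pOpeCard_omega X Y" "outer X Y \<subseteq> Hom pOpeCard_omega X Y"
      by (auto simp: inner_def outer_def)
    show "isos pOpeCard_omega X Y \<subseteq> inner X Y"
    proof
      fix f assume f: "f \<in> isos pOpeCard_omega X Y"
      obtain h where "inverse_functors X Y f h" by (rule isosD[OF XY f])
      then show "f \<in> inner X Y"
        using inverse_functors.image_all f by (auto simp: inner_def isos_def)
    qed
    show "isos pOpeCard_omega X Y \<subseteq> outer X Y"
    proof
      fix f assume f: "f \<in> isos pOpeCard_omega X Y"
      obtain h where "inverse_functors X Y f h" by (rule isosD[OF XY f])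
      then show "f \<in> outer X Y"
        using inverse_functors.hmorphism_face_map inverse_functors.star_map_face_map f
        unfolding outer_def isos_def by blast
    qed
    show "\<exists>Z\<in>Ob pOpeCard_omega. \<exists>e\<in>inner X Z. \<exists>m\<in>outer Z Y. Comp pOpeCard_omega X Z Y m e = f"
      if "f \<in> Hom pOpeCard_omega X Y" for f
      using image_factorization[OF XY that] by blast
  next
    fix X Y Z :: "'a hypergraph" and f g
    assume "X \<in> Ob pOpeCard_omega" "Y \<in> Ob pOpeCard_omega" "Z \<in> Ob pOpeCard_omega"
    then show "Comp pOpeCard_omega X Y Z g f \<in> inner X Z" if "f \<in> inner X Y" "g \<in> inner Y Z"
      using that by (rule inner_Comp)
    show "Comp pOpeCard_omega X Y Z g f \<in> outer X Z" if "f \<in> outer X Y" "g \<in> outer Y Z"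
      using that by (rule outer_Comp)
  qed (rule unique_diagonal)
qed

text \<open>The diagonals of the two mixed squares are mutually inverse, because their composites
  and the identities solve the same diagonal problems.\<close>

lemma (in factorization_system) factorization_unique:
  assumes X: "X \<in> Ob C" and Y: "Y \<in> Ob C" and I: "I \<in> Ob C" and U: "U \<in> Ob C"
    and e: "e \<in> E X I" and m: "m \<in> M I Y" and e': "e' \<in> E X U" and m': "m' \<in> M U Y"
    and eq: "Comp C X U Y m' e' = Comp C X I Y m e"
  shows "\<exists>!h. h \<in> isos C I U \<and> Comp C X I U h e = e' \<and> Comp C I U Y m' h = m"
proof -
  have H: "e \<in> Hom C X I" "m \<in> Hom C I Y" "e' \<in> Hom C X U" "m' \<in> Hom C U Y"
    using E_Hom M_Hom X Y I U e m e' m' by blast+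
  have diag: "\<exists>!h. h \<in> Hom C I U \<and> Comp C X I U h e = e' \<and> Comp C I U Y m' h = m"
    by (rule orthogonality) (use assms H in auto)
  have diag': "\<exists>!h. h \<in> Hom C U I \<and> Comp C X U I h e' = e \<and> Comp C U I Y m h = m'"
    by (rule orthogonality) (use assms H in auto)
  have diag_I: "\<exists>!h. h \<in> Hom C I I \<and> Comp C X I I h e = e \<and> Comp C I I Y m h = m"
    by (rule orthogonality) (use assms H in auto)
  have diag_U: "\<exists>!h. h \<in> Hom C U U \<and> Comp C X U U h e' = e' \<and> Comp C U U Y m' h = m'"
    by (rule orthogonality) (use assms H in auto)
  from diag obtain h where h: "h \<in> Hom C I U" "Comp C X I U h e = e'" "Comp C I U Y m' h = m" by blast
  from diag' obtain k where k: "k \<in> Hom C U I" "Comp C X U I k e' = e" "Comp C U I Y m k = m'" by blast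
  have "Comp C I U I k h \<in> Hom C I I" using Comp_Hom I U h k by blast
  moreover have "Comp C X I I (Comp C I U I k h) e = e"
    using Comp_assoc[OF X I U I H(1) h(1) k(1)] h k by simp
  moreover have "Comp C I I Y m (Comp C I U I k h) = m"
    using Comp_assoc[OF I U I Y h(1) k(1) H(2)] h k by simp
  ultimately have "Comp C I U I k h = Id C I"
    using diag_I Id_Hom[OF I] Id_left[OF X I H(1)] Id_right[OF I Y H(2)] by blast
  moreover have "Comp C U I U h k \<in> Hom C U U" using Comp_Hom I U h k by blast
  moreover have "Comp C X U U (Comp C U I U h k) e' = e'"
    using Comp_assoc[OF X U I U H(3) k(1) h(1)] h k by simp
  moreover have "Comp C U U Y m' (Comp C U I U h k) = m'"
    using Comp_assoc[OF U I U Y k(1) h(1) H(4)] h k by simp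
  ultimately have "h \<in> isos C I U"
    using diag_U Id_Hom[OF U] Id_left[OF X U H(3)] Id_right[OF U Y H(4)] h(1) k(1)
    unfolding isos_def by blast
  with diag h show ?thesis unfolding isos_def by blast
qed

theorem proposition10p3:
  shows "factorization_system
      (pOpeCard_omega :: ('a hypergraph, nat \<Rightarrow> 'a hypergraph \<Rightarrow> 'a hypergraph) cat) inner outer \<and>
    (\<forall>(S :: 'a hypergraph) (T :: 'a hypergraph) f.
       S \<in> Ob pOpeCard_omega \<longrightarrow> T \<in> Ob pOpeCard_omega \<longrightarrow> f \<in> Hom pOpeCard_omega S T \<longrightarrow>
       image_cell S f \<in> Ob pOpeCard_omega \<and>
       (\<exists>e \<in> inner S (image_cell S f). \<exists>m \<in> outer (image_cell S f) T.
          Comp pOpeCard_omega S (image_cell S f) T m e = f \<and>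
          (\<forall>U \<in> Ob pOpeCard_omega. \<forall>e' \<in> inner S U. \<forall>m' \<in> outer U T.
             Comp pOpeCard_omega S U T m' e' = f \<longrightarrow>
             (\<exists>!h. h \<in> isos pOpeCard_omega (image_cell S f) U \<and>
                Comp pOpeCard_omega S (image_cell S f) U h e = e' \<and>
                Comp pOpeCard_omega (image_cell S f) U T m' h = m))))"
proof (intro conjI allI impI)
  show FS: "factorization_system (pOpeCard_omega :: ('a hypergraph, _) cat) inner outer"
    by (rule factorization_system_inner_outer)
  fix S T :: "'a hypergraph" and f
  assume S: "S \<in> Ob pOpeCard_omega" and T: "T \<in> Ob pOpeCard_omega" and f: "f \<in> Hom pOpeCard_omega S T"
  show I: "image_cell S f \<in> Ob pOpeCard_omega" using S T f by (rule image_factorization)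
  obtain e m where em: "e \<in> inner S (image_cell S f)" "m \<in> outer (image_cell S f) T"
    "Comp pOpeCard_omega S (image_cell S f) T m e = f"
    using image_factorization[OF S T f] by blast
  then show "\<exists>e \<in> inner S (image_cell S f). \<exists>m \<in> outer (image_cell S f) T.
      Comp pOpeCard_omega S (image_cell S f) T m e = f \<and>
      (\<forall>U \<in> Ob pOpeCard_omega. \<forall>e' \<in> inner S U. \<forall>m' \<in> outer U T.
         Comp pOpeCard_omega S U T m' e' = f \<longrightarrow>
         (\<exists>!h. h \<in> isos pOpeCard_omega (image_cell S f) U \<and>
            Comp pOpeCard_omega S (image_cell S f) U h e = e' \<and>
            Comp pOpeCard_omega (image_cell S f) U T m' h = m))"
    using factorization_system.factorization_unique[OF FS S T I _ em(1,2)]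
    by (intro bexI[OF _ em(1)] bexI[OF _ em(2)] conjI ballI impI) auto
qed

end
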